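(* Let $l>1$ be an integer, let $t_1<t_2<\cdots<t_l$ be real numbers, and let $\lambda:\{1,\dots,l-1\}\to\{0,1\}$ be a map. Let $m$ be a sufficiently large integer. Then there exist a suitable $m$-dimensional non-singular real algebraic connected manifold $M$ with no boundary and a smooth real algebraic function $f:M\to\mathbb{R}$ such that: (1) $f(M)=[t_1,t_l]$, and the image $f(S(f))$ of the singular set $S(f)$ of $f$ is $\{t_1,\dots,t_l\}$. (2) For $1\le j\le l-1$ and $t\in(t_j,t_{j+1})$: if $\lambda(j)=0$, then $f^{-1}(t)$ is closed (compact without boundary) and connected; if $\lambda(j)=1$, then $f^{-1}(t)$ is connected and non-compact and has no boundary. Moreover, for every $t\in f(M)$, $f^{-1}(t)$ is connected and homeomorphic to a CW complex whose dimension is at most $m-1$. Furthermore, for a suitable integer $n>1$ and another sufficiently large integer $m>n$, one can suitably choose such an $m$-dimensional manifold $M$ and such a function $f$ so that $f=\pi_{n,1}\circ g$, where $\pi_{n,1}:\mathbb{R}^n\to\mathbb{R}$, $(x_1,\dots,x_n)\mapsto x_1$, is the canonical projection and $g:M\to\mathbb{R}^n$ is a smooth real algebraic map with the following explicit properties: (i) The image $g(M)$ is the closure $\overline{D}$ of a normal and convenient domain (NCD) $D\subset\mathbb{R}^n$, with associated hypersurfaces $S_1,\dots,S_r$ as in the definition of an NCD given in the context. (ii) $\overline{D}-D$ is a union of finitely many $(n-1)$-dimensional smooth connected submanifolds of the hypersurfaces $S_j$. Each $S_j$ is a connected component of the real algebraic set defined by a single real polynomial of degree at most $2$. More precisely: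 (a) each $S_j$ is an affine subspace of $\mathbb{R}^n$, a connected component of an $(n-1)$-dimensional cylinder of a hyperbola in $\mathbb{R}^n$, or the boundary of some $n$-dimensional ellipsoid in $\mathbb{R}^n$; (b) if $S_{j_0}$ is the boundary of some $n$-dimensional ellipsoid in $\mathbb{R}^n$, then $S_j\cap S_{j_0}=\emptyset$ for every $j\neq j_0$.
   Context: The real algebraic set in $\mathbb{R}^k$ defined by finitely many real polynomials is the common zero set of these polynomials (it is $\mathbb{R}^k$ if there are no polynomials). A real algebraic manifold means a union of connected components of a real algebraic set in some $\mathbb{R}^k$ defined by finitely many real polynomials. It is non-singular if it is a smooth manifold by the implicit function theorem applied to the map whose components are the defining polynomials, i.e. at each of its points that map has differential of full rank. A smooth real algebraic map from such a manifold to $\mathbb{R}^n$ has its standard meaning (for example, the restriction of a polynomial map such as a projection of the ambient affine space); for $n=1$ it is called a smooth real algebraic function. For a smooth map $c:X\to Y$ between smooth manifolds, a point $x\in X$ is singular if the rank of the differential of $c$ at $x$ is smaller than $\min(\dim X,\dim Y)$; $S(c)\subset X$ denotes the set of all singular points of $c$. Normal and convenient domain (NCD): a connected open set $D\subset\mathbb{R}^n$ for which there are an integer $r>0$ and real polynomials $P_1,\dots,P_r$ in $n$ variables such that - $D=\bigcap_{j=1}^r\{x\in\mathbb{R}^n\mid P_j(x)>0\}$ and its closure is $\overline{D}=\bigcap_{j=1}^r\{x\in\mathbb{R}^n\mid P_j(x)\ge 0\}$; - for each $j$, $S_j$ is a connected component of the real algebraic set $\{P_j=0\}$ and is a non-singular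 connected real algebraic hypersurface; - for each $j$, $(\{P_j=0\}-S_j)\cap\overline{D}$ is empty, and $\overline{D}$ is contained in $\mathbb{R}^n-(\{P_j=0\}-S_j)$, which is an open set; - (transversality) for each non-empty $\Lambda\subset\{1,\dots,r\}$, $\bigcap_{j\in\Lambda}S_j$ is empty or a non-singular real algebraic submanifold with no boundary of dimension $n-|\Lambda|$, and at each point $p$ of it, the image of the differential at $p$ of the inclusion $\bigcap_{j\in\Lambda}S_j\to\mathbb{R}^n$ equals the intersection over $j\in\Lambda$ of the images of the differentials at $p$ of the inclusions $S_j\to\mathbb{R}^n$. An affine transformation of $\mathbb{R}^k$ is an invertible linear map composed with a translation. An affine subspace of $\mathbb{R}^k$ is $\mathbb{R}^k$ itself or the image of some $\mathbb{R}^{k_1}\times\{0\}\subset\mathbb{R}^{k_1}\times\mathbb{R}^{k_2}=\mathbb{R}^k$ ($k_1,k_2>0$) under an affine transformation. A $(k-1)$-dimensional cylinder of a hyperbola in $\mathbb{R}^k$ ($k\ge2$) is a set of the form $\{(x_1,x_2)\in\mathbb{R}^2\mid (x_1-a)(x_2-b)=c\}\times\mathbb{R}^{k-2}$ with real $a,b$ and $c\neq0$ (no second factor if $k=2$), or its image under an affine transformation of $\mathbb{R}^k$. A $k$-dimensional ellipsoid in $\mathbb{R}^k$ is a set $\{x\in\mathbb{R}^k\mid\sum_{j=1}^k (x_j-a_j)^2/r_j\le1\}$ with real $a_j$ and $r_j>0$, or its image under an affine transformation of $\mathbb{R}^k$. *)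

theory Defs
  imports "HOL-Analysis.Analysis" "HOL-Library.Function_Algebras" "HOL-Library.Poly_Mapping"
begin

text \<open>
  The dimensions are bound inside the main statement, so \<open>\<real>\<^sup>k\<close> is \<^term>\<open>Euclidean_space k\<close>:
  its points are sequences that vanish from index \<open>k\<close> on, and the coordinates \<open>x\<^sub>1, \<dots>, x\<^sub>k\<close>
  are \<open>x 0, \<dots>, x (k - 1)\<close>. In particular \<open>\<real>\<^sup>k\<^sup>1 \<times> {0} \<subseteq> \<real>\<^sup>k\<close> is literally the point set of
  \<^term>\<open>Euclidean_space k1\<close>.
\<close>

abbreviation Rn :: "nat \<Rightarrow> (nat \<Rightarrow> real) set" where
  "Rn k \<equiv> topspace (Euclidean_space k)"

global_interpretation rvec: vector_space "\<lambda>(a::real) (v::nat \<Rightarrow> real) i. a * v i"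
  by unfold_locales (auto simp: fun_eq_iff algebra_simps)


section \<open>Smooth functions, submanifolds and tangent spaces\<close>

definition partial_deriv :: "nat \<Rightarrow> ((nat \<Rightarrow> real) \<Rightarrow> real) \<Rightarrow> (nat \<Rightarrow> real) \<Rightarrow> real" where
  "partial_deriv i h x = deriv (\<lambda>s. h (x(i := s))) (x i)"

fun iter_partial_deriv :: "nat list \<Rightarrow> ((nat \<Rightarrow> real) \<Rightarrow> real) \<Rightarrow> (nat \<Rightarrow> real) \<Rightarrow> real" where
  "iter_partial_deriv [] h = h"
| "iter_partial_deriv (i # is) h = partial_deriv i (iter_partial_deriv is h)"

definition smooth_fun_on :: "nat \<Rightarrow> (nat \<Rightarrow> real) set \<Rightarrow> ((nat \<Rightarrow> real) \<Rightarrow> real) \<Rightarrow> bool" where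
  "smooth_fun_on k U h \<longleftrightarrow> openin (Euclidean_space k) U \<and>
     (\<forall>is. set is \<subseteq> {..<k} \<longrightarrow>
        continuous_map (subtopology (Euclidean_space k) U) euclideanreal (iter_partial_deriv is h) \<and>
        (\<forall>x\<in>U. \<forall>i<k. (\<lambda>s. iter_partial_deriv is h (x(i := s))) differentiable (at (x i))))"

definition diffeomorphism ::
  "nat \<Rightarrow> (nat \<Rightarrow> real) set \<Rightarrow> (nat \<Rightarrow> real) set \<Rightarrow> ((nat \<Rightarrow> real) \<Rightarrow> nat \<Rightarrow> real) \<Rightarrow> bool" where
  "diffeomorphism k U V \<phi> \<longleftrightarrow> U \<subseteq> Rn k \<and> V \<subseteq> Rn k \<and> bij_betw \<phi> U V \<and>
     (\<forall>i<k. smooth_fun_on k U (\<lambda>x. \<phi> x i)) \<and>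
     (\<forall>i<k. smooth_fun_on k V (\<lambda>y. inv_into U \<phi> y i)) \<and>
     openin (Euclidean_space k) U \<and> openin (Euclidean_space k) V"

text \<open>Near \<open>p\<close>, the set \<open>X \<subseteq> \<real>\<^sup>k\<close> looks like \<open>[0,\<infinity>)\<^sup>c \<times> \<real>\<^sup>d\<^sup>-\<^sup>c \<times> {0} \<subseteq> \<real>\<^sup>k\<close>.\<close>

definition slice_chart :: "nat \<Rightarrow> nat \<Rightarrow> nat \<Rightarrow> (nat \<Rightarrow> real) set \<Rightarrow> (nat \<Rightarrow> real) \<Rightarrow> bool" where
  "slice_chart k d c X p \<longleftrightarrow> c \<le> d \<and> d \<le> k \<and>
     (\<exists>U V \<phi>. diffeomorphism k U V \<phi> \<and> p \<in> U \<and>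
        \<phi> ` (X \<inter> U) = {y \<in> V. (\<forall>i<c. 0 \<le> y i) \<and> (\<forall>i. d \<le> i \<longrightarrow> y i = 0)})"

text \<open>Embedded smooth \<open>d\<close>-dimensional submanifolds of \<open>\<real>\<^sup>k\<close> without boundary.\<close>

definition smooth_submanifold :: "nat \<Rightarrow> nat \<Rightarrow> (nat \<Rightarrow> real) set \<Rightarrow> bool" where
  "smooth_submanifold k d X \<longleftrightarrow> X \<subseteq> Rn k \<and> (\<forall>p\<in>X. slice_chart k d 0 X p)"

text \<open>The same, but boundary and corners are allowed.\<close>

definition smooth_submanifold_corners :: "nat \<Rightarrow> nat \<Rightarrow> (nat \<Rightarrow> real) set \<Rightarrow> bool" where
  "smooth_submanifold_corners k d X \<longleftrightarrow> X \<subseteq> Rn k \<and> (\<forall>p\<in>X. \<exists>c. slice_chart k d c X p)"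

definition smooth_curve_through ::
  "(nat \<Rightarrow> real) set \<Rightarrow> (nat \<Rightarrow> real) \<Rightarrow> (real \<Rightarrow> nat \<Rightarrow> real) \<Rightarrow> bool" where
  "smooth_curve_through X p \<gamma> \<longleftrightarrow> \<gamma> 0 = p \<and>
     (\<exists>\<epsilon>>0. \<forall>s\<in>{-\<epsilon><..<\<epsilon>}. \<gamma> s \<in> X \<and>
        (\<forall>i j. ((deriv ^^ j) (\<lambda>u. \<gamma> u i)) differentiable (at s)))"

text \<open>
  For a submanifold \<open>X\<close> without boundary this is the image of the differential at \<open>p\<close> of the
  inclusion of \<open>X\<close> into the ambient space.
\<close>

definition tangent_space :: "(nat \<Rightarrow> real) set \<Rightarrow> (nat \<Rightarrow> real) \<Rightarrow> (nat \<Rightarrow> real) set" where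
  "tangent_space X p = {(\<lambda>i. deriv (\<lambda>s. \<gamma> s i) 0) |\<gamma>. smooth_curve_through X p \<gamma>}"

text \<open>
  The image of the differential at \<open>p\<close> of a smooth function \<open>f : X \<rightarrow> \<real>\<close>: the differential sends
  the velocity \<open>\<gamma>'(0)\<close> to \<open>(f \<circ> \<gamma>)'(0)\<close>.
\<close>

definition differential_image ::
  "(nat \<Rightarrow> real) set \<Rightarrow> ((nat \<Rightarrow> real) \<Rightarrow> real) \<Rightarrow> (nat \<Rightarrow> real) \<Rightarrow> real set" where
  "differential_image X f p = {deriv (\<lambda>s. f (\<gamma> s)) 0 |\<gamma>. smooth_curve_through X p \<gamma>}"

definition singular_set ::
  "nat \<Rightarrow> (nat \<Rightarrow> real) set \<Rightarrow> ((nat \<Rightarrow> real) \<Rightarrow> real) \<Rightarrow> (nat \<Rightarrow> real) set" where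
  "singular_set m X f = {x \<in> X. dim (differential_image X f x) < min m 1}"


section \<open>Real algebraic sets, manifolds and maps\<close>

type_synonym rpoly = "(nat \<Rightarrow>\<^sub>0 nat) \<Rightarrow>\<^sub>0 real"

definition poly_in_vars :: "nat \<Rightarrow> rpoly \<Rightarrow> bool" where
  "poly_in_vars k p \<longleftrightarrow> (\<forall>\<mu>\<in>Poly_Mapping.keys p. Poly_Mapping.keys \<mu> \<subseteq> {..<k})"

definition poly_degree_le :: "nat \<Rightarrow> rpoly \<Rightarrow> bool" where
  "poly_degree_le e p \<longleftrightarrow>
     (\<forall>\<mu>\<in>Poly_Mapping.keys p. (\<Sum>i\<in>Poly_Mapping.keys \<mu>. Poly_Mapping.lookup \<mu> i) \<le> e)"

definition poly_eval :: "rpoly \<Rightarrow> (nat \<Rightarrow> real) \<Rightarrow> real" where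
  "poly_eval p x = (\<Sum>\<mu>\<in>Poly_Mapping.keys p. Poly_Mapping.lookup p \<mu> *
     (\<Prod>i\<in>Poly_Mapping.keys \<mu>. x i ^ Poly_Mapping.lookup \<mu> i))"

definition alg_set :: "nat \<Rightarrow> rpoly list \<Rightarrow> (nat \<Rightarrow> real) set" where
  "alg_set k ps = {x \<in> Rn k. \<forall>p\<in>set ps. poly_eval p x = 0}"

definition components_in :: "nat \<Rightarrow> (nat \<Rightarrow> real) set \<Rightarrow> (nat \<Rightarrow> real) set set" where
  "components_in k X = connected_components_of (subtopology (Euclidean_space k) X)"

text \<open>The differential at \<open>x\<close> of the map \<open>\<real>\<^sup>k \<rightarrow> \<real>\<^sup>e\<close> with components \<open>ps\<close>, \<open>e = length ps\<close>.\<close>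

definition poly_differential ::
  "nat \<Rightarrow> rpoly list \<Rightarrow> (nat \<Rightarrow> real) \<Rightarrow> (nat \<Rightarrow> real) \<Rightarrow> (nat \<Rightarrow> real)" where
  "poly_differential k ps x v =
     (\<lambda>j. if j < length ps then \<Sum>i<k. partial_deriv i (poly_eval (ps ! j)) x * v i else 0)"

text \<open>
  The implicit function theorem needs the differential to be onto, i.e. of rank \<open>length ps\<close>;
  the dimension is then \<open>k - length ps\<close>. Such a manifold has no boundary.
\<close>

definition nonsingular_alg_manifold_by ::
  "nat \<Rightarrow> nat \<Rightarrow> rpoly list \<Rightarrow> (nat \<Rightarrow> real) set \<Rightarrow> bool" where
  "nonsingular_alg_manifold_by k d ps M \<longleftrightarrow>
     (\<forall>p\<in>set ps. poly_in_vars k p) \<and>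
     (\<exists>\<C>\<subseteq>components_in k (alg_set k ps). M = \<Union>\<C>) \<and>
     d + length ps = k \<and>
     (\<forall>x\<in>M. rvec.dim (poly_differential k ps x ` Rn k) = length ps)"

definition nonsingular_alg_manifold :: "nat \<Rightarrow> nat \<Rightarrow> (nat \<Rightarrow> real) set \<Rightarrow> bool" where
  "nonsingular_alg_manifold k d M \<longleftrightarrow> (\<exists>ps. nonsingular_alg_manifold_by k d ps M)"

text \<open>
  Regular functions and maps in the sense of real algebraic geometry: quotients of polynomials
  whose denominators have no zero on \<open>M\<close>. They are smooth.
\<close>

definition algebraic_fun :: "nat \<Rightarrow> (nat \<Rightarrow> real) set \<Rightarrow> ((nat \<Rightarrow> real) \<Rightarrow> real) \<Rightarrow> bool" where
  "algebraic_fun k M f \<longleftrightarrow> (\<exists>p q. poly_in_vars k p \<and> poly_in_vars k q \<and>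
     (\<forall>x\<in>M. poly_eval q x \<noteq> 0 \<and> f x = poly_eval p x / poly_eval q x))"

definition algebraic_map ::
  "nat \<Rightarrow> (nat \<Rightarrow> real) set \<Rightarrow> nat \<Rightarrow> ((nat \<Rightarrow> real) \<Rightarrow> nat \<Rightarrow> real) \<Rightarrow> bool" where
  "algebraic_map k M n g \<longleftrightarrow> g ` M \<subseteq> Rn n \<and> (\<forall>i<n. algebraic_fun k M (\<lambda>x. g x i))"


section \<open>Normal and convenient domains\<close>

text \<open>
  \<open>P j\<close> and \<open>S j\<close>, \<open>j < r\<close>, are the polynomials and hypersurfaces associated with the domain \<open>D\<close>.
\<close>

definition NCD ::
  "nat \<Rightarrow> (nat \<Rightarrow> real) set \<Rightarrow> nat \<Rightarrow> (nat \<Rightarrow> rpoly) \<Rightarrow> (nat \<Rightarrow> (nat \<Rightarrow> real) set) \<Rightarrow> bool" where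
  "NCD n D r P S \<longleftrightarrow>
     openin (Euclidean_space n) D \<and> connectedin (Euclidean_space n) D \<and>
     0 < r \<and> (\<forall>j<r. poly_in_vars n (P j)) \<and>
     D = {x \<in> Rn n. \<forall>j<r. 0 < poly_eval (P j) x} \<and>
     Euclidean_space n closure_of D = {x \<in> Rn n. \<forall>j<r. 0 \<le> poly_eval (P j) x} \<and>
     (\<forall>j<r. S j \<in> components_in n (alg_set n [P j]) \<and>
        1 \<le> n \<and> nonsingular_alg_manifold_by n (n - 1) [P j] (S j)) \<and>
     (\<forall>j<r. (alg_set n [P j] - S j) \<inter> Euclidean_space n closure_of D = {} \<and>
        Euclidean_space n closure_of D \<subseteq> Rn n - (alg_set n [P j] - S j) \<and>
        openin (Euclidean_space n) (Rn n - (alg_set n [P j] - S j))) \<and>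
     (\<forall>\<Lambda>. \<Lambda> \<subseteq> {..<r} \<and> \<Lambda> \<noteq> {} \<longrightarrow>
        (\<Inter>j\<in>\<Lambda>. S j) = {} \<or>
        (card \<Lambda> \<le> n \<and> nonsingular_alg_manifold n (n - card \<Lambda>) (\<Inter>j\<in>\<Lambda>. S j) \<and>
         (\<forall>p\<in>(\<Inter>j\<in>\<Lambda>. S j).
            tangent_space (\<Inter>j\<in>\<Lambda>. S j) p = (\<Inter>j\<in>\<Lambda>. tangent_space (S j) p))))"


section \<open>Affine subspaces, cylinders of hyperbolas and ellipsoids\<close>

definition affine_transformation :: "nat \<Rightarrow> ((nat \<Rightarrow> real) \<Rightarrow> nat \<Rightarrow> real) \<Rightarrow> bool" where
  "affine_transformation k T \<longleftrightarrow>
     (\<exists>(A :: nat \<Rightarrow> nat \<Rightarrow> real) L b.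
        L = (\<lambda>x i. if i < k then \<Sum>j<k. A i j * x j else 0) \<and>
        bij_betw L (Rn k) (Rn k) \<and> b \<in> Rn k \<and> T = (\<lambda>x. L x + b))"

definition affine_subspace :: "nat \<Rightarrow> (nat \<Rightarrow> real) set \<Rightarrow> bool" where
  "affine_subspace k X \<longleftrightarrow> X = Rn k \<or>
     (\<exists>k1 k2 T. 0 < k1 \<and> 0 < k2 \<and> k1 + k2 = k \<and> affine_transformation k T \<and> X = T ` Rn k1)"

definition hyperbola_cylinder :: "nat \<Rightarrow> (nat \<Rightarrow> real) set \<Rightarrow> bool" where
  "hyperbola_cylinder k X \<longleftrightarrow> 2 \<le> k \<and>
     (\<exists>a b c T. c \<noteq> 0 \<and> affine_transformation k T \<and>
        X = T ` {x \<in> Rn k. (x 0 - a) * (x 1 - b) = c})"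

definition ellipsoid :: "nat \<Rightarrow> (nat \<Rightarrow> real) set \<Rightarrow> bool" where
  "ellipsoid k X \<longleftrightarrow>
     (\<exists>a \<rho> T. (\<forall>j<k. 0 < \<rho> j) \<and> affine_transformation k T \<and>
        X = T ` {x \<in> Rn k. (\<Sum>j<k. (x j - a j)\<^sup>2 / \<rho> j) \<le> 1})"

definition ellipsoid_boundary :: "nat \<Rightarrow> (nat \<Rightarrow> real) set \<Rightarrow> bool" where
  "ellipsoid_boundary k X \<longleftrightarrow> (\<exists>E. ellipsoid k E \<and> X = Euclidean_space k frontier_of E)"


section \<open>CW complexes\<close>

definition disc :: "nat \<Rightarrow> (nat \<Rightarrow> real) set" where
  "disc d = {x \<in> Rn d. (\<Sum>i<d. (x i)\<^sup>2) \<le> 1}"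

definition open_disc :: "nat \<Rightarrow> (nat \<Rightarrow> real) set" where
  "open_disc d = {x \<in> Rn d. (\<Sum>i<d. (x i)\<^sup>2) < 1}"

text \<open>
  \<open>\<E>\<close> is the set of open cells, \<open>\<delta> e\<close> the dimension and \<open>\<Phi> e\<close> the characteristic map of the
  cell \<open>e\<close>. The last two conditions are closure finiteness and the weak topology.
\<close>

definition CW_structure ::
  "'a topology \<Rightarrow> 'a set set \<Rightarrow> ('a set \<Rightarrow> nat) \<Rightarrow> ('a set \<Rightarrow> (nat \<Rightarrow> real) \<Rightarrow> 'a) \<Rightarrow> bool" where
  "CW_structure X \<E> \<delta> \<Phi> \<longleftrightarrow>
     Hausdorff_space X \<and> \<Union>\<E> = topspace X \<and> pairwise disjnt \<E> \<and>
     (\<forall>e\<in>\<E>. continuous_map (subtopology (Euclidean_space (\<delta> e)) (disc (\<delta> e))) X (\<Phi> e) \<and>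
        homeomorphic_map (subtopology (Euclidean_space (\<delta> e)) (open_disc (\<delta> e)))
          (subtopology X e) (\<Phi> e)) \<and>
     (\<forall>e\<in>\<E>. \<exists>\<F>. finite \<F> \<and> \<F> \<subseteq> {e'\<in>\<E>. \<delta> e' < \<delta> e} \<and>
        \<Phi> e ` (disc (\<delta> e) - open_disc (\<delta> e)) \<subseteq> \<Union>\<F>) \<and>
     (\<forall>A\<subseteq>topspace X. (\<forall>e\<in>\<E>. closedin X (A \<inter> X closure_of e)) \<longrightarrow> closedin X A)"

definition CW_complex_dim_le :: "nat \<Rightarrow> 'a topology \<Rightarrow> bool" where
  "CW_complex_dim_le d X \<longleftrightarrow> (\<exists>\<E> \<delta> \<Phi>. CW_structure X \<E> \<delta> \<Phi> \<and> (\<forall>e\<in>\<E>. \<delta> e \<le> d))"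


section \<open>Functions with prescribed fibres\<close>

definition fibre :: "(nat \<Rightarrow> real) set \<Rightarrow> ((nat \<Rightarrow> real) \<Rightarrow> real) \<Rightarrow> real \<Rightarrow> (nat \<Rightarrow> real) set" where
  "fibre M f s = {x \<in> M. f x = s}"

definition prescribed_fibres ::
  "nat \<Rightarrow> (nat \<Rightarrow> real) \<Rightarrow> (nat \<Rightarrow> nat) \<Rightarrow> nat \<Rightarrow> nat \<Rightarrow> (nat \<Rightarrow> real) set
     \<Rightarrow> ((nat \<Rightarrow> real) \<Rightarrow> real) \<Rightarrow> bool" where
  "prescribed_fibres l t lam m k M f \<longleftrightarrow>
     f ` M = {t 1..t l} \<and> f ` singular_set m M f = t ` {1..l} \<and>
     (\<forall>j\<in>{1..l - 1}. \<forall>s\<in>{t j<..<t (j + 1)}.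
        (lam j = 0 \<longrightarrow>
           compactin (Euclidean_space k) (fibre M f s) \<and>
           smooth_submanifold k (m - 1) (fibre M f s) \<and>
           connectedin (Euclidean_space k) (fibre M f s)) \<and>
        (lam j = 1 \<longrightarrow>
           connectedin (Euclidean_space k) (fibre M f s) \<and>
           \<not> compactin (Euclidean_space k) (fibre M f s) \<and>
           smooth_submanifold k (m - 1) (fibre M f s))) \<and>
     (\<forall>s\<in>f ` M. connectedin (Euclidean_space k) (fibre M f s) \<and>
        (\<exists>Y :: (nat \<Rightarrow> real) topology. CW_complex_dim_le (m - 1) Y \<and>
           subtopology (Euclidean_space k) (fibre M f s) homeomorphic_space Y))"

end

theory Submission
  imports Defs
begin

text \<open>
  Let \<open>\<beta>(x) = (x - t\<^sub>1)(t\<^sub>l - x)\<close>, let \<open>Q\<close> be the product of the \<open>x - t\<^sub>j\<close> with \<open>1 < j < l\<close>, and let \<open>A\<close> be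
  the product of the \<open>(x - t\<^sub>j)(x - t\<^sub>j\<^sub>+\<^sub>1)\<close> with \<open>\<lambda>(j) = 1\<close>. In the space with coordinates
  \<open>(w, y\<^sub>1, \<dots>, y\<^sub>p, x, u)\<close> consider
  \<open>M = {y\<^sub>1\<^sup>2 + \<dots> + y\<^sub>p\<^sup>2 + A(x) w\<^sup>2 = \<beta>(x), u\<^sup>3 = Q(x)}\<close> and \<open>f = x\<close>.

  The fibre of \<open>f\<close> is an ellipsoid where \<open>A > 0\<close> and a cylinder \<open>S\<^sup>p\<^sup>-\<^sup>1 \<times> \<real>\<close> where \<open>A \<le> 0\<close>; over the end
  points it is a point or a line. The second equation does not change the topology, since \<open>u\<close> is
  determined by \<open>x\<close>, but the roots of \<open>Q\<close> are simple, so it makes \<open>x\<close> stationary exactly over them.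
  As \<open>-A \<le> C \<beta>\<close> on \<open>[t\<^sub>1, t\<^sub>l]\<close> for some constant \<open>C\<close>, the map
  \<open>(x, y\<^sub>1 / (1 + C w\<^sup>2))\<close> sends \<open>M\<close> onto the closed round disc \<open>{v\<^sup>2 \<le> \<beta>(x)}\<close> in the plane,
  whose interior is a normal and convenient domain bounded by a circle.
\<close>

text \<open>Every t_j has to be a critical value, even where the type of the fibre is the same on
  both sides, so critical points cannot be left to changes of topology. The cubic equation settles
  this for all inner values: a curve through a point with u = 0 satisfies Q'(x) x' = 3 u^2 u' = 0,
  and Q' is non-zero there. For the same reason M stays non-singular, as u^3 = Q(x) can be solved
  for x near such a point. The exponent is odd so that each x has exactly one u, and larger than 1
  so that the derivative vanishes at u = 0.

  At the end points x is extremal. There A may vanish, but as A is positive outside [t_1, t_l], its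
  derivative has a sign that cannot cancel the derivative of \<beta>; so M is regular even along a
  whole line over an end point. Neighbouring marked intervals give A a double root between them,
  which does no harm: inside, \<beta> > 0 and the quadric is smooth for every value of A.

  Where A < 0, the projection to (x, y_1) is unbounded on the fibres; this is why a denominator is
  needed. With p >= 2 the spheres S^(p-1) are connected and a second variable y_2 is free to fill
  the disc, whence m = p + 1 >= 3.\<close>

lemma Rn_eq: "Rn k = {x. \<forall>i\<ge>k. x i = 0}"
  by (rule topspace_Euclidean_space)

lemma Euclidean_space_eq_top_of_set: "Euclidean_space k = top_of_set (Rn k)"
  by (simp add: Euclidean_space_def euclidean_product_topology)

lemma subtopology_Euclidean_space_eq:
  "X \<subseteq> Rn k \<Longrightarrow> subtopology (Euclidean_space k) X = top_of_set X"
  by (subst Euclidean_space_eq_top_of_set) (simp add: subtopology_subtopology inf_absorb2)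

lemma continuous_on_coordinate [continuous_intros]: "continuous_on S (\<lambda>x :: nat \<Rightarrow> real. x i)"
  by (rule continuous_on_product_coordinates[THEN continuous_on_subset]) simp

lemma Rn_upd: "x \<in> Rn k \<Longrightarrow> i < k \<Longrightarrow> x(i := s) \<in> Rn k"
  by (auto simp: Rn_eq)

lemma openin_Rn_iff: "openin (Euclidean_space k) U \<longleftrightarrow> (\<exists>T. open T \<and> U = Rn k \<inter> T)"
  by (subst Euclidean_space_eq_top_of_set) (simp add: openin_open)

lemma openin_Rn_positive:
  fixes h :: "(nat \<Rightarrow> real) \<Rightarrow> real"
  assumes "continuous_on (Rn k) h"
  shows "openin (Euclidean_space k) {x \<in> Rn k. 0 < h x}"
proof -
  have "openin (top_of_set (Rn k)) (Rn k \<inter> h -` {0<..})"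
    by (rule continuous_openin_preimage_gen[OF assms]) simp
  moreover have "Rn k \<inter> h -` {0<..} = {x \<in> Rn k. 0 < h x}" by auto
  ultimately show ?thesis by (subst Euclidean_space_eq_top_of_set) simp
qed


section \<open>Polynomial functions\<close>

text \<open>Polynomials are handled through the functions they define. The degree bound
  \<open>e\<close> is carried along for the circle in the plane, whose equation must have degree at
  most 2; for the equations of the manifold any bound will do.\<close>

definition polynomial_fun :: "nat \<Rightarrow> nat \<Rightarrow> ((nat \<Rightarrow> real) \<Rightarrow> real) \<Rightarrow> bool" where
  "polynomial_fun k e h \<longleftrightarrow> (\<exists>p. poly_in_vars k p \<and> poly_degree_le e p \<and> poly_eval p = h)"

definition monomial_eval :: "(nat \<Rightarrow>\<^sub>0 nat) \<Rightarrow> (nat \<Rightarrow> real) \<Rightarrow> real" where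
  "monomial_eval \<mu> x = (\<Prod>i\<in>Poly_Mapping.keys \<mu>. x i ^ Poly_Mapping.lookup \<mu> i)"

lemma monomial_eval_superset:
  "finite I \<Longrightarrow> Poly_Mapping.keys \<mu> \<subseteq> I \<Longrightarrow>
     monomial_eval \<mu> x = (\<Prod>i\<in>I. x i ^ Poly_Mapping.lookup \<mu> i)"
  unfolding monomial_eval_def by (rule prod.mono_neutral_left) (auto simp: in_keys_iff)

lemma monomial_eval_add: "monomial_eval (\<mu> + \<nu>) x = monomial_eval \<mu> x * monomial_eval \<nu> x"
proof -
  let ?I = "Poly_Mapping.keys \<mu> \<union> Poly_Mapping.keys \<nu>"
  have "monomial_eval (\<mu> + \<nu>) x = (\<Prod>i\<in>?I. x i ^ Poly_Mapping.lookup (\<mu> + \<nu>) i)"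
    by (rule monomial_eval_superset) (auto dest: subsetD[OF Poly_Mapping.keys_add])
  then show ?thesis
    using monomial_eval_superset[of ?I \<mu> x] monomial_eval_superset[of ?I \<nu> x]
    by (simp add: lookup_add power_add prod.distrib)
qed

definition total_degree :: "(nat \<Rightarrow>\<^sub>0 nat) \<Rightarrow> nat" where
  "total_degree \<mu> = (\<Sum>i\<in>Poly_Mapping.keys \<mu>. Poly_Mapping.lookup \<mu> i)"

lemma total_degree_superset:
  "finite I \<Longrightarrow> Poly_Mapping.keys \<mu> \<subseteq> I \<Longrightarrow> total_degree \<mu> = (\<Sum>i\<in>I. Poly_Mapping.lookup \<mu> i)"
  unfolding total_degree_def by (rule sum.mono_neutral_left) (auto simp: in_keys_iff)

lemma total_degree_add: "total_degree (\<mu> + \<nu>) = total_degree \<mu> + total_degree \<nu>"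
proof -
  let ?I = "Poly_Mapping.keys \<mu> \<union> Poly_Mapping.keys \<nu>"
  have "total_degree (\<mu> + \<nu>) = (\<Sum>i\<in>?I. Poly_Mapping.lookup (\<mu> + \<nu>) i)"
    by (rule total_degree_superset) (auto dest: subsetD[OF Poly_Mapping.keys_add])
  then show ?thesis
    using total_degree_superset[of ?I \<mu>] total_degree_superset[of ?I \<nu>]
    by (simp add: lookup_add sum.distrib)
qed

text \<open>Terms may cancel in a sum of polynomials, so the key sets of \<open>p\<close>,
  \<open>q\<close> and \<open>p + q\<close> differ. Summing over a common finite superset makes the
  three evaluations comparable.\<close>

lemma poly_eval_superset:
  "finite I \<Longrightarrow> Poly_Mapping.keys p \<subseteq> I \<Longrightarrow>
     poly_eval p x = (\<Sum>\<mu>\<in>I. Poly_Mapping.lookup p \<mu> * monomial_eval \<mu> x)"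
  unfolding poly_eval_def monomial_eval_def[symmetric]
  by (rule sum.mono_neutral_left) (auto simp: in_keys_iff)

lemma poly_eval_add: "poly_eval (p + q) x = poly_eval p x + poly_eval q x"
proof -
  let ?I = "Poly_Mapping.keys p \<union> Poly_Mapping.keys q"
  have "poly_eval (p + q) x = (\<Sum>\<mu>\<in>?I. Poly_Mapping.lookup (p + q) \<mu> * monomial_eval \<mu> x)"
    by (rule poly_eval_superset) (auto dest: subsetD[OF Poly_Mapping.keys_add])
  then show ?thesis
    using poly_eval_superset[of ?I p x] poly_eval_superset[of ?I q x]
    by (simp add: lookup_add algebra_simps sum.distrib)
qed

lemma poly_eval_single: "poly_eval (Poly_Mapping.single \<mu> c) x = c * monomial_eval \<mu> x"
  by (subst poly_eval_superset[of "{\<mu>}"]) auto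

text \<open>Turns a step of \<open>update_induct\<close> into the addition of one new term, so that
  distributivity applies.\<close>

lemma update_eq_single_add:
  assumes "Poly_Mapping.lookup p a = 0"
  shows "Poly_Mapping.update a b p = Poly_Mapping.single a b + p"
  by (rule poly_mapping_eqI) (use assms in \<open>auto simp: lookup_update lookup_add lookup_single when_def\<close>)

lemma poly_eval_mult_single:
  "poly_eval (Poly_Mapping.single \<mu> c * q) x = c * monomial_eval \<mu> x * poly_eval q x"
proof (induction q rule: update_induct)
  case const
  then show ?case by (simp add: poly_eval_def)
next
  case (update q a b)
  then have "Poly_Mapping.update a b q = Poly_Mapping.single a b + q"
    by (intro update_eq_single_add) (simp add: in_keys_iff)
  then show ?case
    using update
    by (simp add: distrib_left poly_eval_add mult_single poly_eval_single monomial_eval_add algebra_simps)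
qed

text \<open>Induction over the terms of the left factor; the case of a single term on the left was
  itself an induction over the right factor and rests on adding the exponents of monomials.\<close>

lemma poly_eval_mult: "poly_eval (p * q) x = poly_eval p x * poly_eval q x"
proof (induction p rule: update_induct)
  case const
  then show ?case by (simp add: poly_eval_def)
next
  case (update p a b)
  then have "Poly_Mapping.update a b p = Poly_Mapping.single a b + p"
    by (intro update_eq_single_add) (simp add: in_keys_iff)
  then show ?case
    using update by (simp add: distrib_right poly_eval_add poly_eval_mult_single poly_eval_single)
qed

lemma polynomial_fun_const: "polynomial_fun k e (\<lambda>x. c)"
  unfolding polynomial_fun_def
  by (rule exI[of _ "Poly_Mapping.single 0 c"])
     (auto simp: poly_in_vars_def poly_degree_le_def fun_eq_iff poly_eval_single monomial_eval_def)

lemma polynomial_fun_coordinate: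
  assumes "i < k" "1 \<le> e"
  shows "polynomial_fun k e (\<lambda>x. x i)"
  unfolding polynomial_fun_def
  by (rule exI[of _ "Poly_Mapping.single (Poly_Mapping.single i 1) 1"])
     (use assms in \<open>auto simp: poly_in_vars_def poly_degree_le_def fun_eq_iff poly_eval_single
        monomial_eval_def\<close>)

lemma polynomial_fun_add:
  assumes "polynomial_fun k e g" "polynomial_fun k e h"
  shows "polynomial_fun k e (\<lambda>x. g x + h x)"
proof -
  obtain p q where "poly_in_vars k p" "poly_degree_le e p" "poly_eval p = g"
    "poly_in_vars k q" "poly_degree_le e q" "poly_eval q = h"
    using assms by (auto simp: polynomial_fun_def)
  then show ?thesis
    unfolding polynomial_fun_def poly_in_vars_def poly_degree_le_def
    by (intro exI[of _ "p + q"])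
       (auto simp: fun_eq_iff poly_eval_add dest!: subsetD[OF Poly_Mapping.keys_add])
qed

lemma polynomial_fun_mult:
  assumes "polynomial_fun k e g" "polynomial_fun k e' h"
  shows "polynomial_fun k (e + e') (\<lambda>x. g x * h x)"
proof -
  obtain p q where p: "poly_in_vars k p" "poly_degree_le e p" "poly_eval p = g"
    and q: "poly_in_vars k q" "poly_degree_le e' q" "poly_eval q = h"
    using assms by (auto simp: polynomial_fun_def)
  have "Poly_Mapping.keys \<mu> \<subseteq> {..<k} \<and> total_degree \<mu> \<le> e + e'"
    if \<mu>: "\<mu> \<in> Poly_Mapping.keys (p * q)" for \<mu>
  proof -
    obtain a b where ab: "\<mu> = a + b" "a \<in> Poly_Mapping.keys p" "b \<in> Poly_Mapping.keys q"
      using \<mu> Poly_Mapping.keys_mult[of p q] by auto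
    then have "Poly_Mapping.keys a \<subseteq> {..<k}" "Poly_Mapping.keys b \<subseteq> {..<k}"
      "total_degree a \<le> e" "total_degree b \<le> e'"
      using p q by (auto simp: poly_in_vars_def poly_degree_le_def total_degree_def)
    then show ?thesis
      using Poly_Mapping.keys_add[of a b] by (auto simp: ab total_degree_add)
  qed
  then show ?thesis
    unfolding polynomial_fun_def poly_in_vars_def poly_degree_le_def total_degree_def[symmetric]
    by (intro exI[of _ "p * q"]) (auto simp: fun_eq_iff poly_eval_mult p q)
qed

lemma polynomial_fun_mono: "polynomial_fun k e h \<Longrightarrow> e \<le> e' \<Longrightarrow> polynomial_fun k e' h"
  unfolding polynomial_fun_def poly_degree_le_def by (auto intro: order_trans)

lemma polynomial_fun_minus:
  assumes "polynomial_fun k e h"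
  shows "polynomial_fun k e (\<lambda>x. - h x)"
  using polynomial_fun_mult[OF polynomial_fun_const[of k 0 "-1"] assms] by simp

lemma polynomial_fun_diff:
  assumes "polynomial_fun k e g" "polynomial_fun k e h"
  shows "polynomial_fun k e (\<lambda>x. g x - h x)"
  using polynomial_fun_add[OF assms(1) polynomial_fun_minus[OF assms(2)]] by simp

lemma polynomial_fun_power:
  assumes "polynomial_fun k e h"
  shows "polynomial_fun k (n * e) (\<lambda>x. h x ^ n)"
proof (induction n)
  case 0
  then show ?case by (simp add: polynomial_fun_const)
next
  case (Suc n)
  then show ?case using polynomial_fun_mult[OF assms Suc] by simp
qed

lemma polynomial_fun_sum:
  assumes "finite I" "\<And>i. i \<in> I \<Longrightarrow> polynomial_fun k e (h i)"
  shows "polynomial_fun k e (\<lambda>x. \<Sum>i\<in>I. h i x)"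
  using assms
  by (induction I rule: finite_induct) (auto intro: polynomial_fun_add polynomial_fun_const)

text \<open>Induction along Horner's scheme; each step raises the bound by one.\<close>

lemma polynomial_fun_poly:
  fixes A :: "real poly"
  assumes "i < k"
  shows "\<exists>e. polynomial_fun k e (\<lambda>x. poly A (x i))"
proof (induction A)
  case 0
  then show ?case by (simp add: polynomial_fun_const)
next
  case (pCons a p)
  then obtain e where "polynomial_fun k e (\<lambda>x. poly p (x i))" by auto
  then have "polynomial_fun k (1 + e) (\<lambda>x. a + x i * poly p (x i))"
    by (intro polynomial_fun_add polynomial_fun_mult polynomial_fun_const
        polynomial_fun_coordinate assms) auto
  then show ?case by auto
qed


section \<open>A class of smooth functions\<close>

text \<open>The charts and curves below use square roots, cube roots and reciprocals of positive
  functions. Real powers of positive functions cover all of these, and the resulting class is closed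
  under partial derivatives, so smoothness becomes a syntactic check. The parameter \<open>U\<close>
  is the set on which the bases have to be positive.\<close>

inductive elementary :: "(nat \<Rightarrow> real) set \<Rightarrow> ((nat \<Rightarrow> real) \<Rightarrow> real) \<Rightarrow> bool" for U where
  elementary_const: "elementary U (\<lambda>x. c)"
| elementary_coordinate: "elementary U (\<lambda>x. x i)"
| elementary_add: "elementary U g \<Longrightarrow> elementary U h \<Longrightarrow> elementary U (\<lambda>x. g x + h x)"
| elementary_mult: "elementary U g \<Longrightarrow> elementary U h \<Longrightarrow> elementary U (\<lambda>x. g x * h x)"
| elementary_powr: "elementary U g \<Longrightarrow> (\<And>x. x \<in> U \<Longrightarrow> 0 < g x) \<Longrightarrow> elementary U (\<lambda>x. g x powr c)"

lemma elementary_diff: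
  assumes "elementary U g" "elementary U h"
  shows "elementary U (\<lambda>x. g x - h x)"
  using elementary_add[OF assms(1) elementary_mult[OF elementary_const[of U "-1"] assms(2)]] by simp

lemma elementary_power:
  assumes "elementary U g"
  shows "elementary U (\<lambda>x. g x ^ n)"
  by (induction n) (auto intro: elementary_const elementary_mult assms)

lemma elementary_sum:
  assumes "finite I" "\<And>i. i \<in> I \<Longrightarrow> elementary U (h i)"
  shows "elementary U (\<lambda>x. \<Sum>i\<in>I. h i x)"
  using assms by (induction I rule: finite_induct) (auto intro: elementary_const elementary_add)

lemma elementary_poly:
  assumes "elementary U g"
  shows "elementary U (\<lambda>x. poly A (g x))"
proof (induction A)
  case 0
  then show ?case by (simp add: elementary_const)
next
  case (pCons a A)
  then show ?case
    using elementary_add[OF elementary_const[of U a] elementary_mult[OF assms pCons(2)]] by simp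
qed

lemma elementary_continuous_on: "elementary U h \<Longrightarrow> continuous_on U h"
proof (induction rule: elementary.induct)
  case (elementary_powr g c)
  then have "\<forall>x\<in>U. g x \<noteq> 0" by (metis less_irrefl)
  then show ?case using elementary_powr by (intro continuous_intros) auto
qed (auto intro!: continuous_intros)

text \<open>Every rule of the class differentiates into the class. In the case of powers the
  derivative is c g^(c-1) g', where the base of the new power is again positive.\<close>

lemma elementary_has_partial_derivative:
  "elementary U h \<Longrightarrow> \<exists>h'. elementary U h' \<and>
     (\<forall>x\<in>U. ((\<lambda>s. h (x(i := s))) has_real_derivative h' x) (at (x i)))"
proof (induction rule: elementary.induct)
  case (elementary_const c)
  then show ?case
    by (intro exI[of _ "\<lambda>x. 0"]) (auto intro: elementary.elementary_const)
next
  case (elementary_coordinate j)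
  show ?case
  proof (cases "j = i")
    case True
    then show ?thesis
      by (intro exI[of _ "\<lambda>x. 1"]) (auto intro: elementary.elementary_const)
  next
    case False
    then show ?thesis
      by (intro exI[of _ "\<lambda>x. 0"]) (auto intro: elementary.elementary_const)
  qed
next
  case (elementary_add g h)
  then obtain g' h' where "elementary U g'" "elementary U h'"
    "\<And>x. x \<in> U \<Longrightarrow> ((\<lambda>s. g (x(i := s))) has_real_derivative g' x) (at (x i))"
    "\<And>x. x \<in> U \<Longrightarrow> ((\<lambda>s. h (x(i := s))) has_real_derivative h' x) (at (x i))"
    by blast
  then show ?case
    by (intro exI[of _ "\<lambda>x. g' x + h' x"])
       (intro conjI ballI elementary.elementary_add DERIV_add, auto simp only:)
next
  case (elementary_mult g h)
  then obtain g' h' where *: "elementary U g'" "elementary U h'"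
    "\<And>x. x \<in> U \<Longrightarrow> ((\<lambda>s. g (x(i := s))) has_real_derivative g' x) (at (x i))"
    "\<And>x. x \<in> U \<Longrightarrow> ((\<lambda>s. h (x(i := s))) has_real_derivative h' x) (at (x i))"
    by blast
  have "((\<lambda>s. g (x(i := s)) * h (x(i := s))) has_real_derivative g' x * h x + h' x * g x) (at (x i))"
    if "x \<in> U" for x
    using DERIV_mult[OF *(3,4)[OF that]] by simp
  moreover have "elementary U (\<lambda>x. g' x * h x + h' x * g x)"
    using * elementary_mult
    by (intro elementary.elementary_add elementary.elementary_mult)
  ultimately show ?case by (intro exI[of _ "\<lambda>x. g' x * h x + h' x * g x"]) blast
next
  case (elementary_powr g c)
  then obtain g' where *: "elementary U g'"
    "\<And>x. x \<in> U \<Longrightarrow> ((\<lambda>s. g (x(i := s))) has_real_derivative g' x) (at (x i))"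
    by blast
  have "((\<lambda>s. g (x(i := s)) powr c) has_real_derivative c * g x powr (c - 1) * g' x) (at (x i))"
    if "x \<in> U" for x
    using DERIV_fun_powr[OF *(2)[OF that], of c] elementary_powr(2)[OF that] by simp
  moreover have "elementary U (\<lambda>x. c * g x powr (c - 1) * g' x)"
    using * elementary_powr
    by (intro elementary.elementary_mult elementary.elementary_powr elementary.elementary_const)
  ultimately show ?case by (intro exI[of _ "\<lambda>x. c * g x powr (c - 1) * g' x"]) blast
qed

text \<open>A partial derivative at \<open>x\<close> depends only on a short segment through
  \<open>x\<close>. As this segment stays in \<open>U\<close>, a function may be replaced by one
  that agrees with it on \<open>U\<close>.\<close>

lemma eventually_upd_in_open:
  assumes "openin (Euclidean_space k) U" "x \<in> U" "i < k"
  shows "\<forall>\<^sub>F s in nhds (x i). x(i := s) \<in> U"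
proof -
  obtain T where T: "open T" "U = Rn k \<inter> T"
    using assms(1) openin_Rn_iff by blast
  have "continuous_on UNIV (\<lambda>s. x(i := s))"
  proof (rule continuous_on_coordinatewise_then_product)
    show "continuous_on UNIV (\<lambda>s. (x(i := s)) j)" for j
      by (cases "j = i") (auto intro: continuous_intros)
  qed
  then have "open ((\<lambda>s. x(i := s)) -` T)"
    using T(1) by (simp add: open_vimage)
  moreover have "x i \<in> (\<lambda>s. x(i := s)) -` T"
    using assms T by simp
  ultimately have "\<forall>\<^sub>F s in nhds (x i). s \<in> (\<lambda>s. x(i := s)) -` T"
    by (rule eventually_nhds_in_open)
  then show ?thesis
    by eventually_elim (use assms T Rn_upd in auto)
qed

text \<open>\<open>h0\<close> is tied to the elementary function \<open>h\<close> on
  \<open>U\<close> alone. This freedom is needed for inverses given by \<open>inv_into\<close>,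
  which are arbitrary off the image.\<close>

lemma iter_partial_deriv_elementary:
  assumes "openin (Euclidean_space k) U" "elementary U h" "\<And>x. x \<in> U \<Longrightarrow> h0 x = h x"
    and "set is \<subseteq> {..<k}"
  shows "\<exists>h'. elementary U h' \<and> (\<forall>x\<in>U. iter_partial_deriv is h0 x = h' x)"
  using assms(4)
proof (induction "is")
  case Nil
  then show ?case using assms by auto
next
  case (Cons i "is")
  then obtain g where g: "elementary U g" "\<And>x. x \<in> U \<Longrightarrow> iter_partial_deriv is h0 x = g x"
    by auto
  obtain g' where g': "elementary U g'"
    "\<And>x. x \<in> U \<Longrightarrow> ((\<lambda>s. g (x(i := s))) has_real_derivative g' x) (at (x i))"
    using elementary_has_partial_derivative[OF g(1)] by blast
  have "iter_partial_deriv (i # is) h0 x = g' x" if "x \<in> U" for x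
  proof -
    have "\<forall>\<^sub>F s in nhds (x i). iter_partial_deriv is h0 (x(i := s)) = g (x(i := s))"
      using eventually_upd_in_open[OF assms(1) that, of i] Cons.prems
      by (simp add: eventually_mono g(2))
    then have "deriv (\<lambda>s. iter_partial_deriv is h0 (x(i := s))) (x i) = deriv (\<lambda>s. g (x(i := s))) (x i)"
      by (rule deriv_cong_ev) simp
    then show ?thesis
      using DERIV_imp_deriv[OF g'(2)[OF that]] by (simp add: partial_deriv_def)
  qed
  then show ?case using g' by blast
qed

lemma smooth_fun_on_elementary:
  assumes "openin (Euclidean_space k) U" "elementary U h" "\<And>x. x \<in> U \<Longrightarrow> h0 x = h x"
  shows "smooth_fun_on k U h0"
proof -
  have "continuous_map (subtopology (Euclidean_space k) U) euclideanreal (iter_partial_deriv is h0) \<and>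
        (\<forall>x\<in>U. \<forall>i<k. (\<lambda>s. iter_partial_deriv is h0 (x(i := s))) differentiable (at (x i)))"
    if "is": "set is \<subseteq> {..<k}" for "is"
  proof -
    obtain g where g: "elementary U g" "\<And>x. x \<in> U \<Longrightarrow> iter_partial_deriv is h0 x = g x"
      using iter_partial_deriv_elementary[OF assms "is"] by auto
    have "U \<subseteq> Rn k" using assms(1) openin_subset by blast
    moreover have "continuous_on U (iter_partial_deriv is h0)"
      using elementary_continuous_on[OF g(1)] g(2) by (simp cong: continuous_on_cong)
    moreover have "(\<lambda>s. iter_partial_deriv is h0 (x(i := s))) differentiable (at (x i))"
      if x: "x \<in> U" "i < k" for x i
    proof -
      obtain d where "((\<lambda>s. g (x(i := s))) has_real_derivative d) (at (x i))"
        using elementary_has_partial_derivative[OF g(1)] x by blast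
      moreover have "\<forall>\<^sub>F s in nhds (x i). iter_partial_deriv is h0 (x(i := s)) = g (x(i := s))"
        using eventually_upd_in_open[OF assms(1) x] by (simp add: eventually_mono g(2))
      ultimately have "((\<lambda>s. iter_partial_deriv is h0 (x(i := s))) has_real_derivative d) (at (x i))"
        by (subst DERIV_cong_ev) auto
      then show ?thesis using real_differentiable_def by blast
    qed
    ultimately show ?thesis by (simp add: subtopology_Euclidean_space_eq)
  qed
  then show ?thesis using assms(1) by (simp add: smooth_fun_on_def)
qed

text \<open>Higher derivatives in one variable become repeated partial derivatives in one direction,
  so that smoothness of curves is a case of smoothness of functions.\<close>

lemma iter_deriv_eq_iter_partial_deriv:
  "(deriv ^^ n) (\<lambda>s. h (x(i := s))) = (\<lambda>s. iter_partial_deriv (replicate n i) h (x(i := s)))"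
proof (induction n)
  case 0
  show ?case by (simp only: funpow.simps id_apply replicate_0 iter_partial_deriv.simps)
next
  case (Suc n)
  show ?case
    by (simp only: funpow.simps comp_apply Suc replicate_Suc iter_partial_deriv.simps
        partial_deriv_def fun_upd_upd fun_upd_same)
qed

text \<open>A curve is read as a family of functions on an interval in \<open>Rn 1\<close>, the
  parameter \<open>s\<close> being the point with entry \<open>s\<close> at index 0 and zeros
  elsewhere.\<close>

lemma smooth_curve_through_elementary:
  assumes \<epsilon>: "0 < \<epsilon>" and U: "U = {x \<in> Rn 1. x 0 \<in> {-\<epsilon><..<\<epsilon>}}"
    and h: "\<And>i. elementary U (h i)"
    and \<gamma>: "\<And>s i. \<gamma> s i = h i ((\<lambda>_. 0)(0 := s))"
    and X: "\<And>s. s \<in> {-\<epsilon><..<\<epsilon>} \<Longrightarrow> \<gamma> s \<in> X" and p: "\<gamma> 0 = p"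
  shows "smooth_curve_through X p \<gamma>"
proof -
  have "openin (Euclidean_space 1) ({x \<in> Rn 1. 0 < x 0 - (-\<epsilon>)} \<inter> {x \<in> Rn 1. 0 < \<epsilon> - x 0})"
    by (intro openin_Int openin_Rn_positive continuous_intros)
  also have "{x \<in> Rn 1. 0 < x 0 - (-\<epsilon>)} \<inter> {x \<in> Rn 1. 0 < \<epsilon> - x 0} = U"
    by (auto simp: U)
  finally have "openin (Euclidean_space 1) U" .
  then have sm: "smooth_fun_on 1 U (h i)" for i
    using smooth_fun_on_elementary h by blast
  have "((deriv ^^ j) (\<lambda>u. \<gamma> u i)) differentiable (at s)" if s: "s \<in> {-\<epsilon><..<\<epsilon>}" for i j s
  proof -
    let ?x = "(\<lambda>_. 0 :: real)(0 := s)"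
    have "?x \<in> U" using s by (auto simp: U Rn_eq)
    then have "(\<lambda>u. iter_partial_deriv (replicate j 0) (h i) (?x(0 := u))) differentiable (at s)"
      using sm[of i] unfolding smooth_fun_on_def by (auto dest!: spec[of _ "replicate j 0"])
    then show ?thesis
      by (simp add: \<gamma> iter_deriv_eq_iter_partial_deriv)
  qed
  then show ?thesis
    using \<epsilon> X p unfolding smooth_curve_through_def by blast
qed


section \<open>Charts for quadrics\<close>

text \<open>As \<open>b\<close> is non-zero, some term c_i (p_i - cen_i)^2 is non-zero. Near
  \<open>p\<close> the equation can then be solved for coordinate \<open>i\<close>, whatever the
  signs of the coefficients. The chart puts the defect of the equation in place of this coordinate,
  and its inverse takes a square root with the sign of p_i - cen_i.\<close>

lemma slice_chart_quadric:
  fixes c cen e :: "nat \<Rightarrow> real" and b :: real and d k :: nat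
  defines "X \<equiv> {z \<in> Rn k. (\<Sum>j<Suc d. c j * (z j - cen j)\<^sup>2) = b \<and> (\<forall>j. d < j \<and> j < k \<longrightarrow> z j = e j)}"
  assumes "d < k" "b \<noteq> 0" and p: "p \<in> X"
  shows "slice_chart k d 0 X p"
proof -
  have "(\<Sum>j<Suc d. c j * (p j - cen j)\<^sup>2) \<noteq> 0"
    using p assms(3) by (simp add: X_def)
  then obtain i where i: "i < Suc d" "c i * (p i - cen i)\<^sup>2 \<noteq> 0"
    by (meson lessThan_iff sum.not_neutral_contains_not_neutral)
  define \<sigma> where "\<sigma> = p i - cen i"
  have c: "c i \<noteq> 0" and \<sigma>: "\<sigma> \<noteq> 0" using i by (auto simp: \<sigma>_def)
  \<comment> \<open>The transposition of \<open>i\<close> and \<open>d\<close>: a slice chart wants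
    the vanishing coordinates from index \<open>d\<close> on, so the eliminated coordinate has to
    move to position \<open>d\<close>.\<close>
  define \<tau> where "\<tau> j = (if j = i then d else if j = d then i else j)" for j
  have \<tau>\<tau>: "\<tau> (\<tau> j) = j" for j by (auto simp: \<tau>_def)
  have \<tau>_less: "\<tau> j < d" if "j < Suc d" "j \<noteq> i" for j
    using that i by (auto simp: \<tau>_def)
  have \<tau>_less': "\<tau> j < Suc d" "\<tau> j \<noteq> i" if "j < d" for j
    using that i by (auto simp: \<tau>_def)
  let ?J = "{..<Suc d} - {i}"
  define N where "N z = (\<Sum>j<Suc d. c j * (z j - cen j)\<^sup>2)" for z :: "nat \<Rightarrow> real"
  have N: "N z = c i * (z i - cen i)\<^sup>2 + (\<Sum>j\<in>?J. c j * (z j - cen j)\<^sup>2)" for z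
    unfolding N_def using i by (intro sum.remove) auto
  \<comment> \<open>\<open>R w\<close> recovers (z_i - cen_i)^2 from the new coordinates. It is
    written as a product with the constant 1 / c_i, because the elementary functions have no rule
    for quotients.\<close>
  define R where "R w = (w d + b - (\<Sum>j\<in>?J. c j * (w (\<tau> j) - cen j)\<^sup>2)) * (1 / c i)"
    for w :: "nat \<Rightarrow> real"
  define \<phi> where "\<phi> z j = (if k \<le> j then 0 else if j < d then z (\<tau> j)
      else if j = d then N z - b else z j - e j)" for z j
  define \<psi> where "\<psi> w j = (if k \<le> j then 0 else if j = i then cen i + sgn \<sigma> * R w powr (1/2)
      else if j < Suc d then w (\<tau> j) else w j + e j)" for w j
  \<comment> \<open>The half space on the side of cen_i on which \<open>p\<close> lies; this fixes
    the branch of the square root.\<close>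
  define U where "U = {z \<in> Rn k. 0 < \<sigma> * (z i - cen i)}"
  define V where "V = {w \<in> Rn k. 0 < R w}"
  have elN: "elementary S N" for S
    unfolding N_def by (intro elementary_sum elementary_mult elementary_const elementary_power
        elementary_diff elementary_coordinate) simp
  have elR: "elementary S R" for S
    unfolding R_def by (intro elementary_sum elementary_mult elementary_const elementary_power
        elementary_diff elementary_add elementary_coordinate) simp
  have el\<phi>: "elementary U (\<lambda>z. \<phi> z j)" for j
  proof -
    consider "k \<le> j" | "j < k" "j < d" | "j < k" "j = d" | "j < k" "d < j" by linarith
    then show ?thesis
      by cases (auto simp: \<phi>_def intro!: elementary_diff elN elementary_const elementary_coordinate)
  qed
  have el\<psi>: "elementary V (\<lambda>w. \<psi> w j)" for j
  proof -
    have 1: "elementary V (\<lambda>w. cen i + sgn \<sigma> * R w powr (1/2))"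
      by (intro elementary_add elementary_mult elementary_powr elR elementary_const)
         (auto simp: V_def)
    have 2: "elementary V (\<lambda>w. w j + e j)"
      by (intro elementary_add elementary_const elementary_coordinate)
    consider "k \<le> j" | "j < k" "j = i" | "j < k" "j \<noteq> i" "j < Suc d" | "j < k" "j \<noteq> i" "\<not> j < Suc d"
      by linarith
    then show ?thesis
      using 1 2 by cases (simp_all add: \<psi>_def elementary_const elementary_coordinate)
  qed
  have openU: "openin (Euclidean_space k) U"
    unfolding U_def by (intro openin_Rn_positive continuous_intros)
  have openV: "openin (Euclidean_space k) V"
    unfolding V_def by (intro openin_Rn_positive elementary_continuous_on elR)
  have ik: "i < k" using i assms by simp
  have R\<phi>: "R (\<phi> z) = (z i - cen i)\<^sup>2" for z
  proof -
    have "(\<Sum>j\<in>?J. c j * (\<phi> z (\<tau> j) - cen j)\<^sup>2) = (\<Sum>j\<in>?J. c j * (z j - cen j)\<^sup>2)"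
    proof (rule sum.cong)
      fix j assume "j \<in> ?J"
      then have "\<tau> j < d" using \<tau>_less by auto
      then show "c j * (\<phi> z (\<tau> j) - cen j)\<^sup>2 = c j * (z j - cen j)\<^sup>2"
        using assms(2) by (simp add: \<phi>_def \<tau>\<tau>)
    qed simp
    then have "R (\<phi> z) = c i * (z i - cen i)\<^sup>2 * (1 / c i)"
      using assms(2) by (simp add: R_def N) (simp add: \<phi>_def N)
    then show ?thesis using c by simp
  qed
  have \<phi>V: "\<phi> z \<in> V" if "z \<in> U" for z
    using that R\<phi>[of z] by (auto simp: U_def V_def Rn_eq \<phi>_def)
  have \<psi>i: "\<psi> w i - cen i = sgn \<sigma> * R w powr (1/2)" for w
    using ik by (simp add: \<psi>_def)
  have \<psi>U: "\<psi> w \<in> U" if "w \<in> V" for w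
  proof -
    have "\<sigma> * (sgn \<sigma> * R w powr (1/2)) > 0"
      using that \<sigma> by (simp add: V_def mult.assoc[symmetric] abs_sgn[symmetric])
    then show ?thesis by (auto simp: U_def \<psi>i Rn_eq) (auto simp: \<psi>_def)
  qed
  have \<psi>\<phi>: "\<psi> (\<phi> z) = z" if z: "z \<in> U" for z
  proof
    fix j
    have "sgn \<sigma> * \<bar>z i - cen i\<bar> = z i - cen i"
      using z by (auto simp: U_def sgn_if zero_less_mult_iff)
    then have "cen i + sgn \<sigma> * R (\<phi> z) powr (1/2) = z i"
      by (simp add: R\<phi> powr_half_sqrt)
    moreover have "z j = 0" if "k \<le> j" using that z by (auto simp: U_def Rn_eq)
    moreover have "\<phi> z (\<tau> j) = z j" if "j < Suc d" "j \<noteq> i"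
      using \<tau>_less[OF that] assms(2) by (simp add: \<phi>_def \<tau>\<tau>)
    moreover have "\<phi> z j + e j = z j" if "\<not> j < Suc d" "j < k"
      using that by (simp add: \<phi>_def)
    ultimately show "\<psi> (\<phi> z) j = z j" by (auto simp: \<psi>_def)
  qed
  have \<phi>\<psi>: "\<phi> (\<psi> w) = w" if w: "w \<in> V" for w
  proof
    fix j
    have sq: "(sgn \<sigma> * R w powr (1/2))\<^sup>2 = R w"
      using w \<sigma> by (simp add: V_def power_mult_distrib powr_half_sqrt sgn_if)
    have "(\<Sum>j\<in>?J. c j * (\<psi> w j - cen j)\<^sup>2) = (\<Sum>j\<in>?J. c j * (w (\<tau> j) - cen j)\<^sup>2)"
      using assms(2) by (intro sum.cong) (auto simp: \<psi>_def)
    then have "N (\<psi> w) - b = w d"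
      using c by (simp add: N \<psi>i sq) (simp add: R_def)
    moreover have "\<psi> w (\<tau> j) = w j" if "j < d"
      using \<tau>_less'[OF that] assms(2) by (simp add: \<psi>_def \<tau>\<tau>)
    moreover have "\<psi> w j - e j = w j" if "d < j" "j < k"
      using that i by (simp add: \<psi>_def)
    moreover have "w j = 0" if "k \<le> j" using that w by (auto simp: V_def Rn_eq)
    ultimately show "\<phi> (\<psi> w) j = w j" by (auto simp: \<phi>_def)
  qed
  have bij: "bij_betw \<phi> U V"
    by (rule bij_betw_byWitness[where f' = \<psi>]) (use \<psi>\<phi> \<phi>\<psi> \<phi>V \<psi>U in auto)
  have inv: "inv_into U \<phi> w = \<psi> w" if "w \<in> V" for w
    using that bij \<psi>U \<phi>\<psi> by (intro inv_into_f_eq) (auto simp: bij_betw_def)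
  have "diffeomorphism k U V \<phi>"
    unfolding diffeomorphism_def
    using openU openV bij openin_subset[OF openU] openin_subset[OF openV]
    by (auto intro!: smooth_fun_on_elementary[OF openU el\<phi>] smooth_fun_on_elementary[OF openV el\<psi>]
        simp: inv)
  moreover have "p \<in> U"
    using p \<sigma> by (auto simp: U_def X_def \<sigma>_def zero_less_mult_iff)
  moreover have "\<phi> ` (X \<inter> U) = {y \<in> V. (\<forall>i<0. 0 \<le> y i) \<and> (\<forall>i. d \<le> i \<longrightarrow> y i = 0)}"
  proof (intro equalityI subsetI)
    fix y assume "y \<in> \<phi> ` (X \<inter> U)"
    then obtain z where z: "z \<in> X" "z \<in> U" "y = \<phi> z" by auto
    then have "N z = b" "\<And>j. d < j \<Longrightarrow> j < k \<Longrightarrow> z j = e j" by (auto simp: X_def N_def)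
    then have "y j = 0" if "d \<le> j" for j
      using that by (auto simp: z \<phi>_def)
    then show "y \<in> {y \<in> V. (\<forall>i<0. 0 \<le> y i) \<and> (\<forall>i. d \<le> i \<longrightarrow> y i = 0)}"
      using z \<phi>V by auto
  next
    fix y assume "y \<in> {y \<in> V. (\<forall>i<0. 0 \<le> y i) \<and> (\<forall>i. d \<le> i \<longrightarrow> y i = 0)}"
    then have y: "y \<in> V" "\<And>j. d \<le> j \<Longrightarrow> \<phi> (\<psi> y) j = 0" using \<phi>\<psi> by auto
    have "N (\<psi> y) = b" using y(2)[of d] assms(2) by (simp add: \<phi>_def)
    moreover have "\<psi> y j = e j" if "d < j" "j < k" for j
      using y(2)[of j] that by (simp add: \<phi>_def)
    ultimately have "\<psi> y \<in> X" using \<psi>U[OF y(1)] by (auto simp: X_def N_def U_def)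
    then show "y \<in> \<phi> ` (X \<inter> U)"
      using \<psi>U[OF y(1)] \<phi>\<psi>[OF y(1)] by (metis IntI image_eqI)
  qed
  ultimately have "\<exists>U V \<phi>. diffeomorphism k U V \<phi> \<and> p \<in> U \<and>
      \<phi> ` (X \<inter> U) = {y \<in> V. (\<forall>i<0. 0 \<le> y i) \<and> (\<forall>i. d \<le> i \<longrightarrow> y i = 0)}"
    by blast
  then show ?thesis
    using assms(2) by (simp add: slice_chart_def)
qed


section \<open>Locally finite CW structures\<close>

text \<open>Cells are indexed, so that their dimensions and maps can be given directly on the index
  set and products are formed by pairing indices. Local finiteness stands in for the weak topology:
  it implies it and is inherited by the product with a line.\<close>

definition indexed_CW ::
  "'a topology \<Rightarrow> 'i set \<Rightarrow> ('i \<Rightarrow> 'a set) \<Rightarrow> ('i \<Rightarrow> nat) \<Rightarrow> ('i \<Rightarrow> (nat \<Rightarrow> real) \<Rightarrow> 'a) \<Rightarrow> bool" where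
  "indexed_CW X I c \<delta> \<Phi> \<longleftrightarrow>
     Hausdorff_space X \<and> (\<Union>i\<in>I. c i) = topspace X \<and>
     (\<forall>i\<in>I. \<forall>j\<in>I. i \<noteq> j \<longrightarrow> c i \<inter> c j = {}) \<and>
     (\<forall>i\<in>I. continuous_map (top_of_set (disc (\<delta> i))) X (\<Phi> i) \<and>
        homeomorphic_map (top_of_set (open_disc (\<delta> i))) (subtopology X (c i)) (\<Phi> i)) \<and>
     (\<forall>i\<in>I. \<exists>F. finite F \<and> F \<subseteq> {j\<in>I. \<delta> j < \<delta> i} \<and>
        \<Phi> i ` (disc (\<delta> i) - open_disc (\<delta> i)) \<subseteq> (\<Union>j\<in>F. c j)) \<and>
     (\<forall>x\<in>topspace X. \<exists>V. openin X V \<and> x \<in> V \<and> finite {i\<in>I. c i \<inter> V \<noteq> {}})"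

lemma disc_subset_Rn: "disc d \<subseteq> Rn d" and open_disc_subset_Rn: "open_disc d \<subseteq> Rn d"
  by (auto simp: disc_def open_disc_def)

lemma open_disc_subset_disc: "open_disc d \<subseteq> disc d"
  by (auto simp: disc_def open_disc_def)

lemma zero_in_open_disc: "(\<lambda>_. 0) \<in> open_disc d"
  by (auto simp: open_disc_def Rn_eq)

lemma
  assumes "indexed_CW X I c \<delta> \<Phi>"
  shows indexed_CW_Hausdorff: "Hausdorff_space X"
    and indexed_CW_Union: "(\<Union>i\<in>I. c i) = topspace X"
    and indexed_CW_disjoint: "\<lbrakk>i \<in> I; j \<in> I; i \<noteq> j\<rbrakk> \<Longrightarrow> c i \<inter> c j = {}"
    and indexed_CW_continuous: "i \<in> I \<Longrightarrow> continuous_map (top_of_set (disc (\<delta> i))) X (\<Phi> i)"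
    and indexed_CW_homeomorphic: "i \<in> I \<Longrightarrow>
      homeomorphic_map (top_of_set (open_disc (\<delta> i))) (subtopology X (c i)) (\<Phi> i)"
    and indexed_CW_boundary: "i \<in> I \<Longrightarrow> \<exists>F. finite F \<and> F \<subseteq> {j\<in>I. \<delta> j < \<delta> i} \<and>
      \<Phi> i ` (disc (\<delta> i) - open_disc (\<delta> i)) \<subseteq> (\<Union>j\<in>F. c j)"
    and indexed_CW_locally_finite: "x \<in> topspace X \<Longrightarrow>
      \<exists>V. openin X V \<and> x \<in> V \<and> finite {i\<in>I. c i \<inter> V \<noteq> {}}"
    and indexed_CW_subset: "i \<in> I \<Longrightarrow> c i \<subseteq> topspace X"
proof -
  note * = assms[unfolded indexed_CW_def, THEN conjunct1]
    assms[unfolded indexed_CW_def, THEN conjunct2, THEN conjunct1]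
    assms[unfolded indexed_CW_def, THEN conjunct2, THEN conjunct2, THEN conjunct1]
    assms[unfolded indexed_CW_def, THEN conjunct2, THEN conjunct2, THEN conjunct2, THEN conjunct1]
    assms[unfolded indexed_CW_def, THEN conjunct2, THEN conjunct2, THEN conjunct2, THEN conjunct2,
      THEN conjunct1]
    assms[unfolded indexed_CW_def, THEN conjunct2, THEN conjunct2, THEN conjunct2, THEN conjunct2,
      THEN conjunct2]
  show "Hausdorff_space X" "(\<Union>i\<in>I. c i) = topspace X" by (fact *)+
  show "\<lbrakk>i \<in> I; j \<in> I; i \<noteq> j\<rbrakk> \<Longrightarrow> c i \<inter> c j = {}" using *(3) by blast
  show "i \<in> I \<Longrightarrow> continuous_map (top_of_set (disc (\<delta> i))) X (\<Phi> i)"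
    "i \<in> I \<Longrightarrow> homeomorphic_map (top_of_set (open_disc (\<delta> i))) (subtopology X (c i)) (\<Phi> i)"
    using *(4) by blast+
  show "i \<in> I \<Longrightarrow> \<exists>F. finite F \<and> F \<subseteq> {j\<in>I. \<delta> j < \<delta> i} \<and>
      \<Phi> i ` (disc (\<delta> i) - open_disc (\<delta> i)) \<subseteq> (\<Union>j\<in>F. c j)"
    by (rule bspec[OF *(5)])
  show "x \<in> topspace X \<Longrightarrow> \<exists>V. openin X V \<and> x \<in> V \<and> finite {i\<in>I. c i \<inter> V \<noteq> {}}"
    by (rule bspec[OF *(6)])
  show "i \<in> I \<Longrightarrow> c i \<subseteq> topspace X" using *(2) by blast
qed

lemma indexed_CW_cell_eq:
  assumes "indexed_CW X I c \<delta> \<Phi>" "i \<in> I"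
  shows "c i = \<Phi> i ` open_disc (\<delta> i)"
proof -
  have "\<Phi> i ` topspace (top_of_set (open_disc (\<delta> i))) = topspace (subtopology X (c i))"
    using assms by (intro homeomorphic_imp_surjective_map indexed_CW_homeomorphic)
  then show ?thesis using indexed_CW_subset[OF assms] by (simp add: inf_absorb2)
qed

text \<open>The weak topology comes from local finiteness: \<open>A\<close> is the union of its
  pieces in the closures of the cells, these pieces are closed and form a locally finite family, and
  such a union is closed.\<close>

lemma indexed_CW_imp_CW_complex:
  assumes CW: "indexed_CW X I c \<delta> \<Phi>" and d: "\<And>i. i \<in> I \<Longrightarrow> \<delta> i \<le> d"
  shows "CW_complex_dim_le d X"
proof -
  \<comment> \<open>Disjoint cells are distinct sets once they are non-empty, and then the index can
    be read off from the cell.\<close>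
  have ne: "c i \<noteq> {}" if "i \<in> I" for i
    using indexed_CW_cell_eq[OF CW that] zero_in_open_disc by auto
  have inj: "inj_on c I"
    using indexed_CW_disjoint[OF CW] ne by (intro inj_onI) (metis inf.idem)
  define ix where "ix = inv_into I c"
  have ix: "ix (c i) = i" if "i \<in> I" for i
    using that inj by (simp add: ix_def)
  have weak: "closedin X A" if A: "A \<subseteq> topspace X" "\<forall>i\<in>I. closedin X (A \<inter> X closure_of c i)" for A
  proof -
    have sub: "c i \<subseteq> X closure_of c i" if "i \<in> I" for i
      using indexed_CW_subset[OF CW that] by (rule closure_of_subset)
    have "A = (\<Union>i\<in>I. A \<inter> X closure_of c i)"
      using A(1) indexed_CW_Union[OF CW] sub by blast
    moreover have "closedin X (\<Union>((\<lambda>i. A \<inter> X closure_of c i) ` I))"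
    proof (rule closedin_locally_finite_Union)
      show "locally_finite_in X ((\<lambda>i. A \<inter> X closure_of c i) ` I)"
        unfolding locally_finite_in_def
      proof (intro conjI ballI)
        fix x assume "x \<in> topspace X"
        then obtain V where V: "openin X V" "x \<in> V" "finite {i\<in>I. c i \<inter> V \<noteq> {}}"
          using indexed_CW_locally_finite[OF CW] by blast
        \<comment> \<open>An open set that meets the closure of a cell meets the cell
          itself.\<close>
        have "{U \<in> (\<lambda>i. A \<inter> X closure_of c i) ` I. U \<inter> V \<noteq> {}}
            \<subseteq> (\<lambda>i. A \<inter> X closure_of c i) ` {i\<in>I. c i \<inter> V \<noteq> {}}"
          using openin_Int_closure_of_eq_empty[OF V(1)] by blast
        then have "finite {U \<in> (\<lambda>i. A \<inter> X closure_of c i) ` I. U \<inter> V \<noteq> {}}"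
          using V(3) by (meson finite_imageI finite_subset)
        then show "\<exists>V. openin X V \<and> x \<in> V \<and> finite {U \<in> (\<lambda>i. A \<inter> X closure_of c i) ` I. U \<inter> V \<noteq> {}}"
          using V by blast
      qed (use A in auto)
    qed (use A in auto)
    ultimately show ?thesis by simp
  qed
  have bd: "\<exists>\<F>. finite \<F> \<and> \<F> \<subseteq> {e' \<in> c ` I. \<delta> (ix e') < \<delta> i} \<and>
      \<Phi> i ` (disc (\<delta> i) - open_disc (\<delta> i)) \<subseteq> \<Union>\<F>" if i: "i \<in> I" for i
  proof -
    obtain F where "finite F" "F \<subseteq> {j\<in>I. \<delta> j < \<delta> i}"
      "\<Phi> i ` (disc (\<delta> i) - open_disc (\<delta> i)) \<subseteq> (\<Union>j\<in>F. c j)"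
      using indexed_CW_boundary[OF CW i] by auto
    then show ?thesis by (intro exI[of _ "c ` F"]) (auto simp: ix)
  qed
  have "CW_structure X (c ` I) (\<lambda>e. \<delta> (ix e)) (\<lambda>e. \<Phi> (ix e))"
    unfolding CW_structure_def
  proof (intro conjI ballI allI impI)
    show "Hausdorff_space X" "\<Union> (c ` I) = topspace X"
      by (fact indexed_CW_Hausdorff[OF CW], fact indexed_CW_Union[OF CW])
    show "pairwise disjnt (c ` I)"
      using indexed_CW_disjoint[OF CW] unfolding pairwise_def disjnt_def by blast
  next
    fix e assume "e \<in> c ` I"
    then obtain i where i: "i \<in> I" "e = c i" by auto
    show "continuous_map (subtopology (Euclidean_space (\<delta> (ix e))) (disc (\<delta> (ix e)))) X (\<Phi> (ix e))"
      "homeomorphic_map (subtopology (Euclidean_space (\<delta> (ix e))) (open_disc (\<delta> (ix e))))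
        (subtopology X e) (\<Phi> (ix e))"
      using indexed_CW_continuous[OF CW i(1)] indexed_CW_homeomorphic[OF CW i(1)] i
      by (auto simp: ix subtopology_Euclidean_space_eq[OF disc_subset_Rn]
          subtopology_Euclidean_space_eq[OF open_disc_subset_Rn])
    show "\<exists>\<F>. finite \<F> \<and> \<F> \<subseteq> {e' \<in> c ` I. \<delta> (ix e') < \<delta> (ix e)} \<and>
        \<Phi> (ix e) ` (disc (\<delta> (ix e)) - open_disc (\<delta> (ix e))) \<subseteq> \<Union>\<F>"
      using bd[OF i(1)] i by (simp add: ix)
  next
    fix A assume "A \<subseteq> topspace X" "\<forall>e\<in>c ` I. closedin X (A \<inter> X closure_of e)"
    then show "closedin X A" using weak by auto
  qed
  then show ?thesis
    unfolding CW_complex_dim_le_def using d ix by fastforce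
qed

lemma indexed_CW_homeomorphic_map:
  assumes CW: "indexed_CW X I c \<delta> \<Phi>" and h: "homeomorphic_map X Y h"
  shows "indexed_CW Y I (\<lambda>i. h ` c i) \<delta> (\<lambda>i. h \<circ> \<Phi> i)"
proof -
  have inj: "inj_on h (topspace X)" and im: "h ` topspace X = topspace Y"
    by (fact homeomorphic_imp_injective_map[OF h], fact homeomorphic_imp_surjective_map[OF h])
  note sub = indexed_CW_subset[OF CW]
  show ?thesis
    unfolding indexed_CW_def
  proof (intro conjI ballI impI)
    show "Hausdorff_space Y"
      using indexed_CW_Hausdorff[OF CW] h homeomorphic_Hausdorff_space
        homeomorphic_map_imp_homeomorphic_space by blast
    show "(\<Union>i\<in>I. h ` c i) = topspace Y"
      using indexed_CW_Union[OF CW] im by (metis image_UN)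
  next
    fix i j assume ij: "i \<in> I" "j \<in> I" "i \<noteq> j"
    then have "h ` c i \<inter> h ` c j = h ` (c i \<inter> c j)"
      using inj sub by (metis inj_on_image_Int)
    then show "h ` c i \<inter> h ` c j = {}" using indexed_CW_disjoint[OF CW ij] by auto
  next
    fix i assume i: "i \<in> I"
    show "continuous_map (top_of_set (disc (\<delta> i))) Y (h \<circ> \<Phi> i)"
      by (rule continuous_map_compose[OF indexed_CW_continuous[OF CW i] homeomorphic_imp_continuous_map[OF h]])
    have "homeomorphic_map (subtopology X (c i)) (subtopology Y (h ` c i)) h"
      using sub[OF i] im by (intro homeomorphic_map_subtopologies[OF h]) blast
    then show "homeomorphic_map (top_of_set (open_disc (\<delta> i))) (subtopology Y (h ` c i)) (h \<circ> \<Phi> i)"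
      by (rule homeomorphic_map_compose[OF indexed_CW_homeomorphic[OF CW i]])
    obtain F where "finite F" "F \<subseteq> {j\<in>I. \<delta> j < \<delta> i}"
      "\<Phi> i ` (disc (\<delta> i) - open_disc (\<delta> i)) \<subseteq> (\<Union>j\<in>F. c j)"
      using indexed_CW_boundary[OF CW i] by auto
    then show "\<exists>F. finite F \<and> F \<subseteq> {j \<in> I. \<delta> j < \<delta> i} \<and>
        (h \<circ> \<Phi> i) ` (disc (\<delta> i) - open_disc (\<delta> i)) \<subseteq> (\<Union>j\<in>F. h ` c j)"
      by (intro exI[of _ F]) (simp only: image_comp[symmetric] image_UN[symmetric] image_mono simp_thms)
  next
    fix y assume "y \<in> topspace Y"
    then obtain x where x: "x \<in> topspace X" "y = h x" using im by auto
    then obtain V where V: "openin X V" "x \<in> V" "finite {i\<in>I. c i \<inter> V \<noteq> {}}"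
      using indexed_CW_locally_finite[OF CW] by blast
    have "{i\<in>I. h ` c i \<inter> h ` V \<noteq> {}} \<subseteq> {i\<in>I. c i \<inter> V \<noteq> {}}"
    proof
      fix i assume i: "i \<in> {i\<in>I. h ` c i \<inter> h ` V \<noteq> {}}"
      then obtain z w where "z \<in> c i" "w \<in> V" "h z = h w" by auto
      moreover have "c i \<subseteq> topspace X" "V \<subseteq> topspace X"
        using i sub openin_subset[OF V(1)] by auto
      ultimately have "z = w" using inj by (auto dest: inj_onD)
      then show "i \<in> {i\<in>I. c i \<inter> V \<noteq> {}}"
        using i \<open>z \<in> c i\<close> \<open>w \<in> V\<close> by auto
    qed
    then show "\<exists>V. openin Y V \<and> y \<in> V \<and> finite {i\<in>I. h ` c i \<inter> V \<noteq> {}}"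
      using V x homeomorphic_map_openness_eq[OF h]
      by (intro exI[of _ "h ` V"]) (meson finite_subset imageI)
  qed
qed

section \<open>Cell structures of a point and of spheres\<close>

lemma homeomorphic_map_top_of_set:
  assumes "continuous_on S f" "continuous_on T g" "f ` S \<subseteq> T" "g ` T \<subseteq> S"
    and "\<And>x. x \<in> S \<Longrightarrow> g (f x) = x" "\<And>y. y \<in> T \<Longrightarrow> f (g y) = y"
  shows "homeomorphic_map (top_of_set S) (top_of_set T) f"
  unfolding homeomorphic_map_maps homeomorphic_maps_def
  by (intro exI[of _ g]) (use assms in \<open>auto simp: continuous_map_in_subtopology\<close>)

lemma indexed_CW_point:
  assumes "topspace X = {a}"
  shows "indexed_CW X {()} (\<lambda>_. {a}) (\<lambda>_. 0) (\<lambda>_ _. a)"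
proof -
  have disc0: "disc 0 = {\<lambda>_. 0}" "open_disc 0 = {\<lambda>_. 0}"
    by (auto simp: disc_def open_disc_def Rn_eq)
  have "homeomorphic_map (top_of_set {\<lambda>_. 0 :: real}) X (\<lambda>_ :: nat \<Rightarrow> real. a)"
    unfolding homeomorphic_map_maps homeomorphic_maps_def
    using assms by (intro exI[of _ "\<lambda>_ _. 0"]) auto
  moreover have "subtopology X {a} = X"
    using assms by (metis subtopology_topspace)
  moreover have "Hausdorff_space X"
    using assms by (auto simp: Hausdorff_space_def)
  ultimately show ?thesis
    using assms unfolding indexed_CW_def by (auto simp: disc0 intro!: exI[of _ "{a}"])
      (metis openin_topspace)
qed


definition unit_sphere :: "nat \<Rightarrow> (nat \<Rightarrow> real) set" where
  "unit_sphere q = {x \<in> Rn (Suc q). (\<Sum>i<Suc q. (x i)\<^sup>2) = 1}"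

text \<open>The disc is wrapped around the sphere; its boundary is collapsed to the north pole.\<close>

definition collapse :: "nat \<Rightarrow> (nat \<Rightarrow> real) \<Rightarrow> nat \<Rightarrow> real" where
  "collapse q x = (\<lambda>i. if i < q then 2 * sqrt (1 - (\<Sum>j<q. (x j)\<^sup>2)) * x i
     else if i = q then 2 * (\<Sum>j<q. (x j)\<^sup>2) - 1 else 0)"

definition north_pole :: "nat \<Rightarrow> nat \<Rightarrow> real" where
  "north_pole q = (\<lambda>i. if i = q then 1 else 0)"

lemma continuous_on_collapse: "continuous_on S (collapse q)"
proof (rule continuous_on_coordinatewise_then_product)
  fix i
  consider "i < q" | "i = q" | "q < i" by linarith
  then show "continuous_on S (\<lambda>x. collapse q x i)"
    by cases (auto simp: collapse_def intro!: continuous_intros)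
qed

text \<open>With r = |x|^2 the squared length of the image is 4 (1 - r) r + (2 r - 1)^2 = 1.
  Geometrically, a point at radius sin \<theta> is sent to the angle 2 \<theta> from the south pole,
  since 2 r - 1 = - cos (2 \<theta>) and 2 sqrt (1 - r) |x| = sin (2 \<theta>).\<close>

lemma collapse_in_sphere:
  assumes "x \<in> disc q"
  shows "collapse q x \<in> unit_sphere q"
proof -
  define r where "r = (\<Sum>j<q. (x j)\<^sup>2)"
  have r: "r \<le> 1" using assms by (simp add: disc_def r_def)
  have "(\<Sum>i<q. (collapse q x i)\<^sup>2) = (\<Sum>i<q. 4 * (1 - r) * (x i)\<^sup>2)"
    using r by (intro sum.cong) (auto simp: collapse_def r_def[symmetric] power_mult_distrib)
  also have "\<dots> = 4 * (1 - r) * r"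
    by (simp add: r_def sum_distrib_left)
  finally have "(\<Sum>i<Suc q. (collapse q x i)\<^sup>2) = 4 * (1 - r) * r + (2 * r - 1)\<^sup>2"
    by (simp add: collapse_def r_def[symmetric])
  also have "\<dots> = 1" by (simp add: power2_eq_square algebra_simps)
  finally show ?thesis by (simp add: unit_sphere_def Rn_eq collapse_def)
qed

lemma collapse_boundary:
  assumes "x \<in> disc q - open_disc q"
  shows "collapse q x = north_pole q"
proof -
  have "(\<Sum>j<q. (x j)\<^sup>2) = 1" using assms by (auto simp: disc_def open_disc_def)
  then show ?thesis by (auto simp: collapse_def north_pole_def)
qed

lemma north_pole_in_sphere: "north_pole q \<in> unit_sphere q"
proof -
  have "(\<Sum>i<q. (north_pole q i)\<^sup>2) = 0" by (rule sum.neutral) (auto simp: north_pole_def)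
  then show ?thesis by (simp add: unit_sphere_def Rn_eq) (simp add: north_pole_def)
qed

text \<open>If the last coordinate is at least 1, it uses up the whole unit length and the other
  coordinates vanish. The strict inequality lets the inverse of \<open>collapse\<close> divide by
  the square root of 1 - y_q.\<close>

lemma sphere_minus_north_pole:
  assumes "y \<in> unit_sphere q - {north_pole q}"
  shows "y q < 1"
proof (rule ccontr)
  assume "\<not> y q < 1"
  then have "1 \<le> (y q)\<^sup>2" by (simp add: power2_eq_square mult_ge1_I)
  moreover have eq: "(\<Sum>i<q. (y i)\<^sup>2) + (y q)\<^sup>2 = 1" using assms by (simp add: unit_sphere_def)
  moreover have "0 \<le> (\<Sum>i<q. (y i)\<^sup>2)" by (simp add: sum_nonneg)
  ultimately have z: "(\<Sum>i<q. (y i)\<^sup>2) = 0" and "(y q)\<^sup>2 = 1" by linarith+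
  then have "y q = 1" using \<open>\<not> y q < 1\<close> by (simp add: power2_eq_1_iff)
  moreover have "y i = 0" if "i < q" for i
    using z that by (subst (asm) sum_nonneg_eq_0_iff) auto
  moreover have "y i = 0" if "q < i" for i
    using assms that by (auto simp: unit_sphere_def Rn_eq)
  ultimately have "y i = north_pole q i" for i
    by (cases i q rule: linorder_cases) (auto simp: north_pole_def)
  then have "y = north_pole q" by auto
  then show False using assms by simp
qed

lemma homeomorphic_map_collapse:
  "homeomorphic_map (top_of_set (open_disc q)) (top_of_set (unit_sphere q - {north_pole q})) (collapse q)"
proof (rule homeomorphic_map_top_of_set)
  \<comment> \<open>Solves the formula of \<open>collapse\<close> for \<open>x\<close>: from y_q = 2
    r - 1 one gets 2 (1 - y_q) = 4 (1 - r), so the factor 2 sqrt (1 - r) equals sqrt (2 (1 -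
    y_q)).\<close>
  define g :: "(nat \<Rightarrow> real) \<Rightarrow> nat \<Rightarrow> real"
    where "g y = (\<lambda>i. if i < q then y i / sqrt (2 * (1 - y q)) else 0)" for y
  let ?S = "unit_sphere q - {north_pole q}"
  show "continuous_on (open_disc q) (collapse q)" by (rule continuous_on_collapse)
  show "continuous_on ?S g"
  proof (rule continuous_on_coordinatewise_then_product)
    fix i
    show "continuous_on ?S (\<lambda>y. g y i)"
    proof (cases "i < q")
      case True
      moreover have "continuous_on ?S (\<lambda>y. y i / sqrt (2 * (1 - y q)))"
        by (intro continuous_intros ballI) (use sphere_minus_north_pole in fastforce)
      ultimately show ?thesis by (simp add: g_def)
    qed (simp add: g_def)
  qed
  have sq: "(\<Sum>i<q. (g y i)\<^sup>2) = (1 + y q) / 2" if y: "y \<in> ?S" for y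
  proof -
    have lt: "y q < 1" using sphere_minus_north_pole[OF y] .
    have "(\<Sum>i<q. (g y i)\<^sup>2) = (\<Sum>i<q. (y i)\<^sup>2) / (2 * (1 - y q))"
      unfolding sum_divide_distrib using lt
      by (intro sum.cong) (auto simp: g_def power_divide)
    also have "(\<Sum>i<q. (y i)\<^sup>2) = (1 + y q) * (1 - y q)"
      using y by (simp add: unit_sphere_def algebra_simps power2_eq_square)
    also have "(1 + y q) * (1 - y q) / (2 * (1 - y q)) = (1 + y q) / 2"
      by (rule nonzero_mult_divide_mult_cancel_right) (use lt in simp)
    finally show ?thesis .
  qed
  show "g ` ?S \<subseteq> open_disc q"
  proof
    fix x assume "x \<in> g ` ?S"
    then obtain y where y: "y \<in> ?S" "x = g y" by auto
    show "x \<in> open_disc q"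
      using sq[OF y(1)] sphere_minus_north_pole[OF y(1)] y by (simp add: open_disc_def Rn_eq) (simp add: g_def)
  qed
  show "collapse q ` open_disc q \<subseteq> ?S"
  proof
    fix y assume "y \<in> collapse q ` open_disc q"
    then obtain x where x: "x \<in> open_disc q" "y = collapse q x" by auto
    then have "y \<in> unit_sphere q" using collapse_in_sphere open_disc_subset_disc by blast
    moreover have "y q \<noteq> 1" using x by (simp add: collapse_def open_disc_def)
    ultimately show "y \<in> ?S" by (auto simp: north_pole_def)
  qed
  show "g (collapse q x) = x" if "x \<in> open_disc q" for x
  proof
    fix i
    define r where "r = (\<Sum>j<q. (x j)\<^sup>2)"
    have r: "r < 1" using that by (simp add: open_disc_def r_def)
    have "2 * (1 - collapse q x q) = 4 * (1 - r)" by (simp add: collapse_def r_def)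
    then have sq: "sqrt (2 * (1 - collapse q x q)) = 2 * sqrt (1 - r)"
      by (simp only: real_sqrt_mult real_sqrt_four)
    have "\<not> i < q \<Longrightarrow> x i = 0" using that by (auto simp: open_disc_def Rn_eq)
    moreover have "i < q \<Longrightarrow> collapse q x i = 2 * sqrt (1 - r) * x i"
      by (simp add: collapse_def r_def)
    ultimately show "g (collapse q x) i = x i"
      using r unfolding g_def sq by simp
  qed
  show "collapse q (g y) = y" if y: "y \<in> ?S" for y
  proof
    fix i
    have lt: "y q < 1" using sphere_minus_north_pole[OF y] .
    then have *: "2 * sqrt (1 - (1 + y q) / 2) = sqrt (2 * (1 - y q))"
    proof -
      have "2 * sqrt (1 - (1 + y q) / 2) = sqrt 4 * sqrt ((1 - y q) / 2)"
        by (simp add: field_simps)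
      also have "\<dots> = sqrt (4 * ((1 - y q) / 2))" by (simp only: real_sqrt_mult)
      finally show ?thesis by simp
    qed
    have "\<not> i < q \<Longrightarrow> i \<noteq> q \<Longrightarrow> y i = 0" using y by (auto simp: unit_sphere_def Rn_eq)
    then show "collapse q (g y) i = y i"
      using lt by (simp add: collapse_def sq[OF y] *) (simp add: g_def add_divide_distrib)
  qed
qed

text \<open>The index \<open>True\<close> stands for the top cell and \<open>False\<close> for the
  north pole. With q at least 1 the pole has smaller dimension than the cell attached to it, as the
  boundary condition demands.\<close>

lemma indexed_CW_sphere:
  assumes "1 \<le> q"
  shows "indexed_CW (top_of_set (unit_sphere q)) UNIV
    (\<lambda>b. if b then unit_sphere q - {north_pole q} else {north_pole q}) (\<lambda>b. if b then q else 0)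
    (\<lambda>b. if b then collapse q else (\<lambda>_. north_pole q))"
proof -
  have disc0: "disc 0 = {\<lambda>_. 0}" "open_disc 0 = {\<lambda>_. 0}"
    by (auto simp: disc_def open_disc_def Rn_eq)
  have T: "continuous_map (top_of_set (disc q)) (top_of_set (unit_sphere q)) (collapse q)"
    using continuous_on_collapse collapse_in_sphere by (auto simp: continuous_map_in_subtopology)
  have F: "homeomorphic_map (top_of_set {\<lambda>_. 0 :: real}) (top_of_set {north_pole q})
      (\<lambda>_ :: nat \<Rightarrow> real. north_pole q)"
    by (rule homeomorphic_map_top_of_set[where g = "\<lambda>_ _. 0"]) auto
  have sub: "subtopology (top_of_set (unit_sphere q)) (unit_sphere q - {north_pole q})
      = top_of_set (unit_sphere q - {north_pole q})"
    "subtopology (top_of_set (unit_sphere q)) {north_pole q} = top_of_set {north_pole q}"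
    using north_pole_in_sphere by (auto simp: subtopology_subtopology inf_absorb2 Int_absorb1)
  show ?thesis
    unfolding indexed_CW_def
  proof (intro conjI ballI impI)
    show "Hausdorff_space (top_of_set (unit_sphere q))"
      by (simp add: Hausdorff_space_subtopology)
    show "(\<Union>b\<in>UNIV. if b then unit_sphere q - {north_pole q} else {north_pole q})
        = topspace (top_of_set (unit_sphere q))"
      using north_pole_in_sphere by (auto simp: UNIV_bool)
  next
    fix b
    let ?\<delta> = "\<lambda>b. if b then q else 0" and ?c = "\<lambda>b. if b then unit_sphere q - {north_pole q} else {north_pole q}"
    let ?\<Phi> = "\<lambda>b. if b then collapse q else (\<lambda>_. north_pole q)"
    show "continuous_map (top_of_set (disc (?\<delta> b))) (top_of_set (unit_sphere q)) (?\<Phi> b)"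
      using T north_pole_in_sphere by (cases b) auto
    show "homeomorphic_map (top_of_set (open_disc (?\<delta> b)))
      (subtopology (top_of_set (unit_sphere q)) (?c b)) (?\<Phi> b)"
      using homeomorphic_map_collapse F by (cases b) (simp_all add: sub disc0)
    show "\<exists>F. finite F \<and> F \<subseteq> {j\<in>UNIV. ?\<delta> j < ?\<delta> b} \<and>
        ?\<Phi> b ` (disc (?\<delta> b) - open_disc (?\<delta> b)) \<subseteq> (\<Union>j\<in>F. ?c j)"
    proof (cases b)
      case True
      then show ?thesis
        using assms collapse_boundary by (intro exI[of _ "{False}"]) auto
    next
      case False
      then show ?thesis by (intro exI[of _ "{}"]) (simp add: disc0)
    qed
  next
    fix x assume "x \<in> topspace (top_of_set (unit_sphere q))"
    then show "\<exists>V. openin (top_of_set (unit_sphere q)) V \<and> x \<in> V \<and>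
        finite {i\<in>UNIV. (if i then unit_sphere q - {north_pole q} else {north_pole q}) \<inter> V \<noteq> {}}"
      by (intro exI[of _ "unit_sphere q"]) simp
  qed (auto split: if_splits)
qed

section \<open>Connectedness of discs and spheres\<close>

lemma connected_disc: "connected (disc d)"
proof -
  have "connected_component (disc d) (\<lambda>_. 0) x" if x: "x \<in> disc d" for x
    unfolding connected_component_def
  proof (intro exI conjI)
    let ?C = "(\<lambda>s i. s * x i) ` {0..1::real}"
    show "connected ?C"
      by (intro connected_continuous_image continuous_on_coordinatewise_then_product continuous_intros)
         simp
    show "(\<lambda>_. 0) \<in> ?C" by (rule image_eqI[of _ _ 0]) auto
    show "x \<in> ?C" by (rule image_eqI[of _ _ 1]) auto
    show "?C \<subseteq> disc d"
    proof clarify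
      fix s :: real assume "s \<in> {0..1}"
      then have "(\<Sum>i<d. (s * x i)\<^sup>2) \<le> (\<Sum>i<d. (x i)\<^sup>2)"
        by (intro sum_mono) (simp add: power_mult_distrib mult_left_le_one_le power_le_one)
      then show "(\<lambda>i. s * x i) \<in> disc d" using x by (auto simp: disc_def Rn_eq)
    qed
  qed
  then have "connected_component (disc d) x y" if "x \<in> disc d" "y \<in> disc d" for x y
    using that by (intro connected_component_trans[OF connected_component_sym[of _ "\<lambda>_. 0" x]])
  then show ?thesis by (simp add: connected_iff_connected_component)
qed

text \<open>The sphere is the image of the disc under \<open>collapse\<close>. The north pole is hit
  only by boundary points of the disc, which exist because q is at least 1; for q = 0 the sphere is
  a pair of points.\<close>

lemma connected_unit_sphere:
  assumes "1 \<le> q"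
  shows "connected (unit_sphere q)"
proof -
  have "collapse q ` disc q = unit_sphere q"
  proof (intro equalityI subsetI)
    fix y assume y: "y \<in> unit_sphere q"
    show "y \<in> collapse q ` disc q"
    proof (cases "y = north_pole q")
      case True
      have "(\<Sum>j<q. (if j = 0 then 1 else 0 :: real)\<^sup>2) = (\<Sum>j<q. if j = 0 then 1 else 0)"
        by (intro sum.cong) auto
      also have "\<dots> = 1" using assms by (simp add: sum.delta)
      finally have "(\<lambda>i. if i = 0 then 1 else 0) \<in> disc q - open_disc q"
        using assms by (auto simp: disc_def open_disc_def Rn_eq)
      then show ?thesis using collapse_boundary True by (metis DiffD1 image_eqI)
    next
      case False
      then have "y \<in> collapse q ` open_disc q"
        using homeomorphic_imp_surjective_map[OF homeomorphic_map_collapse[of q]] y by auto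
      then show ?thesis using open_disc_subset_disc by auto
    qed
  qed (auto simp: collapse_in_sphere)
  then show ?thesis
    using connected_continuous_image[OF continuous_on_collapse connected_disc] by metis
qed


text \<open>
  Rescaling along rays identifies the disc with the cylinder over the disc of one dimension less.
\<close>

definition euclid_norm :: "nat \<Rightarrow> (nat \<Rightarrow> real) \<Rightarrow> real" where
  "euclid_norm d x = sqrt (\<Sum>i<d. (x i)\<^sup>2)"

text \<open>The gauge whose unit ball is the cylinder \<open>disc d\<close> times [-1, 1].\<close>

definition cylinder_norm :: "nat \<Rightarrow> (nat \<Rightarrow> real) \<Rightarrow> real" where
  "cylinder_norm d x = max (euclid_norm d x) \<bar>x d\<bar>"

text \<open>Constant on open rays from the origin; scaling by it makes the cylinder norm of the
  image equal to the Euclidean norm of the argument. At the origin the quotient is 0 / 0, hence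
  0.\<close>

definition stretch_factor :: "nat \<Rightarrow> (nat \<Rightarrow> real) \<Rightarrow> real" where
  "stretch_factor d x = euclid_norm (Suc d) x / cylinder_norm d x"

lemma euclid_norm_scale: "euclid_norm d (\<lambda>i. r * x i) = \<bar>r\<bar> * euclid_norm d x"
  by (simp add: euclid_norm_def power_mult_distrib sum_distrib_left[symmetric] real_sqrt_mult)

lemma cylinder_norm_scale: "cylinder_norm d (\<lambda>i. r * x i) = \<bar>r\<bar> * cylinder_norm d x"
  by (simp add: cylinder_norm_def euclid_norm_scale abs_mult max_mult_distrib_left)

lemma euclid_norm_nonneg: "0 \<le> euclid_norm d x"
  by (simp add: euclid_norm_def sum_nonneg)

lemma cylinder_norm_nonneg: "0 \<le> cylinder_norm d x"
  by (simp add: cylinder_norm_def euclid_norm_nonneg le_max_iff_disj)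

lemma abs_le_euclid_norm: "j < d \<Longrightarrow> \<bar>x j\<bar> \<le> euclid_norm d x"
  unfolding euclid_norm_def by (rule real_le_rsqrt) (auto intro: member_le_sum)

lemma cylinder_norm_le_euclid_norm: "cylinder_norm d x \<le> euclid_norm (Suc d) x"
  using abs_le_euclid_norm[of d "Suc d" x]
  by (simp add: cylinder_norm_def) (simp add: euclid_norm_def)

lemma abs_le_cylinder_norm: "j < Suc d \<Longrightarrow> \<bar>x j\<bar> \<le> cylinder_norm d x"
  using abs_le_euclid_norm[of j d x] by (cases "j = d") (auto simp: cylinder_norm_def)

lemma cylinder_norm_eq_0:
  assumes "x \<in> Rn (Suc d)" "cylinder_norm d x = 0"
  shows "x = (\<lambda>_. 0)"
proof
  fix j
  show "x j = 0"
    using assms abs_le_cylinder_norm[of j d x] by (cases "j < Suc d") (auto simp: Rn_eq)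
qed

lemma euclid_norm_zero: "euclid_norm d (\<lambda>_. 0) = 0"
  by (simp add: euclid_norm_def)

lemma stretch_factor_pos:
  assumes "x \<in> Rn (Suc d)" "x \<noteq> (\<lambda>_. 0)"
  shows "0 < stretch_factor d x"
proof -
  have "0 < cylinder_norm d x"
    using assms cylinder_norm_eq_0 cylinder_norm_nonneg[of d x] by (metis less_eq_real_def)
  then show ?thesis
    using cylinder_norm_le_euclid_norm[of d x] by (simp add: stretch_factor_def)
qed

lemma stretch_factor_scale: "0 < r \<Longrightarrow> stretch_factor d (\<lambda>i. r * x i) = stretch_factor d x"
  by (simp add: stretch_factor_def euclid_norm_scale cylinder_norm_scale)

lemma continuous_on_euclid_norm [continuous_intros]: "continuous_on S (euclid_norm d)"
  unfolding euclid_norm_def by (intro continuous_intros)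

lemma continuous_on_cylinder_norm [continuous_intros]: "continuous_on S (cylinder_norm d)"
  unfolding cylinder_norm_def by (intro continuous_intros)

text \<open>Away from the zeros of \<open>m\<close> nothing is to be shown; at a zero,
  \<open>F\<close> is squeezed by \<open>B\<close>, which tends to 0 there. This handles the origin,
  where the stretch factor itself is discontinuous.\<close>

lemma continuous_on_dominated_zeros:
  fixes F B m :: "'a :: t2_space \<Rightarrow> real"
  assumes "continuous_on S m" "continuous_on {x \<in> S. m x \<noteq> 0} F" "continuous_on S B"
    and "\<And>x. x \<in> S \<Longrightarrow> \<bar>F x\<bar> \<le> B x" "\<And>x. x \<in> S \<Longrightarrow> m x = 0 \<Longrightarrow> B x = 0"
  shows "continuous_on S F"
proof (unfold continuous_on_def, intro ballI)
  fix x assume x: "x \<in> S"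
  show "(F \<longlongrightarrow> F x) (at x within S)"
  proof (cases "m x = 0")
    case True
    then have 0: "B x = 0" "F x = 0" using assms(4,5)[OF x] by auto
    have "(B \<longlongrightarrow> B x) (at x within S)" using assms(3) x by (simp add: continuous_on_def)
    then have "(B \<longlongrightarrow> 0) (at x within S)" by (simp only: 0)
    moreover have "\<forall>\<^sub>F y in at x within S. norm (F y) \<le> B y"
      using assms(4) by (auto simp: eventually_at_filter)
    ultimately have "(F \<longlongrightarrow> 0) (at x within S)" by (rule Lim_null_comparison[rotated])
    then show ?thesis by (simp only: 0)
  next
    case False
    have "openin (top_of_set S) (S \<inter> m -` (- {0}))"
      by (rule continuous_openin_preimage_gen[OF assms(1)]) auto
    then obtain T where T: "open T" "S \<inter> m -` (- {0}) = S \<inter> T" by (auto simp: openin_open)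
    then have "x \<in> T" using x False by auto
    then have "at x within S = at x within {x \<in> S. m x \<noteq> 0}"
      using T by (intro at_within_nhd[of x T]) auto
    then show ?thesis using assms(2) x False by (simp add: continuous_on_def)
  qed
qed

text \<open>Each coordinate is at most the cylinder norm and at most the Euclidean norm in absolute
  value. So scaling by the factor is dominated by the Euclidean norm, and scaling by its inverse by
  the cylinder norm.\<close>

lemma continuous_on_stretch:
  "continuous_on (Rn (Suc d)) (\<lambda>x i. stretch_factor d x * x i)"
  "continuous_on (Rn (Suc d)) (\<lambda>x i. inverse (stretch_factor d x) * x i)"
proof -
  have ne: "euclid_norm (Suc d) x \<noteq> 0" if "cylinder_norm d x \<noteq> 0" for x
    using that cylinder_norm_le_euclid_norm[of d x] cylinder_norm_nonneg[of d x] by auto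
  have zero: "x j = 0" if "x \<in> Rn (Suc d)" "\<not> j < Suc d" for x :: "nat \<Rightarrow> real" and j
    using that by (auto simp: Rn_eq)
  have "continuous_on (Rn (Suc d)) (\<lambda>x. stretch_factor d x * x j)" for j
  proof (rule continuous_on_dominated_zeros[where m = "cylinder_norm d" and B = "euclid_norm (Suc d)"])
    show "continuous_on {x \<in> Rn (Suc d). cylinder_norm d x \<noteq> 0} (\<lambda>x. stretch_factor d x * x j)"
      unfolding stretch_factor_def by (intro continuous_intros) auto
    fix x assume x: "x \<in> Rn (Suc d)"
    show "\<bar>stretch_factor d x * x j\<bar> \<le> euclid_norm (Suc d) x"
    proof (cases "j < Suc d \<and> cylinder_norm d x \<noteq> 0")
      case True
      have "\<bar>x j\<bar> / cylinder_norm d x \<le> 1"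
        using True abs_le_cylinder_norm[of j d x] cylinder_norm_nonneg[of d x] by simp
      then have "euclid_norm (Suc d) x * (\<bar>x j\<bar> / cylinder_norm d x) \<le> euclid_norm (Suc d) x"
        by (rule mult_left_le) (rule euclid_norm_nonneg)
      then show ?thesis
        using euclid_norm_nonneg cylinder_norm_nonneg by (simp add: stretch_factor_def abs_mult)
    qed (use zero[OF x, of j] in \<open>auto simp: euclid_norm_nonneg stretch_factor_def\<close>)
    show "euclid_norm (Suc d) x = 0" if "cylinder_norm d x = 0"
      using cylinder_norm_eq_0[OF x that] euclid_norm_zero by simp
  qed (intro continuous_intros)+
  then show "continuous_on (Rn (Suc d)) (\<lambda>x i. stretch_factor d x * x i)"
    by (rule continuous_on_coordinatewise_then_product)
  have "continuous_on (Rn (Suc d)) (\<lambda>x. inverse (stretch_factor d x) * x j)" for j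
  proof (rule continuous_on_dominated_zeros[where m = "cylinder_norm d" and B = "cylinder_norm d"])
    show "continuous_on {x \<in> Rn (Suc d). cylinder_norm d x \<noteq> 0} (\<lambda>x. inverse (stretch_factor d x) * x j)"
      unfolding stretch_factor_def using ne by (intro continuous_intros) auto
    fix x assume x: "x \<in> Rn (Suc d)"
    show "\<bar>inverse (stretch_factor d x) * x j\<bar> \<le> cylinder_norm d x"
    proof (cases "j < Suc d \<and> cylinder_norm d x \<noteq> 0")
      case True
      have "\<bar>x j\<bar> / euclid_norm (Suc d) x \<le> 1"
        using True ne[of x] abs_le_euclid_norm[of j "Suc d" x] euclid_norm_nonneg[of "Suc d" x] by simp
      then have "cylinder_norm d x * (\<bar>x j\<bar> / euclid_norm (Suc d) x) \<le> cylinder_norm d x"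
        by (rule mult_left_le) (rule cylinder_norm_nonneg)
      then show ?thesis
        using euclid_norm_nonneg cylinder_norm_nonneg by (simp add: stretch_factor_def abs_mult)
    qed (use zero[OF x, of j] in \<open>auto simp: cylinder_norm_nonneg stretch_factor_def\<close>)
  qed (auto intro: continuous_intros)
  then show "continuous_on (Rn (Suc d)) (\<lambda>x i. inverse (stretch_factor d x) * x i)"
    by (rule continuous_on_coordinatewise_then_product)
qed

lemma cylinder_norm_stretch:
  assumes "x \<in> Rn (Suc d)"
  shows "cylinder_norm d (\<lambda>i. stretch_factor d x * x i) = euclid_norm (Suc d) x"
proof (cases "cylinder_norm d x = 0")
  case True
  then show ?thesis
    using cylinder_norm_eq_0[OF assms True] euclid_norm_zero by (simp add: cylinder_norm_def)
next
  case False
  then show ?thesis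
    using cylinder_norm_nonneg[of d x] euclid_norm_nonneg[of "Suc d" x]
    by (simp add: cylinder_norm_scale) (simp add: stretch_factor_def)
qed

lemma euclid_norm_unstretch:
  assumes "x \<in> Rn (Suc d)"
  shows "euclid_norm (Suc d) (\<lambda>i. inverse (stretch_factor d x) * x i) = cylinder_norm d x"
proof (cases "x = (\<lambda>_. 0)")
  case True
  then show ?thesis by (simp add: euclid_norm_zero cylinder_norm_def)
next
  case False
  then have "0 < stretch_factor d x" using stretch_factor_pos assms by blast
  moreover from this have "euclid_norm (Suc d) x \<noteq> 0" by (auto simp: stretch_factor_def)
  ultimately show ?thesis by (simp add: euclid_norm_scale) (simp add: stretch_factor_def)
qed

text \<open>The height is split off as a real number, and index \<open>d\<close> is cleared so that
  the rest is a point of \<open>Rn d\<close>. The pair matches the product of a space with the real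
  line.\<close>

definition cylinder_map :: "nat \<Rightarrow> (nat \<Rightarrow> real) \<Rightarrow> (nat \<Rightarrow> real) \<times> real" where
  "cylinder_map d x = ((\<lambda>i. stretch_factor d x * x i)(d := 0), stretch_factor d x * x d)"

lemma disc_eq: "disc d = {x \<in> Rn d. euclid_norm d x \<le> 1}"
  and open_disc_eq: "open_disc d = {x \<in> Rn d. euclid_norm d x < 1}"
  by (auto simp: disc_def open_disc_def euclid_norm_def)

lemma euclid_norm_upd: "euclid_norm d (x(d := s)) = euclid_norm d x"
  by (simp add: euclid_norm_def)

text \<open>The stretching turns Euclidean norm into cylinder norm; hence interior goes to interior
  and boundary to boundary.\<close>

lemma cylinder_map_norms:
  assumes "x \<in> Rn (Suc d)" "cylinder_map d x = (v, h)"
  shows "v \<in> Rn d" "max (euclid_norm d v) \<bar>h\<bar> = euclid_norm (Suc d) x"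
proof -
  show "v \<in> Rn d" using assms by (auto simp: cylinder_map_def Rn_eq)
  have "max (euclid_norm d v) \<bar>h\<bar> = cylinder_norm d (\<lambda>i. stretch_factor d x * x i)"
    using assms(2) by (auto simp: cylinder_map_def cylinder_norm_def euclid_norm_upd)
  then show "max (euclid_norm d v) \<bar>h\<bar> = euclid_norm (Suc d) x"
    using cylinder_norm_stretch[OF assms(1)] by simp
qed

lemma continuous_on_fun_upd:
  fixes f :: "'a :: topological_space \<Rightarrow> nat \<Rightarrow> real"
  assumes "continuous_on S f" "continuous_on S g"
  shows "continuous_on S (\<lambda>x. (f x)(d := g x))"
proof (rule continuous_on_coordinatewise_then_product)
  fix i
  have "continuous_on S (\<lambda>x. f x i)" using assms(1) by (rule continuous_on_product_then_coordinatewise)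
  then show "continuous_on S (\<lambda>x. ((f x)(d := g x)) i)"
    using assms(2) by (cases "i = d") auto
qed

lemma continuous_on_cylinder_map: "continuous_on (Rn (Suc d)) (cylinder_map d)"
proof -
  have "continuous_on (Rn (Suc d)) (\<lambda>x. stretch_factor d x * x d)"
    using continuous_on_product_then_coordinatewise[OF continuous_on_stretch(1)] .
  then show ?thesis
    unfolding cylinder_map_def
    by (intro continuous_on_Pair continuous_on_fun_upd continuous_on_stretch continuous_on_const)
qed

lemma homeomorphic_map_cylinder_map:
  "homeomorphic_map (top_of_set (open_disc (Suc d))) (top_of_set (open_disc d \<times> {-1<..<1})) (cylinder_map d)"
proof (rule homeomorphic_map_top_of_set)
  \<comment> \<open>The inverse puts the height back at index \<open>d\<close> and then undoes the
    stretching.\<close>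
  define glue where "glue p = (fst p)(d := snd p)" for p :: "(nat \<Rightarrow> real) \<times> real"
  define g where "g p = (\<lambda>i. inverse (stretch_factor d (glue p)) * glue p i)" for p
  let ?T = "open_disc d \<times> {-1<..<1::real}"
  have glue_Rn: "glue p \<in> Rn (Suc d)" if "fst p \<in> Rn d" for p
    using that by (auto simp: glue_def Rn_eq)
  have glue_norm: "cylinder_norm d (glue p) = max (euclid_norm d (fst p)) \<bar>snd p\<bar>" for p
    by (simp add: glue_def cylinder_norm_def euclid_norm_upd)
  show "continuous_on (open_disc (Suc d)) (cylinder_map d)"
    using continuous_on_cylinder_map open_disc_subset_Rn by (rule continuous_on_subset)
  have "continuous_on ?T glue"
    unfolding glue_def by (intro continuous_on_fun_upd continuous_intros)
  moreover have "glue ` ?T \<subseteq> Rn (Suc d)"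
    using open_disc_subset_Rn[of d] by (intro image_subsetI glue_Rn) (auto simp: mem_Times_iff)
  ultimately show "continuous_on ?T g"
    unfolding g_def using continuous_on_compose2[OF continuous_on_stretch(2)] by blast
  show "cylinder_map d ` open_disc (Suc d) \<subseteq> ?T"
  proof
    fix p assume "p \<in> cylinder_map d ` open_disc (Suc d)"
    then obtain x where x: "x \<in> open_disc (Suc d)" "cylinder_map d x = (fst p, snd p)" by auto
    show "p \<in> ?T"
      using x cylinder_map_norms[OF _ x(2)] by (auto simp: open_disc_eq mem_Times_iff)
  qed
  show "g ` ?T \<subseteq> open_disc (Suc d)"
  proof
    fix x assume "x \<in> g ` ?T"
    then obtain p where p: "p \<in> ?T" "x = g p" by auto
    then have "glue p \<in> Rn (Suc d)"
      using open_disc_subset_Rn[of d] by (intro glue_Rn) (auto simp: mem_Times_iff)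
    moreover from this have "x \<in> Rn (Suc d)" by (auto simp: p g_def Rn_eq)
    ultimately show "x \<in> open_disc (Suc d)"
      using euclid_norm_unstretch[of "glue p" d] glue_norm[of p] p
      by (auto simp: open_disc_eq g_def)
  qed
  show "g (cylinder_map d x) = x" if "x \<in> open_disc (Suc d)" for x
  \<comment> \<open>At the origin the factor and its inverse are both 0 and cannot be cancelled, but
    the origin is fixed anyway.\<close>
  proof (cases "x = (\<lambda>_. 0)")
    case True
    have "(\<lambda>_. 0)(d := 0) = (\<lambda>_. 0::real)" by auto
    then show ?thesis by (auto simp: True g_def glue_def cylinder_map_def)
  next
    case False
    have "glue (cylinder_map d x) = (\<lambda>i. stretch_factor d x * x i)"
      by (auto simp: glue_def cylinder_map_def)
    moreover have "0 < stretch_factor d x"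
      using False that open_disc_subset_Rn stretch_factor_pos by blast
    ultimately show ?thesis
      by (auto simp: g_def stretch_factor_scale)
  qed
  show "cylinder_map d (g p) = p" if p: "p \<in> ?T" for p
  proof -
    have pR: "fst p \<in> Rn d" using p open_disc_subset_Rn[of d] by (auto simp: mem_Times_iff)
    then have 0: "fst p d = 0" by (simp add: Rn_eq)
    have "(\<lambda>i. stretch_factor d (g p) * g p i) = glue p"
    proof (cases "glue p = (\<lambda>_. 0)")
      case True
      then show ?thesis by (simp add: g_def)
    next
      case False
      then have "0 < stretch_factor d (glue p)" using glue_Rn[OF pR] stretch_factor_pos by blast
      then show ?thesis by (auto simp: g_def stretch_factor_scale)
    qed
    then have "cylinder_map d (g p) = ((glue p)(d := 0), glue p d)"
      unfolding cylinder_map_def by (metis (no_types, lifting))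
    then show ?thesis using 0 by (auto simp: glue_def prod_eq_iff)
  qed
qed


section \<open>The product of a cell structure with the line\<close>

lemma homeomorphic_map_prod:
  assumes "homeomorphic_map X X' f" "homeomorphic_map Y Y' g"
  shows "homeomorphic_map (prod_topology X Y) (prod_topology X' Y') (\<lambda>(x, y). (f x, g y))"
proof -
  obtain f' g' where "homeomorphic_maps X X' f f'" "homeomorphic_maps Y Y' g g'"
    using assms by (auto simp: homeomorphic_map_maps)
  then have "homeomorphic_maps (prod_topology X Y) (prod_topology X' Y')
      (\<lambda>(x, y). (f x, g y)) (\<lambda>(x, y). (f' x, g' y))"
    by (simp add: homeomorphic_maps_prod)
  then show ?thesis unfolding homeomorphic_map_maps by blast
qed

lemma homeomorphic_map_pair_const:
  assumes "homeomorphic_map D X f"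
  shows "homeomorphic_map D (prod_topology X (top_of_set {a})) (\<lambda>x. (f x, a))"
proof -
  obtain g where g: "homeomorphic_maps D X f g"
    using assms by (auto simp: homeomorphic_map_maps)
  have "continuous_map D (prod_topology X (top_of_set {a})) (\<lambda>x. (f x, a))"
    using g by (intro continuous_map_pairedI) (auto simp: homeomorphic_maps_def)
  moreover have "continuous_map (prod_topology X (top_of_set {a})) D (g \<circ> fst)"
    using g by (intro continuous_map_compose[OF continuous_map_fst]) (auto simp: homeomorphic_maps_def)
  ultimately have "homeomorphic_maps D (prod_topology X (top_of_set {a})) (\<lambda>x. (f x, a)) (g \<circ> fst)"
    using g by (auto simp: homeomorphic_maps_def)
  then show ?thesis unfolding homeomorphic_map_maps by blast
qed

lemma homeomorphic_map_open_interval: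
  fixes a :: real
  shows "homeomorphic_map (top_of_set {-1<..<1::real}) (top_of_set {a<..<a + 1}) (\<lambda>h. a + (h + 1) / 2)"
  by (rule homeomorphic_map_top_of_set[where g = "\<lambda>y. 2 * (y - a) - 1"])
     (auto simp: add_divide_distrib diff_divide_distrib intro!: continuous_intros)

definition line_cell :: "int \<times> bool \<Rightarrow> real set" where
  "line_cell nb = (if snd nb then {of_int (fst nb)<..<of_int (fst nb) + 1} else {of_int (fst nb)})"

lemma line_cell_True: "line_cell (n, True) = {of_int n<..<of_int n + 1}"
  and line_cell_False: "line_cell (n, False) = {of_int n}"
  by (simp_all add: line_cell_def)

text \<open>Each real number determines the index of its cell, namely its floor and whether it fails
  to be an integer. Covering and disjointness of the cells of the line follow at once.\<close>

lemma line_cell_floor: "y \<in> line_cell (n, b) \<longleftrightarrow> n = \<lfloor>y\<rfloor> \<and> b = (y \<noteq> of_int \<lfloor>y\<rfloor>)"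
proof -
  have *: "n = \<lfloor>y\<rfloor> \<longleftrightarrow> of_int n \<le> y \<and> y < of_int n + 1"
    using floor_eq_iff[of y n] by auto
  show ?thesis
  proof (cases b)
    case True
    then have "y \<in> line_cell (n, b) \<longleftrightarrow> n = \<lfloor>y\<rfloor> \<and> y \<noteq> of_int n"
      unfolding * by (auto simp: line_cell_def)
    then show ?thesis using True by auto
  next
    case False
    then have "y \<in> line_cell (n, b) \<longleftrightarrow> n = \<lfloor>y\<rfloor> \<and> y = of_int n"
      unfolding * by (auto simp: line_cell_def)
    then show ?thesis using False by auto
  qed
qed

lemma finite_line_cells_near: "finite {nb. line_cell nb \<inter> {y - 1<..<y + 1} \<noteq> {}}"
proof (rule finite_subset)
  show "{nb. line_cell nb \<inter> {y - 1<..<y + 1} \<noteq> {}} \<subseteq> {\<lfloor>y\<rfloor> - 1..\<lfloor>y\<rfloor> + 1} \<times> UNIV"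
  proof
    fix nb assume "nb \<in> {nb. line_cell nb \<inter> {y - 1<..<y + 1} \<noteq> {}}"
    then obtain z where "z \<in> line_cell (fst nb, snd nb)" "y - 1 < z" "z < y + 1" by auto
    then have "fst nb = \<lfloor>z\<rfloor>" "\<lfloor>y\<rfloor> - 1 \<le> \<lfloor>z\<rfloor>" "\<lfloor>z\<rfloor> \<le> \<lfloor>y\<rfloor> + 1"
      unfolding line_cell_floor by linarith+
    then show "nb \<in> {\<lfloor>y\<rfloor> - 1..\<lfloor>y\<rfloor> + 1} \<times> UNIV" by (auto simp: mem_Times_iff)
  qed
qed simp

text \<open>A cell times a unit interval has dimension one more, and its characteristic map first
  deforms the disc into a cylinder. The height in [-1, 1] is moved to [n, n + 1] by n + (h + 1) / 2.
  Local finiteness passes to the product, so no separate discussion of the product topology is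
  needed.\<close>

lemma indexed_CW_times_line:
  assumes CW: "indexed_CW X I c \<delta> \<Phi>"
  defines "c' \<equiv> \<lambda>(i, nb). c i \<times> line_cell nb"
    and "\<delta>' \<equiv> \<lambda>(i, n, b). if b then Suc (\<delta> i) else \<delta> i"
    and "\<Phi>' \<equiv> \<lambda>(i, n, b) x. if b
        then (\<Phi> i (fst (cylinder_map (\<delta> i) x)), of_int n + (snd (cylinder_map (\<delta> i) x) + 1) / 2)
        else (\<Phi> i x, of_int n :: real)"
  shows "indexed_CW (prod_topology X euclideanreal) (I \<times> UNIV) c' \<delta>' \<Phi>'"
  unfolding indexed_CW_def
proof (intro conjI ballI impI)
  show "Hausdorff_space (prod_topology X euclideanreal)"
    using indexed_CW_Hausdorff[OF CW] by (simp add: Hausdorff_space_prod_topology)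
  show "(\<Union>k\<in>I \<times> UNIV. c' k) = topspace (prod_topology X euclideanreal)"
  proof -
    have "(\<Union>k\<in>I \<times> UNIV. c' k) = (\<Union>i\<in>I. c i) \<times> UNIV"
    proof (intro equalityI subsetI)
      fix z assume "z \<in> (\<Union>i\<in>I. c i) \<times> (UNIV :: real set)"
      then obtain x y i where z: "z = (x, y)" "i \<in> I" "x \<in> c i" by auto
      then have "z \<in> c' (i, \<lfloor>y\<rfloor>, y \<noteq> of_int \<lfloor>y\<rfloor>)"
        using line_cell_floor by (simp add: c'_def)
      then show "z \<in> (\<Union>k\<in>I \<times> UNIV. c' k)" using z by blast
    qed (auto simp: c'_def)
    then show ?thesis by (simp add: indexed_CW_Union[OF CW])
  qed
next
  fix k k' assume k: "k \<in> I \<times> (UNIV :: (int \<times> bool) set)" "k' \<in> I \<times> (UNIV :: (int \<times> bool) set)" "k \<noteq> k'"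
  obtain i n b i' n' b' where eq: "k = (i, n, b)" "k' = (i', n', b')" by (metis prod.exhaust)
  show "c' k \<inter> c' k' = {}"
  proof (cases "i = i'")
    case True
    then have "line_cell (n, b) \<inter> line_cell (n', b') = {}"
      using k eq line_cell_floor by auto
    then show ?thesis by (auto simp: c'_def eq)
  next
    case False
    then have "c i \<inter> c i' = {}" using indexed_CW_disjoint[OF CW] k eq by auto
    then show ?thesis by (auto simp: c'_def eq)
  qed
next
  fix k assume "k \<in> I \<times> (UNIV :: (int \<times> bool) set)"
  then obtain i n b where k: "k = (i, n, b)" and i: "i \<in> I" by auto
  let ?d = "\<delta> i"
  \<comment> \<open>By the equality of norms in \<open>cylinder_map_norms\<close>, the boundary of
    the disc goes to the side of the cylinder and its two ends.\<close>
  have cyl: "fst (cylinder_map ?d x) \<in> disc ?d" "\<bar>snd (cylinder_map ?d x)\<bar> \<le> 1"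
    "fst (cylinder_map ?d x) \<in> disc ?d - open_disc ?d \<or> \<bar>snd (cylinder_map ?d x)\<bar> = 1 \<or> x \<in> open_disc (Suc ?d)"
    if "x \<in> disc (Suc ?d)" for x
    using that cylinder_map_norms[of x ?d, OF _ prod.collapse[symmetric]]
    by (auto simp: disc_eq open_disc_eq max_def split: if_splits)
  have subtop: "subtopology (prod_topology X euclideanreal) (c i \<times> T)
      = prod_topology (subtopology X (c i)) (top_of_set T)" for T
    by (simp add: subtopology_Times)
  show "continuous_map (top_of_set (disc (\<delta>' k))) (prod_topology X euclideanreal) (\<Phi>' k)"
  proof (cases b)
    case True
    have *: "continuous_on (disc (Suc ?d)) (cylinder_map ?d)"
      using continuous_on_cylinder_map disc_subset_Rn by (rule continuous_on_subset)
    have "continuous_map (top_of_set (disc (Suc ?d))) (top_of_set (disc ?d)) (\<lambda>x. fst (cylinder_map ?d x))"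
      using * cyl(1) by (auto simp: continuous_map_in_subtopology intro: continuous_on_fst)
    from continuous_map_compose[OF this indexed_CW_continuous[OF CW i]]
    have "continuous_map (top_of_set (disc (Suc ?d))) X (\<lambda>x. \<Phi> i (fst (cylinder_map ?d x)))"
      by (simp add: o_def)
    moreover have "continuous_on (disc (Suc ?d)) (\<lambda>x. of_int n + (snd (cylinder_map ?d x) + 1) / 2)"
      using * by (intro continuous_intros) auto
    ultimately show ?thesis
      using True by (simp add: k \<Phi>'_def \<delta>'_def continuous_map_pairedI)
  next
    case False
    then show ?thesis
      using indexed_CW_continuous[OF CW i] by (simp add: k \<Phi>'_def \<delta>'_def continuous_map_pairedI)
  qed
  show "homeomorphic_map (top_of_set (open_disc (\<delta>' k))) (subtopology (prod_topology X euclideanreal) (c' k)) (\<Phi>' k)"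
  proof (cases b)
    case True
    have "homeomorphic_map (top_of_set (open_disc ?d \<times> {-1<..<1}))
        (prod_topology (subtopology X (c i)) (top_of_set {of_int n<..<of_int n + 1 :: real}))
        (\<lambda>(x, h). (\<Phi> i x, of_int n + (h + 1) / 2))"
      using homeomorphic_map_prod[OF indexed_CW_homeomorphic[OF CW i] homeomorphic_map_open_interval]
      by simp
    from homeomorphic_map_compose[OF homeomorphic_map_cylinder_map this]
    show ?thesis
      using True by (simp add: k \<Phi>'_def \<delta>'_def c'_def subtop line_cell_True o_def case_prod_unfold)
  next
    case False
    then show ?thesis
      using homeomorphic_map_pair_const[OF indexed_CW_homeomorphic[OF CW i]]
      by (simp add: k \<Phi>'_def \<delta>'_def c'_def subtop line_cell_False)
  qed
  obtain F where F: "finite F" "F \<subseteq> {j\<in>I. \<delta> j < \<delta> i}"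
    "\<Phi> i ` (disc ?d - open_disc ?d) \<subseteq> (\<Union>j\<in>F. c j)"
    using indexed_CW_boundary[OF CW i] by auto
  show "\<exists>F. finite F \<and> F \<subseteq> {j\<in>I \<times> UNIV. \<delta>' j < \<delta>' k} \<and>
      \<Phi>' k ` (disc (\<delta>' k) - open_disc (\<delta>' k)) \<subseteq> (\<Union>j\<in>F. c' j)"
  proof (cases b)
    case False
    show ?thesis
    proof (intro exI[of _ "F \<times> {(n, False)}"] conjI)
      show "finite (F \<times> {(n, False)})" using F by simp
      show "F \<times> {(n, False)} \<subseteq> {j\<in>I \<times> UNIV. \<delta>' j < \<delta>' k}"
        using F False by (auto simp: \<delta>'_def k)
      show "\<Phi>' k ` (disc (\<delta>' k) - open_disc (\<delta>' k)) \<subseteq> (\<Union>j\<in>F \<times> {(n, False)}. c' j)"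
      proof
        fix z assume "z \<in> \<Phi>' k ` (disc (\<delta>' k) - open_disc (\<delta>' k))"
        then obtain x where x: "x \<in> disc ?d - open_disc ?d" "z = (\<Phi> i x, of_int n)"
          using False by (auto simp: k \<Phi>'_def \<delta>'_def)
        then obtain j where "j \<in> F" "\<Phi> i x \<in> c j" using F(3) by blast
        then show "z \<in> (\<Union>j\<in>F \<times> {(n, False)}. c' j)"
          by (intro UN_I[of "(j, n, False)"]) (auto simp: x c'_def line_cell_False)
      qed
    qed
  next
    case True
    \<comment> \<open>The ends lie over \<open>c i\<close> and its boundary cells at the integer
      heights n and n + 1, the side lies over the boundary cells times the open interval. All these
      cells have dimension below that of the cell \<open>k\<close>.\<close>
    let ?G = "insert i F \<times> {(n, False), (n + 1, False)} \<union> F \<times> {(n, True)}"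
    show ?thesis
    proof (intro exI[of _ ?G] conjI)
      show "finite ?G" using F by simp
      show "?G \<subseteq> {j\<in>I \<times> UNIV. \<delta>' j < \<delta>' k}"
        using F i True by (auto simp: \<delta>'_def k)
      show "\<Phi>' k ` (disc (\<delta>' k) - open_disc (\<delta>' k)) \<subseteq> (\<Union>j\<in>?G. c' j)"
      proof
        fix z assume "z \<in> \<Phi>' k ` (disc (\<delta>' k) - open_disc (\<delta>' k))"
        then obtain x where x: "x \<in> disc (Suc ?d) - open_disc (Suc ?d)" "z = \<Phi>' k x"
          using True by (auto simp: k \<delta>'_def)
        define v h where "v = fst (cylinder_map ?d x)" and "h = snd (cylinder_map ?d x)"
        have z: "z = (\<Phi> i v, of_int n + (h + 1) / 2)"
          using True by (simp add: x k \<Phi>'_def v_def h_def)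
        have v: "v \<in> disc ?d" "\<bar>h\<bar> \<le> 1" and vh: "v \<in> disc ?d - open_disc ?d \<or> \<bar>h\<bar> = 1"
          using cyl[of x] x unfolding v_def h_def by auto
        \<comment> \<open>On the ends, \<open>v\<close> may be interior to the disc, and then
          \<open>i\<close> itself is the index; on the side it is a boundary point, and
          \<open>j\<close> has to come from \<open>F\<close>.\<close>
        obtain j where j: "j \<in> insert i F" "\<Phi> i v \<in> c j" and j': "v \<notin> open_disc ?d \<Longrightarrow> j \<in> F"
        proof (cases "v \<in> open_disc ?d")
          case True
          then show ?thesis using that[of i] indexed_CW_cell_eq[OF CW i] by auto
        next
          case False
          then obtain j where "j \<in> F" "\<Phi> i v \<in> c j" using F(3) v(1) by blast
          then show ?thesis using that by blast
        qed
        consider "h = 1" | "h = -1" | "\<bar>h\<bar> < 1" using v(2) by linarith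
        then show "z \<in> (\<Union>j\<in>?G. c' j)"
        proof cases
          case 1
          then show ?thesis
            using j by (intro UN_I[of "(j, n + 1, False)"]) (auto simp: z c'_def line_cell_False)
        next
          case 2
          then show ?thesis
            using j by (intro UN_I[of "(j, n, False)"]) (auto simp: z c'_def line_cell_False)
        next
          case 3
          then show ?thesis
            using j j' vh by (intro UN_I[of "(j, n, True)"]) (auto simp: z c'_def line_cell_True)
        qed
      qed
    qed
  qed
next
  fix z assume "z \<in> topspace (prod_topology X euclideanreal)"
  then obtain x y where z: "z = (x, y)" "x \<in> topspace X" by auto
  obtain V where V: "openin X V" "x \<in> V" "finite {i\<in>I. c i \<inter> V \<noteq> {}}"
    using indexed_CW_locally_finite[OF CW z(2)] by auto
  have "{k\<in>I \<times> UNIV. c' k \<inter> V \<times> {y - 1<..<y + 1} \<noteq> {}}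
      \<subseteq> {i\<in>I. c i \<inter> V \<noteq> {}} \<times> {nb. line_cell nb \<inter> {y - 1<..<y + 1} \<noteq> {}}"
    by (auto simp: c'_def)
  then have "finite {k\<in>I \<times> UNIV. c' k \<inter> V \<times> {y - 1<..<y + 1} \<noteq> {}}"
    by (rule finite_subset) (intro finite_cartesian_product V finite_line_cells_near)
  moreover have "openin (prod_topology X euclideanreal) (V \<times> {y - 1<..<y + 1})"
    using V by (simp add: openin_prod_Times_iff)
  moreover have "z \<in> V \<times> {y - 1<..<y + 1}" using V z by simp
  ultimately show "\<exists>V. openin (prod_topology X euclideanreal) V \<and> z \<in> V \<and>
      finite {k\<in>I \<times> UNIV. c' k \<inter> V \<noteq> {}}"
    by blast
qed


section \<open>Fibres\<close>

lemma connectedin_Rn: "S \<subseteq> Rn k \<Longrightarrow> connectedin (Euclidean_space k) S \<longleftrightarrow> connected S"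
  by (subst Euclidean_space_eq_top_of_set) (simp add: connectedin_subtopology)

lemma compactin_Rn: "S \<subseteq> Rn k \<Longrightarrow> compactin (Euclidean_space k) S \<longleftrightarrow> compact S"
  by (subst Euclidean_space_eq_top_of_set) (simp add: compactin_subtopology)

text \<open>Tychonoff: sequences carry the product topology, so a box with compact factors is
  compact even with infinitely many coordinates.\<close>

lemma compact_coordinatewise_bounded:
  fixes S :: "(nat \<Rightarrow> real) set"
  assumes "closed S" "\<And>x i. x \<in> S \<Longrightarrow> \<bar>x i\<bar> \<le> b i"
  shows "compact S"
proof -
  have "compactin (product_topology (\<lambda>i. euclideanreal) UNIV) (PiE UNIV (\<lambda>i. {-b i..b i}))"
    by (simp add: compactin_PiE)
  then have "compact (PiE UNIV (\<lambda>i. {-b i..b i}))"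
    by (simp add: euclidean_product_topology)
  moreover have "S \<subseteq> PiE UNIV (\<lambda>i. {-b i..b i})"
  proof
    fix x assume "x \<in> S"
    then have "-b i \<le> x i" "x i \<le> b i" for i using assms(2)[of x i] by linarith+
    then show "x \<in> PiE UNIV (\<lambda>i. {-b i..b i})" by auto
  qed
  ultimately show ?thesis
    using assms(1) by (metis compact_Int_closed inf.absorb2)
qed

lemma continuous_on_If_const:
  "(b \<Longrightarrow> continuous_on S f) \<Longrightarrow> (\<not> b \<Longrightarrow> continuous_on S g) \<Longrightarrow>
     continuous_on S (\<lambda>x. if b then f x else g x)"
  by (cases b) auto

text \<open>The shape of every fibre. Index 0 carries the variable that can become unbounded,
  indices 1 to p the y-variables; \<open>s\<close> is the value of the function and \<open>w\<close>
  the value of the cube root coordinate, not the variable called w in the overview.\<close>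

definition quadric :: "nat \<Rightarrow> real \<Rightarrow> real \<Rightarrow> real \<Rightarrow> real \<Rightarrow> (nat \<Rightarrow> real) set" where
  "quadric p A B s w = {z \<in> Rn (p + 3). A * (z 0)\<^sup>2 + (\<Sum>j<p. (z (Suc j))\<^sup>2) = B \<and>
     z (p + 1) = s \<and> z (p + 2) = w}"

lemma quadric_subset_Rn: "quadric p A B s w \<subseteq> Rn (p + 3)"
  by (auto simp: quadric_def)

text \<open>The quadric chart for the first p + 1 coordinates, the two remaining ones being
  constant. The sign of \<open>A\<close> does not matter, since the value \<open>B\<close> is
  non-zero.\<close>

lemma smooth_submanifold_quadric:
  assumes "B \<noteq> 0"
  shows "smooth_submanifold (p + 3) p (quadric p A B s w)"
proof -
  define c where "c j = (if j = 0 then A else 1)" for j :: nat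
  define e where "e j = (if j = p + 1 then s else w)" for j
  have ex: "(\<forall>j. p < j \<and> j < p + 3 \<longrightarrow> z j = e j) \<longleftrightarrow> z (p + 1) = s \<and> z (p + 2) = w" for z :: "nat \<Rightarrow> real"
  proof -
    have "p < j \<and> j < p + 3 \<longleftrightarrow> j = p + 1 \<or> j = p + 2" for j by auto
    then show ?thesis by (auto simp: e_def)
  qed
  have "(\<Sum>j<Suc p. c j * (z j - 0)\<^sup>2) = A * (z 0)\<^sup>2 + (\<Sum>j<p. (z (Suc j))\<^sup>2)" for z :: "nat \<Rightarrow> real"
    by (simp add: sum.lessThan_Suc_shift c_def del: sum.lessThan_Suc)
  then have eq: "quadric p A B s w = {z \<in> Rn (p + 3). (\<Sum>j<Suc p. c j * (z j - 0)\<^sup>2) = B \<and>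
      (\<forall>j. p < j \<and> j < p + 3 \<longrightarrow> z j = e j)}"
    unfolding quadric_def ex by simp
  have "slice_chart (p + 3) p 0 (quadric p A B s w) z" if "z \<in> quadric p A B s w" for z
    unfolding eq by (rule slice_chart_quadric[where cen = "\<lambda>_. 0"]) (use assms that in \<open>auto simp: eq\<close>)
  then show ?thesis
    using quadric_subset_Rn by (simp add: smooth_submanifold_def)
qed

text \<open>An ellipsoid: rescaling the axes turns it into the unit sphere.\<close>

lemma homeomorphic_map_sphere_quadric:
  assumes "0 < A" "0 < B"
  shows "\<exists>f. homeomorphic_map (top_of_set (unit_sphere p)) (top_of_set (quadric p A B s w)) f"
proof -
  define f where "f y i = (if i = 0 then sqrt B / sqrt A * y 0 else if i < Suc p then sqrt B * y i
    else if i = p + 1 then s else if i = p + 2 then w else 0)" for y :: "nat \<Rightarrow> real" and i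
  define g where "g z i = (if i = 0 then sqrt A / sqrt B * z 0 else if i < Suc p then z i / sqrt B
    else 0)" for z :: "nat \<Rightarrow> real" and i
  have sphere: "(\<Sum>i<Suc p. (y i)\<^sup>2) = (y 0)\<^sup>2 + (\<Sum>j<p. (y (Suc j))\<^sup>2)" for y :: "nat \<Rightarrow> real"
    by (simp add: sum.lessThan_Suc_shift del: sum.lessThan_Suc)
  have "homeomorphic_map (top_of_set (unit_sphere p)) (top_of_set (quadric p A B s w)) f"
  proof (rule homeomorphic_map_top_of_set[where g = g])
    show "continuous_on (unit_sphere p) f"
      unfolding f_def by (intro continuous_on_coordinatewise_then_product continuous_on_If_const continuous_intros;
          simp)
    show "continuous_on (quadric p A B s w) g"
      unfolding g_def using assms
      by (intro continuous_on_coordinatewise_then_product continuous_on_If_const continuous_intros;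
          simp)
    show "f ` unit_sphere p \<subseteq> quadric p A B s w"
    proof clarify
      fix y assume "y \<in> unit_sphere p"
      then have y: "(y 0)\<^sup>2 + (\<Sum>j<p. (y (Suc j))\<^sup>2) = 1" by (simp add: unit_sphere_def flip: sphere)
      have "A * (f y 0)\<^sup>2 + (\<Sum>j<p. (f y (Suc j))\<^sup>2) = B * ((y 0)\<^sup>2 + (\<Sum>j<p. (y (Suc j))\<^sup>2))"
        using assms by (simp add: f_def power_mult_distrib power_divide sum_distrib_left[symmetric] algebra_simps)
      then show "f y \<in> quadric p A B s w"
        by (simp add: y quadric_def Rn_eq) (simp add: f_def)
    qed
    show "g ` quadric p A B s w \<subseteq> unit_sphere p"
    proof clarify
      fix z assume z: "z \<in> quadric p A B s w"
      have "(g z 0)\<^sup>2 + (\<Sum>j<p. (g z (Suc j))\<^sup>2) = (A * (z 0)\<^sup>2 + (\<Sum>j<p. (z (Suc j))\<^sup>2)) / B"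
        using assms by (simp add: g_def power_mult_distrib power_divide sum_divide_distrib[symmetric] add_divide_distrib)
      also have "\<dots> = 1" using z assms by (simp add: quadric_def)
      finally show "g z \<in> unit_sphere p"
        unfolding unit_sphere_def mem_Collect_eq sphere by (simp add: Rn_eq) (simp add: g_def)
    qed
    show "g (f y) = y" if "y \<in> unit_sphere p" for y
      using that assms by (auto simp: g_def f_def fun_eq_iff unit_sphere_def Rn_eq)
    show "f (g z) = z" if "z \<in> quadric p A B s w" for z
    proof
      fix i
      have z: "z (p + 1) = s" "z (p + 2) = w" "\<And>i. p + 3 \<le> i \<Longrightarrow> z i = 0"
        using that by (auto simp: quadric_def Rn_eq)
      consider "i < Suc p" | "i = p + 1" | "i = p + 2" | "p + 3 \<le> i" by linarith
      then show "f (g z) i = z i"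
        using z assms by cases (auto simp: f_def g_def)
    qed
  qed
  then show ?thesis by blast
qed

text \<open>For non-positive \<open>A\<close> the quantity B - A a^2 is positive for every a, so
  each slice at height a is a round sphere of radius \<open>R a\<close>; dividing by the radius
  straightens the quadric to a cylinder. With \<open>Suc q\<close> y-variables the slices have
  dimension \<open>q\<close>.\<close>

lemma homeomorphic_map_cylinder_quadric:
  assumes "A \<le> 0" "0 < B"
  shows "\<exists>f. homeomorphic_map (top_of_set (unit_sphere q \<times> (UNIV :: real set)))
    (top_of_set (quadric (Suc q) A B s w)) f"
proof -
  let ?p = "Suc q"
  define R where "R a = sqrt (B - A * a\<^sup>2)" for a :: real
  have pos: "0 < B - A * a\<^sup>2" for a :: real
    using assms mult_nonpos_nonneg[of A "a\<^sup>2"] by simp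
  have R: "0 < R a" "R a \<noteq> 0" "(R a)\<^sup>2 = B - A * a\<^sup>2" for a
    using pos[of a] less_imp_le[OF pos[of a]] by (auto simp: R_def)
  define f where "f ya i = (if i = 0 then snd ya else if i < Suc ?p then R (snd ya) * fst ya (i - 1)
    else if i = ?p + 1 then s else if i = ?p + 2 then w else 0)" for ya :: "(nat \<Rightarrow> real) \<times> real" and i
  define g where "g z = ((\<lambda>i. if i < ?p then z (Suc i) / R (z 0) else 0), z 0)" for z :: "nat \<Rightarrow> real"
  have contR: "continuous_on S (\<lambda>x. R (h x))" if "continuous_on S h" for S and h :: "'x :: topological_space \<Rightarrow> real"
    unfolding R_def using that by (intro continuous_intros)
  have "homeomorphic_map (top_of_set (unit_sphere q \<times> (UNIV :: real set))) (top_of_set (quadric ?p A B s w)) f"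
  proof (rule homeomorphic_map_top_of_set[where g = g])
    have cfst: "continuous_on S (\<lambda>ya :: (nat \<Rightarrow> real) \<times> real. fst ya i)" for S i
      by (rule continuous_on_product_then_coordinatewise[OF continuous_on_fst[OF continuous_on_id]])
    show "continuous_on (unit_sphere q \<times> (UNIV :: real set)) f"
      unfolding f_def
      by (intro continuous_on_coordinatewise_then_product continuous_on_If_const cfst contR
          continuous_on_mult continuous_on_snd continuous_on_id continuous_on_const)
    have "continuous_on (quadric ?p A B s w) (\<lambda>z i. if i < ?p then z (Suc i) / R (z 0) else 0)"
      by (intro continuous_on_coordinatewise_then_product continuous_on_If_const continuous_intros contR;
          simp add: R)
    then show "continuous_on (quadric ?p A B s w) g"
      unfolding g_def by (intro continuous_on_Pair continuous_on_coordinate)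
    show "f ` (unit_sphere q \<times> (UNIV :: real set)) \<subseteq> quadric ?p A B s w"
    proof clarify
      fix y a assume "y \<in> unit_sphere q"
      then have y: "(\<Sum>j<?p. (y j)\<^sup>2) = 1" by (simp add: unit_sphere_def)
      have "(\<Sum>j<?p. (f (y, a) (Suc j))\<^sup>2) = (R a)\<^sup>2 * (\<Sum>j<?p. (y j)\<^sup>2)"
        unfolding sum_distrib_left by (intro sum.cong) (auto simp: f_def power_mult_distrib)
      then have "A * (f (y, a) 0)\<^sup>2 + (\<Sum>j<?p. (f (y, a) (Suc j))\<^sup>2) = B"
        unfolding y R by (simp add: f_def)
      then show "f (y, a) \<in> quadric ?p A B s w"
        unfolding quadric_def Rn_eq by (simp del: sum.lessThan_Suc) (simp add: f_def)
    qed
    show "g ` quadric ?p A B s w \<subseteq> unit_sphere q \<times> (UNIV :: real set)"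
    proof (intro image_subsetI)
      fix z assume z: "z \<in> quadric ?p A B s w"
      define y where "y = fst (g z)"
      have "(\<Sum>j<?p. (y j)\<^sup>2) = (\<Sum>j<?p. (z (Suc j))\<^sup>2) / (R (z 0))\<^sup>2"
        unfolding sum_divide_distrib by (intro sum.cong) (auto simp: y_def g_def power_divide)
      also have "(\<Sum>j<?p. (z (Suc j))\<^sup>2) = (R (z 0))\<^sup>2"
        using z unfolding R by (simp add: quadric_def)
      finally have "(\<Sum>j<?p. (y j)\<^sup>2) = 1" using R(2)[of "z 0"] by simp
      moreover have "y \<in> Rn ?p" by (auto simp: y_def g_def Rn_eq)
      ultimately show "g z \<in> unit_sphere q \<times> (UNIV :: real set)"
        by (simp add: unit_sphere_def mem_Times_iff y_def)
    qed
    show "g (f ya) = ya" if "ya \<in> unit_sphere q \<times> (UNIV :: real set)" for ya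
    proof -
      obtain y a where ya: "ya = (y, a)" by fastforce
      have "y i = 0" if "?p \<le> i" for i
        using \<open>ya \<in> _\<close> that by (auto simp: ya unit_sphere_def Rn_eq)
      then show ?thesis
        using R(2)[of a] by (auto simp: g_def f_def fun_eq_iff ya)
    qed
    show "f (g z) = z" if "z \<in> quadric ?p A B s w" for z
    proof
      fix i
      have z: "z (?p + 1) = s" "z (?p + 2) = w" "\<And>i. ?p + 3 \<le> i \<Longrightarrow> z i = 0"
        using that by (auto simp: quadric_def Rn_eq)
      consider "i = 0" | "0 < i" "i < Suc ?p" | "i = ?p + 1" | "i = ?p + 2" | "?p + 3 \<le> i" by linarith
      then show "f (g z) i = z i"
        using z R(2)[of "z 0"] by cases (auto simp: f_def g_def)
    qed
  qed
  then show ?thesis by blast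
qed

lemma quadric_coordinate_cases:
  fixes i p :: nat
  obtains "i = 0" | j where "i = Suc j" "j < p" | "i = p + 1" | "i = p + 2" | "p + 3 \<le> i"
proof (cases i)
  case (Suc j)
  then show ?thesis
    using that(2)[of j] that(3-5) by (cases "j < p") (simp_all, linarith)
qed (use that in simp)

lemma quadric_degenerate:
  assumes "z \<in> quadric p A 0 s w" "0 \<le> A"
  shows "A * (z 0)\<^sup>2 = 0" "\<And>j. j < p \<Longrightarrow> z (Suc j) = 0"
proof -
  have eq: "A * (z 0)\<^sup>2 + (\<Sum>j<p. (z (Suc j))\<^sup>2) = 0" using assms by (simp add: quadric_def)
  have "0 \<le> A * (z 0)\<^sup>2" "0 \<le> (\<Sum>j<p. (z (Suc j))\<^sup>2)" using assms by (auto simp: sum_nonneg)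
  then have *: "A * (z 0)\<^sup>2 = 0" "(\<Sum>j<p. (z (Suc j))\<^sup>2) = 0" using eq by linarith+
  then show "A * (z 0)\<^sup>2 = 0" by simp
  show "z (Suc j) = 0" if "j < p" for j
    using *(2) that by (subst (asm) sum_nonneg_eq_0_iff) auto
qed

lemma quadric_point:
  assumes "0 < A"
  shows "quadric p A 0 s w = {\<lambda>i. if i = p + 1 then s else if i = p + 2 then w else 0}"
proof (intro equalityI subsetI)
  fix z assume z: "z \<in> quadric p A 0 s w"
  have "z i = (if i = p + 1 then s else if i = p + 2 then w else 0)" for i
  proof -
    have z': "z (p + 1) = s" "z (p + 2) = w" "p + 3 \<le> i \<Longrightarrow> z i = 0"
      using z by (auto simp: quadric_def Rn_eq)
    have "z 0 = 0" using quadric_degenerate(1)[OF z] assms by simp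
    moreover have "z (Suc j) = 0" if "j < p" for j
      using quadric_degenerate(2)[OF z _ that] assms by simp
    ultimately show ?thesis
      using z' by (cases rule: quadric_coordinate_cases[where i = i and p = p]) (simp_all only:, simp_all)
  qed
  then show "z \<in> {\<lambda>i. if i = p + 1 then s else if i = p + 2 then w else 0}" by auto
qed (auto simp: quadric_def Rn_eq)

text \<open>The fibre over an end point at which \<open>A\<close> vanishes. The factor {0} presents
  the line as a point times a line, so that the product construction gives its cells.\<close>

lemma homeomorphic_map_line_quadric:
  "\<exists>f. homeomorphic_map (top_of_set ({0 :: real} \<times> (UNIV :: real set))) (top_of_set (quadric p 0 0 s w)) f"
proof -
  define f where "f ua i = (if i = 0 then snd ua else if i = p + 1 then s else if i = p + 2 then w else 0)"
    for ua :: "real \<times> real" and i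
  have "homeomorphic_map (top_of_set ({0 :: real} \<times> (UNIV :: real set))) (top_of_set (quadric p 0 0 s w)) f"
  proof (rule homeomorphic_map_top_of_set[where g = "\<lambda>z. (0, z 0)"])
    show "continuous_on ({0 :: real} \<times> (UNIV :: real set)) f"
      unfolding f_def by (intro continuous_on_coordinatewise_then_product continuous_on_If_const continuous_intros;
          simp)
    show "f (0, z 0) = z" if z: "z \<in> quadric p 0 0 s w" for z
    proof
      fix i
      have z': "z (p + 1) = s" "z (p + 2) = w" "p + 3 \<le> i \<Longrightarrow> z i = 0"
        using z by (auto simp: quadric_def Rn_eq)
      have "z (Suc j) = 0" if "j < p" for j
        using quadric_degenerate(2)[OF z _ that] by simp
      then show "f (0, z 0) i = z i"
        using z' by (cases rule: quadric_coordinate_cases[where i = i and p = p]) (simp_all only: f_def, simp_all)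
    qed
  qed (auto simp: f_def quadric_def Rn_eq intro!: continuous_intros)
  then show ?thesis by blast
qed

lemma connected_homeomorphic_image:
  assumes "homeomorphic_map (top_of_set S) (top_of_set T) f" "connected S"
  shows "connected T"
proof -
  have "continuous_on S f" "f ` S = T"
    using homeomorphic_imp_continuous_map[OF assms(1)] homeomorphic_imp_surjective_map[OF assms(1)]
    by (auto simp: continuous_map_in_subtopology)
  then show ?thesis using connected_continuous_image[OF _ assms(2)] by blast
qed

lemma CW_times_line:
  assumes "indexed_CW (top_of_set S) I c \<delta> \<Phi>" "\<And>i. i \<in> I \<Longrightarrow> \<delta> i < d"
    and "homeomorphic_map (top_of_set (S \<times> (UNIV :: real set))) Y f"
  shows "CW_complex_dim_le d Y"
proof -
  have "prod_topology (top_of_set S) euclideanreal = top_of_set (S \<times> (UNIV :: real set))"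
    using prod_topology_subtopology_eu[of S "UNIV :: real set"] by simp
  then have "homeomorphic_map (prod_topology (top_of_set S) euclideanreal) Y f"
    using assms(3) by simp
  from indexed_CW_homeomorphic_map[OF indexed_CW_times_line[OF assms(1)] this]
  show ?thesis
    by (rule indexed_CW_imp_CW_complex) (use assms(2) in \<open>auto simp: less_imp_le Suc_le_eq\<close>)
qed

text \<open>Four shapes occur: ellipsoid, cylinder, line and point. The last hypothesis excludes the
  cone B = 0, A < 0. With p at least 2 the cross sections of the cylinder are spheres of positive
  dimension, hence connected.\<close>

lemma quadric_connected_CW:
  assumes "2 \<le> p" "0 \<le> B" "B = 0 \<Longrightarrow> 0 \<le> A"
  shows "connected (quadric p A B s w)" "CW_complex_dim_le p (top_of_set (quadric p A B s w))"
proof -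
  obtain q where q: "p = Suc q" "1 \<le> q" using assms(1) by (cases p) auto
  consider "0 < B" "0 < A" | "0 < B" "A \<le> 0" | "B = 0" "A = 0" | "B = 0" "0 < A"
    using assms by fastforce
  then have "connected (quadric p A B s w) \<and> CW_complex_dim_le p (top_of_set (quadric p A B s w))"
  proof cases
    case 1
    then obtain f where f: "homeomorphic_map (top_of_set (unit_sphere p)) (top_of_set (quadric p A B s w)) f"
      using homeomorphic_map_sphere_quadric by blast
    have "1 \<le> p" using assms by simp
    then show ?thesis
      using connected_homeomorphic_image[OF f connected_unit_sphere]
        indexed_CW_imp_CW_complex[OF indexed_CW_homeomorphic_map[OF indexed_CW_sphere f], of p]
      by auto
  next
    case 2
    then obtain f where f: "homeomorphic_map (top_of_set (unit_sphere q \<times> (UNIV :: real set))) (top_of_set (quadric p A B s w)) f"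
      unfolding q using homeomorphic_map_cylinder_quadric by blast
    have "connected (unit_sphere q \<times> (UNIV :: real set))"
      using connected_unit_sphere[OF q(2)] by (intro connected_Times) auto
    moreover have "CW_complex_dim_le p (top_of_set (quadric p A B s w))"
      by (rule CW_times_line[OF indexed_CW_sphere[OF q(2)] _ f]) (use q in auto)
    ultimately show ?thesis using connected_homeomorphic_image[OF f] by blast
  next
    case 3
    then obtain f where f: "homeomorphic_map (top_of_set ({0 :: real} \<times> (UNIV :: real set))) (top_of_set (quadric p A B s w)) f"
      using homeomorphic_map_line_quadric by blast
    have "connected ({0 :: real} \<times> (UNIV :: real set))" by (intro connected_Times) auto
    moreover have "CW_complex_dim_le p (top_of_set (quadric p A B s w))"
      by (rule CW_times_line[OF indexed_CW_point[of _ "0 :: real"] _ f]) (use assms in auto)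
    ultimately show ?thesis using connected_homeomorphic_image[OF f] by blast
  next
    case 4
    then obtain a where a: "quadric p A B s w = {a}" using quadric_point by blast
    have "CW_complex_dim_le p (top_of_set {a})"
      by (rule indexed_CW_imp_CW_complex[OF indexed_CW_point]) auto
    then show ?thesis by (simp add: a)
  qed
  then show "connected (quadric p A B s w)" "CW_complex_dim_le p (top_of_set (quadric p A B s w))"
    by auto
qed

lemma compact_quadric:
  assumes "0 < A" "0 < B"
  shows "compact (quadric p A B s w)"
proof (rule compact_coordinatewise_bounded)
  have "quadric p A B s w = {z. A * (z 0)\<^sup>2 + (\<Sum>j<p. (z (Suc j))\<^sup>2) = B \<and> z (p + 1) = s \<and> z (p + 2) = w}
      \<inter> (\<Inter>i\<in>{p + 3..}. {z. z i = 0})"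
    by (auto simp: quadric_def Rn_eq)
  also have "closed \<dots>"
    by (intro closed_Int closed_INT ballI closed_Collect_conj closed_Collect_eq continuous_intros)
  finally show "closed (quadric p A B s w)" .
  \<comment> \<open>A single bound for all coordinates, the sum of the separate ones. The estimate
    |x| <= x^2 + 1 avoids square roots.\<close>
  define b where "b = B / A + B + 1 + \<bar>s\<bar> + \<bar>w\<bar>"
  fix z i assume z: "z \<in> quadric p A B s w"
  have sq: "\<bar>x\<bar> \<le> x\<^sup>2 + 1" for x :: real
  proof -
    have "0 \<le> (\<bar>x\<bar> - 1/2)\<^sup>2" by simp
    then show ?thesis by (simp add: power2_eq_square algebra_simps)
  qed
  have eq: "A * (z 0)\<^sup>2 + (\<Sum>j<p. (z (Suc j))\<^sup>2) = B" using z by (simp add: quadric_def)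
  have "0 \<le> (\<Sum>j<p. (z (Suc j))\<^sup>2)" by (simp add: sum_nonneg)
  then have "A * (z 0)\<^sup>2 \<le> B" using eq by linarith
  then have z0: "(z 0)\<^sup>2 \<le> B / A" using assms by (simp add: field_simps)
  have zj: "(z (Suc j))\<^sup>2 \<le> B" if "j < p" for j
  proof -
    have "(z (Suc j))\<^sup>2 \<le> (\<Sum>j<p. (z (Suc j))\<^sup>2)" using that by (intro member_le_sum) auto
    moreover have "0 \<le> A * (z 0)\<^sup>2" using assms by simp
    ultimately show ?thesis using eq by linarith
  qed
  have ba: "0 \<le> B / A" using assms by simp
  have zz: "z (p + 1) = s" "z (p + 2) = w" "\<And>i. p + 3 \<le> i \<Longrightarrow> z i = 0"
    using z by (auto simp: quadric_def Rn_eq)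
  show "\<bar>z i\<bar> \<le> b"
  proof (cases rule: quadric_coordinate_cases[where i = i and p = p])
    case 1
    then show ?thesis using z0 sq[of "z 0"] assms unfolding b_def by simp
  next
    case (2 j)
    then show ?thesis using zj[of j] sq[of "z (Suc j)"] ba unfolding b_def by simp
  qed (use zz ba assms in \<open>auto simp: b_def\<close>)
qed

text \<open>Coordinate 0 takes every real value a: as B - A a^2 is not negative, its square root can
  be placed in the first y-variable. A compact set would have a bounded projection.\<close>

lemma not_compact_quadric:
  assumes "A \<le> 0" "0 < B" "0 < p"
  shows "\<not> compact (quadric p A B s w)"
proof
  assume "compact (quadric p A B s w)"
  then have "compact ((\<lambda>z. z 0) ` quadric p A B s w)"
    by (intro compact_continuous_image continuous_intros)
  moreover have "(\<lambda>z. z 0) ` quadric p A B s w = UNIV"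
  proof (intro equalityI subsetI)
    fix a :: real
    have "A * a\<^sup>2 \<le> 0" using assms by (simp add: mult_nonpos_nonneg)
    then have pos: "0 \<le> B - A * a\<^sup>2" using assms by linarith
    define z where "z i = (if i = 0 then a else if i = Suc 0 then sqrt (B - A * a\<^sup>2)
      else if i = p + 1 then s else if i = p + 2 then w else 0)" for i
    obtain q where q: "p = Suc q" using assms by (cases p) auto
    have "(\<Sum>j<p. (z (Suc j))\<^sup>2) = (z (Suc 0))\<^sup>2 + (\<Sum>j<q. (z (Suc (Suc j)))\<^sup>2)"
      unfolding q by (rule sum.lessThan_Suc_shift)
    also have "(\<Sum>j<q. (z (Suc (Suc j)))\<^sup>2) = 0"
      by (rule sum.neutral) (auto simp: z_def q)
    finally have "z \<in> quadric p A B s w"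
      using pos assms by (auto simp: quadric_def Rn_eq z_def)
    then show "a \<in> (\<lambda>z. z 0) ` quadric p A B s w"
      by (intro image_eqI[of _ _ z]) (auto simp: z_def)
  qed auto
  ultimately show False
    using compact_imp_bounded not_bounded_UNIV by metis
qed


section \<open>Rank of polynomial maps\<close>

lemma subspace_Rn: "rvec.subspace (Rn n)"
  by (auto simp: rvec.subspace_def Rn_eq)

lemma Rn_basis:
  defines "e \<equiv> \<lambda>i j. if j = i then 1 else (0 :: real)"
  shows "e ` {..<n} \<subseteq> Rn n \<and> Rn n \<subseteq> rvec.span (e ` {..<n}) \<and> rvec.independent (e ` {..<n})"
proof (induction n)
  case 0
  have "Rn 0 = {0}" by (auto simp: Rn_eq)
  then show ?case by (simp add: rvec.independent_empty)
next
  case (Suc n)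
  have eq: "e ` {..<Suc n} = insert (e n) (e ` {..<n})" by (auto simp: lessThan_Suc)
  have "rvec.span (e ` {..<n}) \<subseteq> Rn n"
    using Suc subspace_Rn by (intro rvec.span_minimal) auto
  moreover have "e n \<notin> Rn n" by (auto simp: e_def Rn_eq)
  ultimately have "rvec.independent (e ` {..<Suc n})"
    unfolding eq using Suc by (intro rvec.independent_insertI) auto
  moreover have "e ` {..<Suc n} \<subseteq> Rn (Suc n)" by (auto simp: e_def Rn_eq)
  moreover have "x \<in> rvec.span (e ` {..<Suc n})" if x: "x \<in> Rn (Suc n)" for x
  proof -
    have "x(n := 0) \<in> Rn n" using x by (auto simp: Rn_eq)
    then have 1: "x(n := 0) \<in> rvec.span (e ` {..<Suc n})"
      unfolding eq using Suc rvec.span_mono[OF subset_insertI] by blast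
    have "e n \<in> rvec.span (e ` {..<Suc n})" by (intro rvec.span_base) simp
    then have 2: "(\<lambda>i. x n * e n i) \<in> rvec.span (e ` {..<Suc n})" by (rule rvec.span_scale)
    have "x = x(n := 0) + (\<lambda>i. x n * e n i)" by (auto simp: fun_eq_iff e_def)
    then show ?thesis using rvec.span_add[OF 1 2] by metis
  qed
  ultimately show ?case by blast
qed

lemma dim_Rn: "rvec.dim (Rn n) = n"
proof (rule rvec.dim_unique)
  let ?e = "\<lambda>i j :: nat. if j = i then 1 else (0 :: real)"
  show "?e ` {..<n} \<subseteq> Rn n" "Rn n \<subseteq> rvec.span (?e ` {..<n})" "rvec.independent (?e ` {..<n})"
    using Rn_basis by auto
  have "inj ?e" by (intro injI) (metis zero_neq_one)
  then show "card (?e ` {..<n}) = n" by (simp add: card_image inj_on_subset)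
qed

lemma poly_differential_in_Rn: "poly_differential k ps x v \<in> Rn (length ps)"
  by (simp add: poly_differential_def Rn_eq)

lemma rank_one:
  assumes "i < k" "partial_deriv i (poly_eval P) x \<noteq> 0"
  shows "rvec.dim (poly_differential k [P] x ` Rn k) = 1"
proof -
  have "poly_differential k [P] x ` Rn k = Rn 1"
  proof (intro equalityI subsetI)
    fix y assume y: "y \<in> Rn 1"
    define v where "v j = (if j = i then y 0 / partial_deriv i (poly_eval P) x else 0)" for j
    have "(\<Sum>j<k. partial_deriv j (poly_eval P) x * v j) = (\<Sum>j<k. if j = i then y 0 else 0)"
      using assms by (intro sum.cong) (auto simp: v_def)
    also have "\<dots> = y 0" using assms by simp
    finally have "poly_differential k [P] x v = y"
      using y by (auto simp: poly_differential_def fun_eq_iff Rn_eq)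
    moreover have "v \<in> Rn k" using assms by (auto simp: v_def Rn_eq)
    ultimately show "y \<in> poly_differential k [P] x ` Rn k" by blast
  qed (use poly_differential_in_Rn[of k "[P]"] in auto)
  then show ?thesis by (simp add: dim_Rn)
qed

text \<open>One non-zero minor of size two makes the differential onto \<open>Rn 2\<close>, already
  on vectors supported at \<open>i\<close> and \<open>j\<close>.\<close>

lemma rank_two:
  assumes "i < k" "j < k" "i \<noteq> j"
    and D: "partial_deriv i (poly_eval P) x * partial_deriv j (poly_eval Q) x
      - partial_deriv j (poly_eval P) x * partial_deriv i (poly_eval Q) x \<noteq> 0"
  shows "rvec.dim (poly_differential k [P, Q] x ` Rn k) = 2"
proof -
  define a b c d where "a = partial_deriv i (poly_eval P) x" and "b = partial_deriv j (poly_eval P) x"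
    and "c = partial_deriv i (poly_eval Q) x" and "d = partial_deriv j (poly_eval Q) x"
  have D: "a * d - b * c \<noteq> 0" using assms by (simp add: a_def b_def c_def d_def)
  have "poly_differential k [P, Q] x ` Rn k = Rn 2"
  proof (intro equalityI subsetI)
    fix y assume y: "y \<in> Rn 2"
    \<comment> \<open>\<open>s\<close> and \<open>r\<close> solve the linear system by Cramer's
      rule.\<close>
    define s where "s = (d * y 0 - b * y 1) / (a * d - b * c)"
    define r where "r = (a * y 1 - c * y 0) / (a * d - b * c)"
    define v where "v l = (if l = i then s else if l = j then r else 0)" for l
    have sum: "(\<Sum>l<k. h l * v l) = h i * s + h j * r" for h :: "nat \<Rightarrow> real"
    proof -
      have "(\<Sum>l<k. h l * v l) = (\<Sum>l\<in>{i, j}. h l * v l)"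
        using assms by (intro sum.mono_neutral_right) (auto simp: v_def)
      then show ?thesis using assms by (simp add: v_def)
    qed
    have "a * s + b * r = (a * (d * y 0 - b * y 1) + b * (a * y 1 - c * y 0)) / (a * d - b * c)"
      by (simp add: s_def r_def add_divide_distrib)
    also have "a * (d * y 0 - b * y 1) + b * (a * y 1 - c * y 0) = y 0 * (a * d - b * c)"
      by (simp add: algebra_simps)
    finally have 0: "a * s + b * r = y 0" using D by simp
    have "c * s + d * r = (c * (d * y 0 - b * y 1) + d * (a * y 1 - c * y 0)) / (a * d - b * c)"
      by (simp add: s_def r_def add_divide_distrib)
    also have "c * (d * y 0 - b * y 1) + d * (a * y 1 - c * y 0) = y 1 * (a * d - b * c)"
      by (simp add: algebra_simps)
    finally have 1: "c * s + d * r = y 1" using D by simp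
    have "poly_differential k [P, Q] x v l = y l" for l
    proof -
      consider "l = 0" | "l = 1" | "2 \<le> l" by linarith
      then show ?thesis
        using 0 1 y by cases (auto simp: poly_differential_def sum a_def b_def c_def d_def Rn_eq)
    qed
    then have "poly_differential k [P, Q] x v = y" by auto
    moreover have "v \<in> Rn k" using assms by (auto simp: v_def Rn_eq)
    ultimately show "y \<in> poly_differential k [P, Q] x ` Rn k" by blast
  next
    fix y assume "y \<in> poly_differential k [P, Q] x ` Rn k"
    then show "y \<in> Rn 2" by (auto simp: poly_differential_def Rn_eq)
  qed
  then show ?thesis by (simp add: dim_Rn)
qed

lemma components_in_connected:
  assumes "X \<subseteq> Rn k" "connected X" "X \<noteq> {}"
  shows "components_in k X = {X}"
proof -
  have "connected_space (top_of_set X)"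
    using assms(2) by (simp add: connectedin_def flip: connectedin_iff_connected)
  moreover have "top_of_set X \<noteq> trivial_topology"
    using assms(3) by (metis topspace_euclidean_subtopology topspace_discrete_topology)
  ultimately show ?thesis
    unfolding components_in_def subtopology_Euclidean_space_eq[OF assms(1)]
    by (simp add: connected_components_of_eq_singleton)
qed

text \<open>The zero sets used here are connected, so each is its own single component.\<close>

lemma nonsingular_alg_manifold_byI:
  assumes "\<And>P. P \<in> set ps \<Longrightarrow> poly_in_vars k P" "alg_set k ps = M" "connected M" "M \<noteq> {}"
    and "d + length ps = k" "\<And>x. x \<in> M \<Longrightarrow> rvec.dim (poly_differential k ps x ` Rn k) = length ps"
  shows "nonsingular_alg_manifold_by k d ps M"
proof -
  have "M \<subseteq> Rn k" using assms(2) by (auto simp: alg_set_def)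
  then have "components_in k (alg_set k ps) = {M}"
    using assms components_in_connected by simp
  then show ?thesis
    using assms unfolding nonsingular_alg_manifold_by_def by (auto intro!: exI[of _ "{M}"])
qed


section \<open>Round discs\<close>

text \<open>Ellipsoids are defined as affine images. The unit matrix cuts off the entries from index
  \<open>k\<close> on, so the map is the identity on \<open>Rn k\<close> only.\<close>

lemma affine_transformation_identity:
  obtains T where "affine_transformation k T" "\<And>x. x \<in> Rn k \<Longrightarrow> T x = x"
proof -
  define L where "L = (\<lambda>(x :: nat \<Rightarrow> real) i. if i < k then \<Sum>j<k. (if i = j then 1 else 0) * x j else 0)"
  have L: "L x = x" if "x \<in> Rn k" for x
    using that by (auto simp: L_def fun_eq_iff Rn_eq if_distrib[of "\<lambda>c. c * _"] cong: if_cong)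
  have "bij_betw L (Rn k) (Rn k)"
    by (rule bij_betw_byWitness[where f' = L]) (auto simp: L simp del: topspace_Euclidean_space)
  then have "affine_transformation k (\<lambda>x. L x + (\<lambda>_. 0))"
    unfolding affine_transformation_def L_def
    by (intro exI conjI) (auto simp: Rn_eq)
  moreover have "L x + (\<lambda>_. 0) = x" if "x \<in> Rn k" for x
    using L[OF that] by (auto simp: fun_eq_iff)
  ultimately show ?thesis by (rule that)
qed

locale round_disc =
  fixes c r :: real
  assumes r: "0 < r"
begin

definition P :: "(nat \<Rightarrow> real) \<Rightarrow> real" where
  "P x = r\<^sup>2 - (x 0 - c)\<^sup>2 - (x 1)\<^sup>2"

definition D :: "(nat \<Rightarrow> real) set" where "D = {x \<in> Rn 2. 0 < P x}"

definition E :: "(nat \<Rightarrow> real) set" where "E = {x \<in> Rn 2. 0 \<le> P x}"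

definition S :: "(nat \<Rightarrow> real) set" where "S = {x \<in> Rn 2. P x = 0}"

text \<open>The homothety with factor \<open>s\<close> about the centre (c, 0).\<close>

definition ray :: "(nat \<Rightarrow> real) \<Rightarrow> real \<Rightarrow> nat \<Rightarrow> real" where
  "ray y s = (\<lambda>i. if i = 0 then c + s * (y 0 - c) else if i = 1 then s * y 1 else 0)"

lemma continuous_on_P: "continuous_on X P"
  unfolding P_def by (intro continuous_intros)

lemma continuous_on_ray: "continuous_on X (ray y)"
  unfolding ray_def
  by (intro continuous_on_coordinatewise_then_product continuous_on_If_const continuous_intros)

text \<open>Holds because r^2 - P y is the squared distance to the centre. Thus shrinking moves
  points of the closed disc into the open disc, and stretching moves boundary points out; closure,
  connectedness and frontier are all read off from this.\<close>

lemma P_ray: "P (ray y s) = r\<^sup>2 * (1 - s\<^sup>2) + s\<^sup>2 * P y"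
  by (simp add: P_def ray_def power2_eq_square algebra_simps)

lemma ray_1:
  assumes y: "y \<in> Rn 2"
  shows "ray y 1 = y"
proof
  fix i :: nat
  consider "i = 0" | "i = 1" | "2 \<le> i" by linarith
  then show "ray y 1 i = y i" using y by cases (auto simp: ray_def Rn_eq)
qed

lemma ray_in_Rn: "ray y s \<in> Rn 2"
  by (auto simp: ray_def Rn_eq)

lemma openin_D: "openin (Euclidean_space 2) D"
  unfolding D_def by (intro openin_Rn_positive continuous_on_P)

lemma closedin_E: "closedin (Euclidean_space 2) E"
proof -
  have "closedin (top_of_set (Rn 2)) (Rn 2 \<inter> P -` {0..})"
    by (rule continuous_closedin_preimage[OF continuous_on_P]) simp
  moreover have "Rn 2 \<inter> P -` {0..} = E" by (auto simp: E_def)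
  ultimately show ?thesis by (subst Euclidean_space_eq_top_of_set) simp
qed

lemma ray_in_D:
  assumes "y \<in> E" "0 \<le> s" "s < 1"
  shows "ray y s \<in> D"
proof -
  have "s\<^sup>2 < 1" using assms by (simp add: power_less_one_iff abs_square_less_1)
  then have "0 < r\<^sup>2 * (1 - s\<^sup>2)" using r by simp
  moreover have "0 \<le> s\<^sup>2 * P y" using assms by (simp add: E_def)
  ultimately show ?thesis by (simp add: D_def P_ray ray_in_Rn)
qed

lemma closure_of_D: "Euclidean_space 2 closure_of D = E"
proof (intro equalityI closure_of_minimal[OF _ closedin_E])
  show "D \<subseteq> E" by (auto simp: D_def E_def)
  show "E \<subseteq> Euclidean_space 2 closure_of D"
  proof
    fix y assume y: "y \<in> E"
    \<comment> \<open>\<open>y\<close> itself is the limit of the points \<open>ray y s\<close> of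
      the open disc as \<open>s\<close> increases to 1.\<close>
    have "ray y ` closure {0..<1} \<subseteq> closure (ray y ` {0..<1})"
      by (rule image_closure_subset) (auto intro: continuous_on_ray closure_subset[THEN subsetD])
    then have "ray y 1 \<in> closure (ray y ` {0..<1})" by auto
    moreover have "ray y ` {0..<1} \<subseteq> D" using ray_in_D[OF y] by auto
    ultimately have "ray y 1 \<in> closure D" using closure_mono by blast
    moreover have "y \<in> Rn 2" using y by (simp add: E_def)
    moreover have "Rn 2 \<inter> D = D" by (auto simp: D_def)
    ultimately show "y \<in> Euclidean_space 2 closure_of D"
      by (subst Euclidean_space_eq_top_of_set) (simp add: closure_of_subtopology ray_1)
  qed
qed

lemma connected_D: "connected D"
proof -
  \<comment> \<open>The disc is star-shaped about its centre, and \<open>ray y 0\<close> is the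
    centre for every \<open>y\<close>.\<close>
  have "connected_component D (ray (\<lambda>_. 0) 0) y" if y: "y \<in> D" for y
    unfolding connected_component_def
  proof (intro exI conjI)
    show "connected (ray y ` {0..1})"
      by (intro connected_continuous_image continuous_on_ray) simp
    have "y \<in> E" "y \<in> Rn 2" using y by (auto simp: D_def E_def)
    show "ray y ` {0..1} \<subseteq> D"
    proof
      fix z assume "z \<in> ray y ` {0..1}"
      then obtain s where "z = ray y s" "0 \<le> s" "s \<le> 1" by auto
      then show "z \<in> D"
        using ray_in_D[OF \<open>y \<in> E\<close>, of s] ray_1[OF \<open>y \<in> Rn 2\<close>] y by (cases "s = 1") auto
    qed
    have "ray (\<lambda>_. 0) 0 = ray y 0" by (auto simp: ray_def fun_eq_iff)
    then show "ray (\<lambda>_. 0) 0 \<in> ray y ` {0..1}" by simp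
    show "y \<in> ray y ` {0..1}" using ray_1[OF \<open>y \<in> Rn 2\<close>] by (intro image_eqI[of _ _ 1]) auto
  qed
  then have "connected_component D x y" if "x \<in> D" "y \<in> D" for x y
    using that by (intro connected_component_trans[OF connected_component_sym[of _ "ray (\<lambda>_. 0) 0" x]])
  then show ?thesis by (simp add: connected_iff_connected_component)
qed

lemma frontier_of_E: "Euclidean_space 2 frontier_of E = S"
proof -
  have "y \<notin> Euclidean_space 2 interior_of E" if y: "y \<in> S" for y
  proof
    assume "y \<in> Euclidean_space 2 interior_of E"
    then obtain U where U: "openin (Euclidean_space 2) U" "y \<in> U" "U \<subseteq> E"
      by (auto simp: interior_of_def)
    then obtain V where V: "open V" "U = Rn 2 \<inter> V" using openin_Rn_iff by blast
    have yR: "y \<in> Rn 2" and Py: "P y = 0" using y by (auto simp: S_def)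
    have "open (ray y -` V)" using V(1) continuous_on_ray[of UNIV y] by (simp add: open_vimage)
    moreover have "1 \<in> ray y -` V" using U V ray_1[OF yR] by auto
    ultimately obtain e where e: "0 < e" "ball 1 e \<subseteq> ray y -` V" using openE by blast
    \<comment> \<open>A stretching factor slightly above 1 stays in the given neighbourhood of
      \<open>y\<close> and yet leaves the disc.\<close>
    let ?s = "1 + e / 2"
    have "?s \<in> ball 1 e" using e by (simp add: dist_real_def)
    then have "ray y ?s \<in> U" using e(2) V(2) ray_in_Rn[of y ?s] by blast
    then have "ray y ?s \<in> E" using U(3) by blast
    then have "0 \<le> r\<^sup>2 * (1 - ?s\<^sup>2)" by (simp add: E_def P_ray Py)
    moreover have "1 < ?s\<^sup>2" using e by (intro one_less_power) auto
    moreover from this have "r\<^sup>2 * (1 - ?s\<^sup>2) < 0" using r by (intro mult_pos_neg) auto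
    ultimately show False by linarith
  qed
  moreover have "D \<subseteq> Euclidean_space 2 interior_of E"
    by (rule interior_of_maximal[OF _ openin_D]) (auto simp: D_def E_def)
  moreover have "Euclidean_space 2 closure_of E = E"
    using closedin_E by (simp add: closure_of_closedin)
  ultimately show ?thesis
    unfolding frontier_of_def by (auto simp: S_def D_def E_def)
qed

lemma closure_minus_D: "E - D = S"
  by (auto simp: D_def E_def S_def)

lemma ellipsoid_boundary_S: "ellipsoid_boundary 2 S"
proof -
  obtain T where T: "affine_transformation 2 T" "\<And>x. x \<in> Rn 2 \<Longrightarrow> T x = x"
    by (rule affine_transformation_identity[of 2]) blast
  have "(\<Sum>j<2. (x j - (if j = 0 then c else 0))\<^sup>2 / r\<^sup>2) \<le> 1 \<longleftrightarrow> 0 \<le> P x" for x :: "nat \<Rightarrow> real"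
    using r by (simp add: P_def numeral_2_eq_2 field_simps)
  then have "{x \<in> Rn 2. (\<Sum>j<2. (x j - (if j = 0 then c else 0))\<^sup>2 / r\<^sup>2) \<le> 1} = E"
    by (simp add: E_def)
  moreover have "T ` E = E" using T(2) by (force simp: E_def)
  ultimately have "ellipsoid 2 E"
    unfolding ellipsoid_def using T(1) r
    by (intro exI[of _ "\<lambda>j. if j = 0 then c else 0"] exI[of _ "\<lambda>_. r\<^sup>2"] exI[of _ T]) auto
  then show ?thesis unfolding ellipsoid_boundary_def using frontier_of_E by blast
qed

text \<open>The circle is an affine image of \<open>unit_sphere 1\<close>.\<close>

lemma connected_S: "connected S" and S_nonempty: "S \<noteq> {}"
proof -
  define h :: "(nat \<Rightarrow> real) \<Rightarrow> nat \<Rightarrow> real"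
    where "h y = (\<lambda>i. if i = 0 then c + r * y 0 else if i = 1 then r * y 1 else 0)" for y
  have "continuous_on (unit_sphere 1) h"
    unfolding h_def
    by (intro continuous_on_coordinatewise_then_product continuous_on_If_const continuous_intros)
  moreover have "h ` unit_sphere 1 = S"
  proof (intro equalityI subsetI)
    fix z assume "z \<in> h ` unit_sphere 1"
    then obtain y where y: "z = h y" "(y 0)\<^sup>2 + (y 1)\<^sup>2 = 1"
      by (auto simp: unit_sphere_def numeral_2_eq_2)
    have "P z = r\<^sup>2 * (1 - ((y 0)\<^sup>2 + (y 1)\<^sup>2))"
      by (simp add: y(1) P_def h_def power_mult_distrib algebra_simps)
    then show "z \<in> S" using y by (auto simp: S_def Rn_eq h_def)
  next
    fix z assume z: "z \<in> S"
    define y where "y i = (if i = 0 then (z 0 - c) / r else if i = 1 then z 1 / r else 0)" for i :: nat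
    have "(y 0)\<^sup>2 + (y 1)\<^sup>2 = ((z 0 - c)\<^sup>2 + (z 1)\<^sup>2) / r\<^sup>2"
      by (simp add: y_def power_divide add_divide_distrib)
    also have "\<dots> = 1" using z r by (simp add: S_def P_def)
    finally have "y \<in> unit_sphere 1"
      by (simp add: unit_sphere_def Rn_eq) (simp add: y_def)
    moreover have "h y i = z i" for i
    proof -
      consider "i = 0" | "i = 1" | "2 \<le> i" by linarith
      then show ?thesis using z r by cases (auto simp: h_def y_def S_def Rn_eq)
    qed
    ultimately show "z \<in> h ` unit_sphere 1" by (intro image_eqI[of _ _ y]) auto
  qed
  ultimately show "connected S" "S \<noteq> {}"
    using connected_continuous_image[of "unit_sphere 1" h] connected_unit_sphere[of 1]
      north_pole_in_sphere[of 1] by auto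
qed

lemma polynomial_fun_P: "polynomial_fun 2 2 P"
proof -
  have "polynomial_fun 2 (2 * 1) (\<lambda>x. (x 0 - c) ^ 2)" "polynomial_fun 2 (2 * 1) (\<lambda>x. (x 1) ^ 2)"
    by (intro polynomial_fun_power polynomial_fun_diff polynomial_fun_coordinate
        polynomial_fun_const; simp)+
  then show ?thesis
    unfolding P_def by (intro polynomial_fun_diff polynomial_fun_const) simp_all
qed

text \<open>The quadric chart with d = 1 and k = 2; there are no coordinates beyond the equation, so
  the condition on \<open>e\<close> is vacuous.\<close>

lemma S_slice_chart: "y \<in> S \<Longrightarrow> slice_chart 2 1 0 S y"
proof -
  assume y: "y \<in> S"
  have eq: "S = {z \<in> Rn 2. (\<Sum>j<Suc 1. 1 * (z j - (if j = 0 then c else 0))\<^sup>2) = r\<^sup>2 \<and>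
      (\<forall>j. 1 < j \<and> j < 2 \<longrightarrow> z j = 0)}"
    by (auto simp: S_def P_def)
  show ?thesis
    unfolding eq by (rule slice_chart_quadric[where e = "\<lambda>_. 0"]) (use y[unfolded eq] r in simp_all)
qed

lemma P_partial_deriv:
  "partial_deriv 0 P x = - 2 * (x 0 - c)" "partial_deriv 1 P x = - 2 * x 1"
  unfolding partial_deriv_def P_def
  by (auto intro!: DERIV_imp_deriv derivative_eq_intros)

text \<open>The gradient of \<open>P\<close> vanishes only at the centre, which is not on the
  circle. With a single hypersurface the only index set in the transversality condition is {0},
  where both sides are the same tangent space.\<close>

lemma
  assumes p: "poly_in_vars 2 p" "poly_eval p = P"
  shows alg_set_S: "alg_set 2 [p] = S"
    and NCD_D: "NCD 2 D 1 (\<lambda>_. p) (\<lambda>_. S)"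
proof -
  show alg: "alg_set 2 [p] = S" by (simp add: alg_set_def S_def p)
  have SR: "S \<subseteq> Rn 2" by (auto simp: S_def)
  have rank: "rvec.dim (poly_differential 2 [p] x ` Rn 2) = length [p]" if "x \<in> S" for x
  proof -
    have "x 0 - c \<noteq> 0 \<or> x 1 \<noteq> 0" using that r by (auto simp: S_def P_def)
    then show ?thesis
      using rank_one[of 0 2 p x] rank_one[of 1 2 p x] P_partial_deriv[of x] by (auto simp: p)
  qed
  have man: "nonsingular_alg_manifold_by 2 1 [p] S"
    by (rule nonsingular_alg_manifold_byI) (use p alg connected_S S_nonempty rank in auto)
  have comp: "components_in 2 (alg_set 2 [p]) = {S}"
    unfolding alg by (rule components_in_connected[OF SR connected_S S_nonempty])
  have \<Lambda>: "\<Lambda> = {0}" if "\<Lambda> \<subseteq> {..<1::nat}" "\<Lambda> \<noteq> {}" for \<Lambda> using that by auto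
  have "D \<subseteq> Rn 2" by (auto simp: D_def)
  moreover have "E \<subseteq> Rn 2" by (auto simp: E_def)
  moreover have "(\<Inter>j\<in>\<Lambda>. S) = {} \<or>
      (card \<Lambda> \<le> 2 \<and> nonsingular_alg_manifold 2 (2 - card \<Lambda>) (\<Inter>j\<in>\<Lambda>. S) \<and>
       (\<forall>p\<in>(\<Inter>j\<in>\<Lambda>. S). tangent_space (\<Inter>j\<in>\<Lambda>. S) p = (\<Inter>j\<in>\<Lambda>. tangent_space S p)))"
    if "\<Lambda> \<subseteq> {..<1} \<and> \<Lambda> \<noteq> {}" for \<Lambda> :: "nat set"
    using man \<Lambda>[of \<Lambda>] that by (auto simp: nonsingular_alg_manifold_def)
  ultimately show "NCD 2 D 1 (\<lambda>_. p) (\<lambda>_. S)"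
    unfolding NCD_def closure_of_D
    using openin_D connected_D p man
    by (simp add: connectedin_Rn alg comp[unfolded alg] D_def[symmetric] E_def[symmetric])
qed

end


section \<open>The manifold\<close>

lemma root_3_iff: "u ^ 3 = y \<longleftrightarrow> u = root 3 y" for u y :: real
  using odd_real_root_power_cancel[of 3 u] odd_real_root_pow[of 3 y] by auto

text \<open>\<open>a\<close> and \<open>b\<close> are the outermost prescribed values.
  \<open>A_pos\<close> confines the manifold to a <= x <= b; \<open>Q_roots\<close> says that the
  inner critical values are simple roots, away from the ends. Nothing is asked of the sign of
  \<open>A\<close> inside, which shapes the fibres.\<close>

locale cubic_fibration =
  fixes p :: nat and a b :: real and A Q :: "real poly"
  assumes p: "2 \<le> p" and ab: "a < b"
    and A_pos: "\<And>x. x < a \<or> b < x \<Longrightarrow> 0 < poly A x"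
    and Q_roots: "\<And>x. poly Q x = 0 \<Longrightarrow> a < x \<and> x < b \<and> poly (pderiv Q) x \<noteq> 0"
begin

definition \<beta> :: "real \<Rightarrow> real" where "\<beta> x = (x - a) * (b - x)"

definition G :: "(nat \<Rightarrow> real) \<Rightarrow> real" where
  "G z = poly A (z (p + 1)) * (z 0)\<^sup>2 + (\<Sum>j<p. (z (Suc j))\<^sup>2) - \<beta> (z (p + 1))"

definition H :: "(nat \<Rightarrow> real) \<Rightarrow> real" where
  "H z = z (p + 2) ^ 3 - poly Q (z (p + 1))"

definition M :: "(nat \<Rightarrow> real) set" where
  "M = {z \<in> Rn (p + 3). H z = 0 \<and> G z = 0}"

definition f :: "(nat \<Rightarrow> real) \<Rightarrow> real" where "f z = z (p + 1)"

lemma \<beta>_pos_iff: "0 < \<beta> x \<longleftrightarrow> a < x \<and> x < b"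
  using ab by (auto simp: \<beta>_def zero_less_mult_iff)

lemma \<beta>_zero_iff: "\<beta> x = 0 \<longleftrightarrow> x = a \<or> x = b"
  by (auto simp: \<beta>_def)

text \<open>A negative value at an end would force a zero of \<open>A\<close> outside [a, b] by the
  intermediate value theorem, as \<open>A\<close> is positive further out.\<close>

lemma A_ends: "0 \<le> poly A a" "0 \<le> poly A b"
proof -
  show "0 \<le> poly A a"
  proof (rule ccontr)
    assume "\<not> 0 \<le> poly A a"
    then obtain x where "x < a" "poly A x = 0"
      using poly_IVT_neg[of "a - 1" a A] A_pos[of "a - 1"] by auto
    then show False using A_pos[of x] by simp
  qed
  show "0 \<le> poly A b"
  proof (rule ccontr)
    assume "\<not> 0 \<le> poly A b"
    then obtain x where "b < x" "poly A x = 0"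
      using poly_IVT_pos[of b "b + 1" A] A_pos[of "b + 1"] by auto
    then show False using A_pos[of x] by simp
  qed
qed

text \<open>With the wrong sign of the derivative, \<open>A\<close> would be negative just outside
  the interval. The sign is what keeps the x-derivative of \<open>G\<close> from vanishing over the
  ends.\<close>

lemma A_deriv_ends:
  "poly A a = 0 \<Longrightarrow> poly (pderiv A) a \<le> 0" "poly A b = 0 \<Longrightarrow> 0 \<le> poly (pderiv A) b"
proof -
  show "poly (pderiv A) a \<le> 0" if "poly A a = 0"
  proof (rule ccontr)
    assume "\<not> poly (pderiv A) a \<le> 0"
    then obtain d where "0 < d" "\<And>h. 0 < h \<Longrightarrow> h < d \<Longrightarrow> poly A (a - h) < poly A a"
      using DERIV_pos_inc_left[OF poly_DERIV[of A a]] by auto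
    from this(1) this(2)[of "d / 2"] show False using that A_pos[of "a - d / 2"] by simp
  qed
  show "0 \<le> poly (pderiv A) b" if "poly A b = 0"
  proof (rule ccontr)
    assume "\<not> 0 \<le> poly (pderiv A) b"
    then obtain d where "0 < d" "\<And>h. 0 < h \<Longrightarrow> h < d \<Longrightarrow> poly A (b + h) < poly A b"
      using DERIV_neg_dec_right[OF poly_DERIV[of A b]] by auto
    from this(1) this(2)[of "d / 2"] show False using that A_pos[of "b + d / 2"] by simp
  qed
qed

text \<open>Outside the interval the left side of the equation is non-negative, whereas \<beta> is
  negative.\<close>

lemma M_range:
  assumes "z \<in> M"
  shows "a \<le> f z" "f z \<le> b"
proof -
  have eq: "poly A (f z) * (z 0)\<^sup>2 + (\<Sum>j<p. (z (Suc j))\<^sup>2) = \<beta> (f z)"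
    using assms by (simp add: M_def G_def f_def)
  have s: "0 \<le> (\<Sum>j<p. (z (Suc j))\<^sup>2)" by (simp add: sum_nonneg)
  have "a \<le> f z \<and> f z \<le> b"
  proof (rule ccontr)
    assume out: "\<not> (a \<le> f z \<and> f z \<le> b)"
    then have "0 \<le> poly A (f z) * (z 0)\<^sup>2" using A_pos[of "f z"] by (simp add: less_imp_le not_le)
    then have "0 \<le> \<beta> (f z)" using eq s by linarith
    then have "0 < \<beta> (f z) \<or> \<beta> (f z) = 0" by linarith
    then show False using out ab by (auto simp: \<beta>_pos_iff \<beta>_zero_iff)
  qed
  then show "a \<le> f z" "f z \<le> b" by auto
qed

lemma fibre_eq: "fibre M f s = quadric p (poly A s) (\<beta> s) s (root 3 (poly Q s))"
  unfolding fibre_def M_def quadric_def G_def H_def f_def by (auto simp: root_3_iff)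

text \<open>A continuous section of \<open>f\<close>: the unbounded variable is 0 and the first
  y-variable carries all of \<beta>. It shows that \<open>f\<close> is onto and ties the fibres
  together.\<close>

definition section_curve :: "real \<Rightarrow> nat \<Rightarrow> real" where
  "section_curve s = (\<lambda>i. if i = 1 then sqrt (\<beta> s) else if i = p + 1 then s
     else if i = p + 2 then root 3 (poly Q s) else 0)"

lemma section_curve_in_M:
  assumes "a \<le> s" "s \<le> b"
  shows "section_curve s \<in> M" "f (section_curve s) = s"
proof -
  have \<beta>: "0 \<le> \<beta> s" using assms by (simp add: \<beta>_def)
  obtain q where q: "p = Suc q" using p by (cases p) auto
  have "(\<Sum>j<p. (section_curve s (Suc j))\<^sup>2)
      = (section_curve s (Suc 0))\<^sup>2 + (\<Sum>j<q. (section_curve s (Suc (Suc j)))\<^sup>2)"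
    unfolding q by (rule sum.lessThan_Suc_shift)
  also have "(\<Sum>j<q. (section_curve s (Suc (Suc j)))\<^sup>2) = 0"
  proof (intro sum.neutral ballI)
    fix j assume "j \<in> {..<q}"
    then have "Suc (Suc j) < p + 1" using q by simp
    then show "(section_curve s (Suc (Suc j)))\<^sup>2 = 0" by (simp add: section_curve_def)
  qed
  finally have sum: "(\<Sum>j<p. (section_curve s (Suc j))\<^sup>2) = \<beta> s"
    using \<beta> by (simp add: section_curve_def)
  have s1: "section_curve s (p + 1) = s" "section_curve s (p + 2) = root 3 (poly Q s)"
    "section_curve s 0 = 0"
    using p by (auto simp: section_curve_def)
  have "section_curve s \<in> Rn (p + 3)" using p by (auto simp: section_curve_def Rn_eq)
  then show "section_curve s \<in> M"
    unfolding M_def G_def H_def mem_Collect_eq s1 sum by (simp add: odd_real_root_pow)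
  show "f (section_curve s) = s" unfolding f_def by (rule s1)
qed

lemma f_image: "f ` M = {a..b}"
proof (intro equalityI subsetI)
  fix s assume "s \<in> {a..b}"
  then show "s \<in> f ` M" using section_curve_in_M[of s] by (intro image_eqI[of _ _ "section_curve s"]) auto
qed (use M_range in auto)

lemma M_subset_Rn: "M \<subseteq> Rn (p + 3)"
  by (auto simp: M_def)

lemma fibre_connected_CW:
  assumes "a \<le> s" "s \<le> b"
  shows "connected (fibre M f s)" "CW_complex_dim_le p (top_of_set (fibre M f s))"
proof -
  have "0 \<le> \<beta> s" using assms by (simp add: \<beta>_def)
  moreover have "\<beta> s = 0 \<Longrightarrow> 0 \<le> poly A s" using A_ends by (auto simp: \<beta>_zero_iff)
  ultimately show "connected (fibre M f s)" "CW_complex_dim_le p (top_of_set (fibre M f s))"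
    unfolding fibre_eq by (auto intro: quadric_connected_CW p)
qed

text \<open>Each fibre is connected and meets the connected image of the section.\<close>

lemma connected_M: "connected M"
proof -
  have "continuous_on {a..b} section_curve"
    unfolding section_curve_def \<beta>_def
    by (intro continuous_on_coordinatewise_then_product continuous_on_If_const continuous_intros)
  then have C: "connected (section_curve ` {a..b})" by (intro connected_continuous_image) simp_all
  have CM: "section_curve ` {a..b} \<subseteq> M" using section_curve_in_M by auto
  have "connected_component M (section_curve a) z" if z: "z \<in> M" for z
  proof -
    let ?s = "f z"
    have s: "a \<le> ?s" "?s \<le> b" using M_range[OF z] by auto
    have "connected_component M (section_curve a) (section_curve ?s)"
      unfolding connected_component_def using C CM s ab by (intro exI[of _ "section_curve ` {a..b}"]) auto
    moreover have "connected_component M (section_curve ?s) z"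
      unfolding connected_component_def
      using fibre_connected_CW(1)[OF s] section_curve_in_M[OF s] z
      by (intro exI[of _ "fibre M f ?s"]) (auto simp: fibre_def)
    ultimately show ?thesis by (rule connected_component_trans)
  qed
  then have "connected_component M x y" if "x \<in> M" "y \<in> M" for x y
    using that by (intro connected_component_trans[OF connected_component_sym[of _ "section_curve a" x]])
  then show ?thesis by (simp add: connected_iff_connected_component)
qed

lemma M_nonempty: "M \<noteq> {}"
  using section_curve_in_M[of a] ab by auto

section \<open>Regularity of the defining equations\<close>

lemma polynomial_fun_GH: "\<exists>e. polynomial_fun (p + 3) e G" "\<exists>e. polynomial_fun (p + 3) e H"
proof -
  have co: "polynomial_fun (p + 3) 1 (\<lambda>z. z i)" if "i < p + 3" for i
    using that by (intro polynomial_fun_coordinate) auto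
  obtain e where e: "polynomial_fun (p + 3) e (\<lambda>z. poly A (z (p + 1)))"
    using polynomial_fun_poly[of "p + 1" "p + 3" A] by auto
  have 1: "polynomial_fun (p + 3) (e + 2 * 1) (\<lambda>z. poly A (z (p + 1)) * (z 0) ^ 2)"
    by (intro polynomial_fun_mult e polynomial_fun_power co) simp
  have sq: "polynomial_fun (p + 3) (2 * 1) (\<lambda>z. (z (Suc j)) ^ 2)" if "j < p" for j
    using that by (intro polynomial_fun_power co) simp
  have 2: "polynomial_fun (p + 3) (e + 2 * 1) (\<lambda>z. (z (Suc j)) ^ 2)" if "j < p" for j
    by (rule polynomial_fun_mono[OF sq[OF that]]) simp
  have "polynomial_fun (p + 3) (1 + 1) (\<lambda>z. (z (p + 1) - a) * (b - z (p + 1)))"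
    by (intro polynomial_fun_mult polynomial_fun_diff co polynomial_fun_const) simp_all
  then have 3: "polynomial_fun (p + 3) (e + 2 * 1) (\<lambda>z. (z (p + 1) - a) * (b - z (p + 1)))"
    by (rule polynomial_fun_mono) simp
  have "polynomial_fun (p + 3) (e + 2 * 1) G"
    unfolding G_def \<beta>_def
    by (intro polynomial_fun_diff polynomial_fun_add polynomial_fun_sum 1 2 3) auto
  then show "\<exists>e. polynomial_fun (p + 3) e G" by blast
  obtain e' where "polynomial_fun (p + 3) e' (\<lambda>z. poly Q (z (p + 1)))"
    using polynomial_fun_poly[of "p + 1" "p + 3" Q] by auto
  then have 4: "polynomial_fun (p + 3) (e' + 3 * 1) (\<lambda>z. poly Q (z (p + 1)))"
    by (rule polynomial_fun_mono) simp
  have "polynomial_fun (p + 3) (3 * 1) (\<lambda>z. z (p + 2) ^ 3)"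
    by (intro polynomial_fun_power co) simp
  then have "polynomial_fun (p + 3) (e' + 3 * 1) (\<lambda>z. z (p + 2) ^ 3)"
    by (rule polynomial_fun_mono) simp
  then have "polynomial_fun (p + 3) (e' + 3 * 1) H"
    unfolding H_def by (rule polynomial_fun_diff[OF _ 4])
  then show "\<exists>e. polynomial_fun (p + 3) e H" by blast
qed

lemma partial_deriv_H:
  "partial_deriv (p + 2) H z = 3 * (z (p + 2))\<^sup>2"
  "partial_deriv (p + 1) H z = - poly (pderiv Q) (z (p + 1))"
  "i < p + 1 \<Longrightarrow> partial_deriv i H z = 0"
  unfolding partial_deriv_def H_def
  by (auto intro!: DERIV_imp_deriv derivative_eq_intros)

lemma partial_deriv_G:
  "partial_deriv (p + 2) G z = 0"
  "partial_deriv (p + 1) G z = poly (pderiv A) (z (p + 1)) * (z 0)\<^sup>2 - (a + b - 2 * z (p + 1))"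
  "partial_deriv 0 G z = 2 * poly A (z (p + 1)) * z 0"
  "j < p \<Longrightarrow> partial_deriv (Suc j) G z = 2 * z (Suc j)"
proof -
  show "partial_deriv (p + 2) G z = 0"
    unfolding partial_deriv_def G_def by (auto intro!: DERIV_imp_deriv derivative_eq_intros)
  show "partial_deriv (p + 1) G z = poly (pderiv A) (z (p + 1)) * (z 0)\<^sup>2 - (a + b - 2 * z (p + 1))"
    unfolding partial_deriv_def G_def \<beta>_def
    by (rule DERIV_imp_deriv) (auto intro!: derivative_eq_intros)
  show "partial_deriv 0 G z = 2 * poly A (z (p + 1)) * z 0"
    unfolding partial_deriv_def G_def by (auto intro!: DERIV_imp_deriv derivative_eq_intros)
  show "partial_deriv (Suc j) G z = 2 * z (Suc j)" if j: "j < p"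
  proof -
    have "(\<Sum>l<p. ((z(Suc j := s)) (Suc l))\<^sup>2) = s\<^sup>2 + (\<Sum>l\<in>{..<p} - {j}. (z (Suc l))\<^sup>2)" for s
    proof -
      have "(\<Sum>l<p. ((z(Suc j := s)) (Suc l))\<^sup>2) = ((z(Suc j := s)) (Suc j))\<^sup>2
          + (\<Sum>l\<in>{..<p} - {j}. ((z(Suc j := s)) (Suc l))\<^sup>2)"
        using j by (intro sum.remove) auto
      also have "(\<Sum>l\<in>{..<p} - {j}. ((z(Suc j := s)) (Suc l))\<^sup>2) = (\<Sum>l\<in>{..<p} - {j}. (z (Suc l))\<^sup>2)"
        by (intro sum.cong) auto
      finally show ?thesis by simp
    qed
    then have "G (z(Suc j := s)) = poly A (z (p + 1)) * (z 0)\<^sup>2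
        + (s\<^sup>2 + (\<Sum>l\<in>{..<p} - {j}. (z (Suc l))\<^sup>2)) - \<beta> (z (p + 1))" for s
      using j unfolding G_def by simp
    then show ?thesis
      unfolding partial_deriv_def by (auto intro!: DERIV_imp_deriv derivative_eq_intros)
  qed
qed

text \<open>
  Where the gradient of \<open>G\<close> vanishes in all directions but that of \<open>f\<close>, \<open>f\<close> takes an extremal
  value, and there the remaining partial derivative is non-zero.
\<close>

lemma G_regular:
  assumes z: "z \<in> M"
  obtains j where "j < p + 1" "partial_deriv j G z \<noteq> 0"
  | "\<beta> (f z) = 0" "partial_deriv (p + 1) G z \<noteq> 0"
proof (cases "\<exists>j<p + 1. partial_deriv j G z \<noteq> 0")
  case False
  have eq: "poly A (f z) * (z 0)\<^sup>2 + (\<Sum>j<p. (z (Suc j))\<^sup>2) = \<beta> (f z)"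
    using z by (simp add: M_def G_def f_def)
  have "partial_deriv 0 G z = 0" using False by simp
  then have Az: "poly A (f z) * z 0 = 0" using partial_deriv_G(3)[of z] by (simp add: f_def)
  have "z (Suc j) = 0" if "j < p" for j
    using False partial_deriv_G(4)[OF that, of z] that by auto
  then have "(\<Sum>j<p. (z (Suc j))\<^sup>2) = 0" by simp
  moreover have "poly A (f z) * (z 0)\<^sup>2 = 0" using Az by auto
  ultimately have \<beta>: "\<beta> (f z) = 0" using eq by linarith
  moreover have "partial_deriv (p + 1) G z \<noteq> 0"
  proof -
    consider "f z = a" | "f z = b" using \<beta> by (auto simp: \<beta>_zero_iff)
    then show ?thesis
    proof cases
      case 1
      \<comment> \<open>Either \<open>A\<close> vanishes at the end, and its derivative has the
        right sign, or coordinate 0 vanishes. So at \<open>a\<close> the x-derivative of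
        \<open>G\<close> is at most -(b - a); at \<open>b\<close> it is at least b - a.\<close>
      have "poly (pderiv A) a * (z 0)\<^sup>2 \<le> 0"
        using Az A_deriv_ends(1) 1 by (auto simp: mult_nonpos_nonneg)
      then show ?thesis using 1 ab unfolding partial_deriv_G(2) by (simp add: f_def)
    next
      case 2
      have "0 \<le> poly (pderiv A) b * (z 0)\<^sup>2"
        using Az A_deriv_ends(2) 2 by auto
      then show ?thesis using 2 ab unfolding partial_deriv_G(2) by (simp add: f_def)
    qed
  qed
  ultimately show ?thesis using that by blast
qed (use that in blast)

text \<open>If u is non-zero, the u-derivative of \<open>H\<close> is non-zero while
  \<open>G\<close> is free of u, so any non-zero derivative of \<open>G\<close> completes a minor.
  If u = 0, then x is a root of \<open>Q\<close>, hence strictly inside; there \<open>G\<close> has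
  a non-zero derivative in a direction other than x, and the x-derivative of \<open>H\<close> is
  -Q'(x), which is not 0.\<close>

lemma nonsingular_M: "nonsingular_alg_manifold (p + 3) (p + 1) M"
proof -
  obtain h g where h: "poly_in_vars (p + 3) h" "poly_eval h = H"
    and g: "poly_in_vars (p + 3) g" "poly_eval g = G"
    using polynomial_fun_GH unfolding polynomial_fun_def by blast
  have alg: "alg_set (p + 3) [h, g] = M" by (auto simp: alg_set_def M_def h g)
  have "rvec.dim (poly_differential (p + 3) [h, g] z ` Rn (p + 3)) = 2" if z: "z \<in> M" for z
  proof (cases "z (p + 2) = 0")
    case True
    then have "poly Q (f z) = 0" using z by (simp add: M_def H_def f_def)
    then have Q: "poly (pderiv Q) (f z) \<noteq> 0" "\<beta> (f z) \<noteq> 0"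
      using Q_roots[of "f z"] by (auto simp: \<beta>_zero_iff)
    from z show ?thesis
    proof (cases rule: G_regular)
      case (1 j)
      then show ?thesis
        using Q partial_deriv_H(2)[of z] partial_deriv_H(3)[of j z]
        by (intro rank_two[of "p + 1" _ j]) (simp_all add: h g f_def)
    qed (use Q in simp)
  next
    case False
    have "\<exists>j<p + 2. partial_deriv j G z \<noteq> 0"
      using z
    proof (cases rule: G_regular)
      case (1 j)
      then show ?thesis by (intro exI[of _ j]) auto
    next
      case 2
      then show ?thesis by (intro exI[of _ "p + 1"]) auto
    qed
    then obtain j where j: "j < p + 2" "partial_deriv j G z \<noteq> 0" by auto
    then show ?thesis
      using False partial_deriv_H(1)[of z] partial_deriv_G(1)[of z]
      by (intro rank_two[of "p + 2" _ j]) (simp_all add: h g)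
  qed
  then have "nonsingular_alg_manifold_by (p + 3) (p + 1) [h, g] M"
    by (intro nonsingular_alg_manifold_byI) (use h g alg connected_M M_nonempty in auto)
  then show ?thesis unfolding nonsingular_alg_manifold_def by blast
qed

end


section \<open>Critical points of the function\<close>

lemma eventually_ratio_pos:
  fixes h :: "real \<Rightarrow> real"
  assumes "isCont h x" "h x \<noteq> 0"
  shows "\<exists>\<epsilon>>0. \<forall>s. \<bar>s\<bar> < \<epsilon> \<longrightarrow> 0 < h (x + s) / h x"
proof -
  have "((\<lambda>y. h y / h x) \<longlongrightarrow> h x / h x) (at x)"
    using assms by (intro tendsto_divide) (auto simp: isCont_def)
  then have "\<forall>\<^sub>F y in at x. 0 < h y / h x"
    using assms by (intro order_tendstoD(1)) auto
  then obtain \<epsilon> where \<epsilon>: "0 < \<epsilon>" "\<And>y. y \<noteq> x \<Longrightarrow> dist y x < \<epsilon> \<Longrightarrow> 0 < h y / h x"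
    by (auto simp: eventually_at)
  have "0 < h (x + s) / h x" if "\<bar>s\<bar> < \<epsilon>" for s
    using \<epsilon>(2)[of "x + s"] that assms by (cases "s = 0") (auto simp: dist_real_def)
  then show ?thesis using \<epsilon>(1) by blast
qed

context cubic_fibration
begin

text \<open>Over an end point, \<open>f\<close> is extremal on the whole manifold. Over a root of
  \<open>Q\<close> one has u = 0, so the derivative of u^3 along the curve is 0; it equals Q'(x) x',
  and the root is simple.\<close>

lemma differential_vanishes:
  assumes z: "\<beta> (f z) = 0 \<or> poly Q (f z) = 0" and \<gamma>: "smooth_curve_through M z \<gamma>"
  shows "deriv (\<lambda>s. f (\<gamma> s)) 0 = 0"
proof -
  obtain \<epsilon> where \<epsilon>: "0 < \<epsilon>" "\<And>s. s \<in> {-\<epsilon><..<\<epsilon>} \<Longrightarrow> \<gamma> s \<in> M"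
    and diff: "\<And>s i j. s \<in> {-\<epsilon><..<\<epsilon>} \<Longrightarrow> ((deriv ^^ j) (\<lambda>u. \<gamma> u i)) differentiable (at s)"
    and \<gamma>0: "\<gamma> 0 = z"
    using \<gamma> unfolding smooth_curve_through_def by blast
  have "(\<lambda>u. \<gamma> u i) differentiable (at 0)" for i
    using diff[of 0 0 i] \<epsilon>(1) by simp
  then have der: "\<exists>d. ((\<lambda>u. \<gamma> u i) has_real_derivative d) (at 0)" for i
    using real_differentiable_def by blast
  obtain x' where x': "((\<lambda>s. f (\<gamma> s)) has_real_derivative x') (at 0)"
    using der[of "p + 1"] by (auto simp: f_def)
  have near: "\<gamma> s \<in> M" if "\<bar>0 - s\<bar> < \<epsilon>" for s
    by (rule \<epsilon>(2)) (use that in auto)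
  consider "f z = a" | "f z = b" | "poly Q (f z) = 0" using z by (auto simp: \<beta>_zero_iff)
  then have "x' = 0"
  proof cases
    case 1
    have "\<forall>s. \<bar>0 - s\<bar> < \<epsilon> \<longrightarrow> f (\<gamma> 0) \<le> f (\<gamma> s)"
      using near M_range(1) 1 \<gamma>0 by auto
    then show ?thesis using DERIV_local_min[OF x' \<epsilon>(1)] by blast
  next
    case 2
    have "\<forall>s. \<bar>0 - s\<bar> < \<epsilon> \<longrightarrow> f (\<gamma> s) \<le> f (\<gamma> 0)"
      using near M_range(2) 2 \<gamma>0 by auto
    then show ?thesis using DERIV_local_max[OF x' \<epsilon>(1)] by blast
  next
    case 3
    have cube: "\<gamma> s (p + 2) ^ 3 = poly Q (f (\<gamma> s))" if "\<bar>0 - s\<bar> < \<epsilon>" for s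
      using near[OF that] by (simp add: M_def H_def f_def)
    have "\<gamma> 0 (p + 2) = 0" using cube[of 0] \<epsilon>(1) 3 \<gamma>0 by simp
    moreover obtain u' where "((\<lambda>s. \<gamma> s (p + 2)) has_real_derivative u') (at 0)"
      using der by blast
    ultimately have "((\<lambda>s. \<gamma> s (p + 2) ^ 3) has_real_derivative 0) (at 0)"
      by (auto intro!: derivative_eq_intros)
    moreover have "\<forall>\<^sub>F s in nhds 0. \<gamma> s (p + 2) ^ 3 = poly Q (f (\<gamma> s))"
      unfolding eventually_nhds_metric using \<epsilon>(1) cube by (auto simp: dist_real_def)
    ultimately have "((\<lambda>s. poly Q (f (\<gamma> s))) has_real_derivative 0) (at 0)"
      by (subst (asm) DERIV_cong_ev) auto
    moreover have "((\<lambda>s. poly Q (f (\<gamma> s))) has_real_derivative poly (pderiv Q) (f z) * x') (at 0)"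
      using DERIV_chain2[OF poly_DERIV x', of Q] \<gamma>0 by simp
    ultimately have "poly (pderiv Q) (f z) * x' = 0" using DERIV_unique by blast
    then show ?thesis using Q_roots[OF 3] by simp
  qed
  then show ?thesis using DERIV_imp_deriv[OF x'] by simp
qed

text \<open>The curve moves x at unit speed. One coordinate with a non-zero term is rescaled by a
  square root to keep the quadratic equation, and u by a cube root to keep the cubic one. The
  scaling factors are roots of ratios that equal 1 at s = 0, so they are positive and smooth nearby
  and the curve starts at \<open>z\<close>. The cube root is smooth because \<open>Q\<close> does
  not vanish at the value of \<open>f\<close>.\<close>

lemma differential_surjective:
  assumes z: "z \<in> M" and "\<beta> (f z) \<noteq> 0" "poly Q (f z) \<noteq> 0"
  shows "\<exists>\<gamma>. smooth_curve_through M z \<gamma> \<and> deriv (\<lambda>s. f (\<gamma> s)) 0 = 1"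
proof -
  define x0 where "x0 = f z"
  \<comment> \<open>The coefficient polynomials of the squares: \<open>A\<close> for index 0 and 1
    for the y-variables, so that all coordinates are treated alike.\<close>
  define C where "C j = (if j = 0 then A else 1)" for j :: nat
  have expand: "(\<Sum>j<Suc p. poly (C j) x * (w j)\<^sup>2) = poly A x * (w 0)\<^sup>2 + (\<Sum>j<p. (w (Suc j))\<^sup>2)"
    for x and w :: "nat \<Rightarrow> real"
    by (simp add: sum.lessThan_Suc_shift C_def del: sum.lessThan_Suc)
  have "(\<Sum>j<Suc p. poly (C j) x0 * (z j)\<^sup>2) = \<beta> x0"
    unfolding expand using z by (simp add: M_def G_def f_def x0_def)
  moreover from this have "(\<Sum>j<Suc p. poly (C j) x0 * (z j)\<^sup>2) \<noteq> 0" using assms by (simp add: x0_def)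
  ultimately obtain i where i: "i < Suc p" "poly (C i) x0 * (z i)\<^sup>2 \<noteq> 0"
    by (meson lessThan_iff sum.not_neutral_contains_not_neutral)
  let ?J = "{..<Suc p} - {i}"
  \<comment> \<open>\<open>R x\<close> is the value that the term of index \<open>i\<close> has to
    take when the other coordinates stay fixed.\<close>
  define R where "R x = \<beta> x - (\<Sum>j\<in>?J. poly (C j) x * (z j)\<^sup>2)" for x
  have split: "(\<Sum>j<Suc p. poly (C j) x * (w j)\<^sup>2)
      = poly (C i) x * (w i)\<^sup>2 + (\<Sum>j\<in>?J. poly (C j) x * (w j)\<^sup>2)" for x and w :: "nat \<Rightarrow> real"
    using i by (intro sum.remove) auto
  have R0: "R x0 = poly (C i) x0 * (z i)\<^sup>2"
    using \<open>(\<Sum>j<Suc p. poly (C j) x0 * (z j)\<^sup>2) = \<beta> x0\<close> split[of x0 z] by (simp add: R_def)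
  have ne: "R x0 \<noteq> 0" "poly (C i) x0 \<noteq> 0" "poly Q x0 \<noteq> 0"
    using i R0 assms by (auto simp: x0_def)
  have "isCont R x0" unfolding R_def \<beta>_def by (intro continuous_intros)
  then obtain e1 where e1: "0 < e1" "\<And>s. \<bar>s\<bar> < e1 \<Longrightarrow> 0 < R (x0 + s) / R x0"
    using eventually_ratio_pos ne(1) by blast
  obtain e2 where e2: "0 < e2" "\<And>s. \<bar>s\<bar> < e2 \<Longrightarrow> 0 < poly (C i) (x0 + s) / poly (C i) x0"
    using eventually_ratio_pos[where h = "poly (C i)" and x = x0] ne(2) by auto
  obtain e3 where e3: "0 < e3" "\<And>s. \<bar>s\<bar> < e3 \<Longrightarrow> 0 < poly Q (x0 + s) / poly Q x0"
    using eventually_ratio_pos[where h = "poly Q" and x = x0] ne(3) by auto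
  define \<epsilon> where "\<epsilon> = min e1 (min e2 e3)"
  have \<epsilon>: "0 < \<epsilon>" using e1 e2 e3 by (simp add: \<epsilon>_def)
  \<comment> \<open>The required ratio of squares of coordinate \<open>i\<close>. The exponent -1
    replaces a division and keeps the expression elementary.\<close>
  define W where "W s = (R (x0 + s) / R x0) * (poly (C i) (x0 + s) / poly (C i) x0) powr (-1)" for s
  define \<gamma> where "\<gamma> s l = (if l = i then z i * W s powr (1/2) else if l = p + 1 then x0 + s
    else if l = p + 2 then z (p + 2) * (poly Q (x0 + s) / poly Q x0) powr (1/3) else z l)" for s l
  define U where "U = {x \<in> Rn 1. x 0 \<in> {-\<epsilon><..<\<epsilon>}}"
  have pos: "0 < R (x0 + s) / R x0" "0 < poly (C i) (x0 + s) / poly (C i) x0"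
    "0 < poly Q (x0 + s) / poly Q x0" if "s \<in> {-\<epsilon><..<\<epsilon>}" for s
    using that e1(2)[of s] e2(2)[of s] e3(2)[of s] by (auto simp: \<epsilon>_def)
  have Wpos: "0 < W s" if "s \<in> {-\<epsilon><..<\<epsilon>}" for s
    unfolding W_def using pos(1,2)[OF that] by (intro mult_pos_pos) (metis less_irrefl powr_gt_zero)+
  have x: "elementary U (\<lambda>y. x0 + y 0)"
    by (intro elementary_add elementary_const elementary_coordinate)
  have elR: "elementary U (\<lambda>y. R (x0 + y 0) / R x0)"
  proof -
    have "elementary U (\<lambda>y. (((x0 + y 0) - a) * (b - (x0 + y 0))
        - (\<Sum>j\<in>?J. poly (C j) (x0 + y 0) * (z j)\<^sup>2)) * (1 / R x0))"
      by (intro elementary_mult elementary_diff elementary_sum elementary_poly x elementary_const) auto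
    then show ?thesis by (simp add: R_def \<beta>_def)
  qed
  have elp: "elementary U (\<lambda>y. poly B (x0 + y 0) / poly B x0)" for B
    using elementary_mult[OF elementary_poly[OF x, of B] elementary_const[of U "1 / poly B x0"]] by simp
  have elW: "elementary U (\<lambda>y. W (y 0))"
    unfolding W_def
    by (intro elementary_mult elR elementary_powr elp pos) (simp add: U_def)
  have el: "elementary U (\<lambda>y. \<gamma> (y 0) l)" for l
  proof -
    have 1: "elementary U (\<lambda>y. z i * W (y 0) powr (1/2))"
      by (intro elementary_mult elementary_const elementary_powr elW Wpos) (simp add: U_def)
    have 2: "elementary U (\<lambda>y. z (p + 2) * (poly Q (x0 + y 0) / poly Q x0) powr (1/3))"
      by (intro elementary_mult elementary_const elementary_powr elp pos) (simp add: U_def)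
    show ?thesis
      unfolding \<gamma>_def using 1 2 x elementary_const[of U "z l"]
      by (cases "l = i"; cases "l = p + 1"; cases "l = p + 2") simp_all
  qed
  have W0: "W 0 = 1" using ne by (simp add: W_def)
  have \<gamma>0: "\<gamma> 0 = z"
    using ne by (auto simp: \<gamma>_def fun_eq_iff W0 x0_def f_def)
  have x1: "\<gamma> s (p + 1) = x0 + s" for s using i by (simp add: \<gamma>_def)
  have M: "\<gamma> s \<in> M" if s: "s \<in> {-\<epsilon><..<\<epsilon>}" for s
  proof -
    have "poly (C i) (x0 + s) * (\<gamma> s i)\<^sup>2 = R (x0 + s)"
    proof -
      have inv: "0 < y \<Longrightarrow> y powr (-1) = inverse y" for y :: real
        by (simp add: powr_minus)
      have "(\<gamma> s i)\<^sup>2 = (z i)\<^sup>2 * W s"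
        using Wpos[OF s] by (simp add: \<gamma>_def power_mult_distrib powr_half_sqrt)
      also have "W s = R (x0 + s) / R x0 * (poly (C i) x0 / poly (C i) (x0 + s))"
        unfolding W_def inv[OF pos(2)[OF s]] inverse_divide ..
      also have "(z i)\<^sup>2 * \<dots> = R (x0 + s) / poly (C i) (x0 + s)"
        using ne i unfolding R0 by simp
      finally show ?thesis using pos(2)[OF s] by auto
    qed
    moreover have "(\<Sum>j\<in>?J. poly (C j) (x0 + s) * (\<gamma> s j)\<^sup>2) = (\<Sum>j\<in>?J. poly (C j) (x0 + s) * (z j)\<^sup>2)"
      by (intro sum.cong) (auto simp: \<gamma>_def)
    ultimately have "(\<Sum>j<Suc p. poly (C j) (x0 + s) * (\<gamma> s j)\<^sup>2) = \<beta> (x0 + s)"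
      unfolding split by (simp add: R_def)
    then have G: "G (\<gamma> s) = 0" unfolding expand G_def x1 by simp
    have cube: "0 < y \<Longrightarrow> (y powr (1/3)) ^ 3 = y" for y :: real
      by (simp add: powr_power)
    have "((poly Q (x0 + s) / poly Q x0) powr (1/3)) ^ 3 = poly Q (x0 + s) / poly Q x0"
      by (rule cube[OF pos(3)[OF s]])
    then have "\<gamma> s (p + 2) ^ 3 = z (p + 2) ^ 3 * (poly Q (x0 + s) / poly Q x0)"
      using i by (simp add: \<gamma>_def power_mult_distrib)
    also have "z (p + 2) ^ 3 = poly Q x0" using z by (simp add: M_def H_def x0_def f_def)
    finally have "H (\<gamma> s) = 0" unfolding H_def x1 using ne by simp
    moreover have "\<gamma> s \<in> Rn (p + 3)" using z i by (auto simp: \<gamma>_def M_def Rn_eq)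
    ultimately show ?thesis using G by (simp add: M_def)
  qed
  have "smooth_curve_through M z \<gamma>"
  proof (rule smooth_curve_through_elementary[OF \<epsilon> U_def el])
    show "\<gamma> s l = \<gamma> (((\<lambda>_. 0)(0 := s)) 0) l" for s l by simp
  qed (use M \<gamma>0 in auto)
  moreover have "deriv (\<lambda>s. f (\<gamma> s)) 0 = 1"
    unfolding f_def x1 by (rule DERIV_imp_deriv) (auto intro!: derivative_eq_intros)
  ultimately show ?thesis by blast
qed

text \<open>The image of the differential lies in the real line, so a rank below 1 means that it is
  contained in {0}; a curve with derivative 1 rules this out.\<close>

lemma singular_set_eq: "singular_set (p + 1) M f = {z \<in> M. \<beta> (f z) = 0 \<or> poly Q (f z) = 0}"
proof -
  have "dim (differential_image M f z) = 0 \<longleftrightarrow> \<beta> (f z) = 0 \<or> poly Q (f z) = 0" if z: "z \<in> M" for z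
  proof -
    have "differential_image M f z \<subseteq> {0}" if "\<beta> (f z) = 0 \<or> poly Q (f z) = 0"
      using differential_vanishes[OF that] by (auto simp: differential_image_def)
    moreover have "1 \<in> differential_image M f z" if "\<not> (\<beta> (f z) = 0 \<or> poly Q (f z) = 0)"
      using differential_surjective[OF z] that by (force simp: differential_image_def)
    ultimately show ?thesis
      unfolding dim_eq_0 by (metis singletonD subsetD zero_neq_one)
  qed
  then show ?thesis by (auto simp: singular_set_def min_def)
qed

lemma singular_values: "f ` singular_set (p + 1) M f = {a, b} \<union> {x. poly Q x = 0}"
proof -
  have "s \<in> f ` {z \<in> M. \<beta> (f z) = 0 \<or> poly Q (f z) = 0}" if "s \<in> {a, b} \<union> {x. poly Q x = 0}" for s
  proof -
    have "a \<le> s" "s \<le> b" using that ab Q_roots[of s] by auto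
    from section_curve_in_M[OF this] show ?thesis
      using that by (intro image_eqI[of _ _ "section_curve s"]) (auto simp: \<beta>_zero_iff)
  qed
  then show ?thesis unfolding singular_set_eq by (auto simp: \<beta>_zero_iff)
qed

lemma prescribed_fibres_M:
  assumes "t 1 = a" "t l = b" "t ` {1..l} = {a, b} \<union> {x. poly Q x = 0}"
    and lam: "\<And>j s. j \<in> {1..l - 1} \<Longrightarrow> s \<in> {t j<..<t (j + 1)} \<Longrightarrow>
      a < s \<and> s < b \<and> (lam j = 0 \<longrightarrow> 0 < poly A s) \<and> (lam j = 1 \<longrightarrow> poly A s < 0)"
  shows "prescribed_fibres l t lam (p + 1) (p + 3) M f"
proof -
  have sub: "fibre M f s \<subseteq> Rn (p + 3)" for s using M_subset_Rn by (auto simp: fibre_def)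
  have sm: "smooth_submanifold (p + 3) p (fibre M f s)" if "a < s" "s < b" for s
    using that \<beta>_pos_iff[of s] unfolding fibre_eq by (intro smooth_submanifold_quadric) auto
  have main: "(lam j = 0 \<longrightarrow> compact (fibre M f s) \<and> smooth_submanifold (p + 3) p (fibre M f s) \<and>
         connected (fibre M f s)) \<and>
      (lam j = 1 \<longrightarrow> connected (fibre M f s) \<and> \<not> compact (fibre M f s) \<and>
         smooth_submanifold (p + 3) p (fibre M f s))"
    if j: "j \<in> {1..l - 1}" "s \<in> {t j<..<t (j + 1)}" for j s
  proof -
    have s: "a < s" "s < b" and \<beta>: "0 < \<beta> s" using lam[OF j] by (auto simp: \<beta>_pos_iff)
    have "lam j = 0 \<Longrightarrow> compact (fibre M f s)"
      unfolding fibre_eq using lam[OF j] \<beta> by (intro compact_quadric) auto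
    moreover have "lam j = 1 \<Longrightarrow> \<not> compact (fibre M f s)"
      unfolding fibre_eq using lam[OF j] \<beta> p by (intro not_compact_quadric) auto
    ultimately show ?thesis
      using sm[OF s] fibre_connected_CW(1)[of s] s by auto
  qed
  have CW: "connected (fibre M f s) \<and> (\<exists>Y :: (nat \<Rightarrow> real) topology. CW_complex_dim_le p Y \<and>
      subtopology (Euclidean_space (p + 3)) (fibre M f s) homeomorphic_space Y)" if "s \<in> {a..b}" for s
    using fibre_connected_CW[of s] that
    by (auto simp: subtopology_Euclidean_space_eq[OF sub] intro!: exI[of _ "top_of_set (fibre M f s)"]
        homeomorphic_space_refl)
  show ?thesis
    unfolding prescribed_fibres_def
    using f_image singular_values assms(1-3) main CW
    by (simp add: connectedin_Rn[OF sub] compactin_Rn[OF sub])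
qed

end


section \<open>The map onto the disc in the plane\<close>

context cubic_fibration
begin

text \<open>\<open>A\<close> is non-negative at both ends and its derivative is bounded by some L,
  so by the mean value theorem -A is at most L times the distance to the nearer end. The function
  \<beta> grows at least linearly in this distance.\<close>

lemma A_lower_bound: "\<exists>C\<ge>0. \<forall>x\<in>{a..b}. - poly A x \<le> C * \<beta> x"
proof -
  have "compact (poly (pderiv A) ` {a..b})"
    by (intro compact_continuous_image continuous_intros) simp
  then obtain L where L: "\<And>x. x \<in> {a..b} \<Longrightarrow> \<bar>poly (pderiv A) x\<bar> \<le> L"
    using compact_imp_bounded bounded_iff[of "poly (pderiv A) ` {a..b}"] by (metis imageI real_norm_def)
  have L0: "0 \<le> L" using L[of a] ab by auto
  have left: "- poly A x \<le> L * (x - a)" if x: "x \<in> {a..b}" for x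
  proof (cases "x = a")
    case True
    then show ?thesis using A_ends by simp
  next
    case False
    then obtain y where y: "a < y" "y < x" "poly A x - poly A a = (x - a) * poly (pderiv A) y"
      using poly_MVT[of a x A] x by auto
    then have "- poly (pderiv A) y \<le> L" using L[of y] x by auto
    then have "(x - a) * (- poly (pderiv A) y) \<le> (x - a) * L" using x by (intro mult_left_mono) auto
    then have "- ((x - a) * poly (pderiv A) y) \<le> L * (x - a)" by (simp add: mult.commute)
    then show ?thesis using y(3) A_ends(1) by linarith
  qed
  have right: "- poly A x \<le> L * (b - x)" if x: "x \<in> {a..b}" for x
  proof (cases "x = b")
    case True
    then show ?thesis using A_ends by simp
  next
    case False
    then obtain y where y: "x < y" "y < b" "poly A b - poly A x = (b - x) * poly (pderiv A) y"
      using poly_MVT[of x b A] x by auto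
    then have "poly (pderiv A) y \<le> L" using L[of y] x by auto
    then have "(b - x) * poly (pderiv A) y \<le> (b - x) * L" using x by (intro mult_left_mono) auto
    then have "(b - x) * poly (pderiv A) y \<le> L * (b - x)" by (simp add: mult.commute)
    then show ?thesis using y(3) A_ends(2) by linarith
  qed
  \<comment> \<open>At distance d from the nearer end the other end is at least (b - a) / 2 away, so
    \<beta> is at least d (b - a) / 2; this gives the constant.\<close>
  have "- poly A x \<le> 2 * L / (b - a) * \<beta> x" if x: "x \<in> {a..b}" for x
  proof -
    have "\<exists>d\<ge>0. - poly A x \<le> L * d \<and> d * ((b - a) / 2) \<le> \<beta> x"
    proof (cases "x - a \<le> b - x")
      case True
      then have "(x - a) * ((b - a) / 2) \<le> \<beta> x"
        unfolding \<beta>_def using x by (intro mult_left_mono) auto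
      then show ?thesis using left[OF x] x by (intro exI[of _ "x - a"]) auto
    next
      case False
      then have "(b - x) * ((b - a) / 2) \<le> (b - x) * (x - a)"
        using x by (intro mult_left_mono) auto
      then have "(b - x) * ((b - a) / 2) \<le> \<beta> x" by (simp add: \<beta>_def mult.commute)
      then show ?thesis using right[OF x] x by (intro exI[of _ "b - x"]) auto
    qed
    then obtain d where d: "- poly A x \<le> L * d" "d * ((b - a) / 2) \<le> \<beta> x" by auto
    have "L * d = 2 * L / (b - a) * (d * ((b - a) / 2))" using ab by simp
    also have "\<dots> \<le> 2 * L / (b - a) * \<beta> x"
      using d(2) L0 ab by (intro mult_left_mono) auto
    finally show ?thesis using d(1) by linarith
  qed
  then show ?thesis using L0 ab by (intro exI[of _ "2 * L / (b - a)"]) auto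
qed

definition C :: real where "C = (SOME C. C \<ge> 0 \<and> (\<forall>x\<in>{a..b}. - poly A x \<le> C * \<beta> x))"

lemma C: "0 \<le> C" "x \<in> {a..b} \<Longrightarrow> - poly A x \<le> C * \<beta> x"
  using someI_ex[of "\<lambda>C. C \<ge> 0 \<and> (\<forall>x\<in>{a..b}. - poly A x \<le> C * \<beta> x)"] A_lower_bound
  unfolding C_def by auto

text \<open>The denominator squeezes the unbounded fibres of \<open>f\<close> into the disc.\<close>

definition g :: "(nat \<Rightarrow> real) \<Rightarrow> nat \<Rightarrow> real" where
  "g z = (\<lambda>i. if i = 0 then z (p + 1) else if i = 1 then z 1 / (1 + C * (z 0)\<^sup>2) else 0)"

lemma algebraic_fun_f: "algebraic_fun (p + 3) M f"
proof -
  obtain P where "poly_in_vars (p + 3) P" "poly_eval P = (\<lambda>z. z (p + 1))"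
    using polynomial_fun_coordinate[of "p + 1" "p + 3" 1] by (auto simp: polynomial_fun_def)
  moreover obtain P' where "poly_in_vars (p + 3) P'" "poly_eval P' = (\<lambda>z. 1)"
    using polynomial_fun_const[of "p + 3" 0 1] by (auto simp: polynomial_fun_def)
  ultimately show ?thesis
    unfolding algebraic_fun_def by (intro exI[of _ P] exI[of _ P']) (auto simp: f_def)
qed

lemma f_eq_g: "f z = g z 0"
  by (simp add: f_def g_def)

lemma denominator_ge_1: "1 \<le> 1 + C * (z 0)\<^sup>2" for z :: "nat \<Rightarrow> real"
  using C(1) by simp

lemma algebraic_map_g: "algebraic_map (p + 3) M 2 g"
proof -
  have "polynomial_fun (p + 3) (0 + 2 * 1) (\<lambda>z. 1 + C * (z 0) ^ 2)"
    by (intro polynomial_fun_add polynomial_fun_mult polynomial_fun_power polynomial_fun_const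
        polynomial_fun_coordinate) simp_all
  then obtain P' where P': "poly_in_vars (p + 3) P'" "poly_eval P' = (\<lambda>z. 1 + C * (z 0)\<^sup>2)"
    by (auto simp: polynomial_fun_def)
  obtain P where P: "poly_in_vars (p + 3) P" "poly_eval P = (\<lambda>z. z 1)"
    using polynomial_fun_coordinate[of 1 "p + 3" 1] by (auto simp: polynomial_fun_def)
  have "1 + C * (z 0)\<^sup>2 \<noteq> 0" for z :: "nat \<Rightarrow> real" using denominator_ge_1[of z] by linarith
  then have "algebraic_fun (p + 3) M (\<lambda>z. g z 1)"
    unfolding algebraic_fun_def using P P' by (intro exI[of _ P] exI[of _ P']) (auto simp: g_def)
  moreover have "algebraic_fun (p + 3) M (\<lambda>z. g z 0)"
    using algebraic_fun_f unfolding f_eq_g[abs_def] .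
  ultimately have "algebraic_fun (p + 3) M (\<lambda>z. g z i)" if "i < 2" for i
    using that by (cases "i = 0") (auto simp: less_2_cases_iff)
  then show ?thesis
    unfolding algebraic_map_def by (auto simp: g_def Rn_eq)
qed

text \<open>With N = 1 + C w^2, w being coordinate 0, one has y_1^2 <= \<beta> - A w^2 <= \<beta> N
  <= \<beta> N^2, so the quotient y_1 / N stays in the disc. Conversely the points with w = 0, where
  N = 1, already cover the disc.\<close>

lemma g_image: "g ` M = {y \<in> Rn 2. (y 1)\<^sup>2 \<le> \<beta> (y 0)}"
proof (intro equalityI subsetI)
  fix y assume "y \<in> g ` M"
  then obtain z where z: "z \<in> M" "y = g z" by auto
  have x: "f z \<in> {a..b}" using M_range[OF z(1)] by simp
  have \<beta>: "0 \<le> \<beta> (f z)" using x by (simp add: \<beta>_def)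
  let ?N = "1 + C * (z 0)\<^sup>2"
  have "(z (Suc 0))\<^sup>2 \<le> (\<Sum>j<p. (z (Suc j))\<^sup>2)"
    using p by (intro member_le_sum[of 0]) auto
  also have "\<dots> = \<beta> (f z) + - poly A (f z) * (z 0)\<^sup>2"
    using z by (simp add: M_def G_def f_def)
  also have "\<dots> \<le> \<beta> (f z) + C * \<beta> (f z) * (z 0)\<^sup>2"
    using C(2)[OF x] by (intro add_left_mono mult_right_mono) auto
  also have "\<dots> = \<beta> (f z) * ?N" by (simp add: algebra_simps)
  also have "\<dots> \<le> \<beta> (f z) * ?N * ?N"
    using mult_left_mono[of 1 ?N "\<beta> (f z) * ?N"] \<beta> denominator_ge_1[of z] by simp
  finally have "(z (Suc 0))\<^sup>2 \<le> \<beta> (f z) * ?N\<^sup>2" by (simp add: power2_eq_square mult.assoc)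
  then have "(z (Suc 0) / ?N)\<^sup>2 \<le> \<beta> (f z)"
    using denominator_ge_1[of z] by (simp add: power_divide divide_le_eq)
  then show "y \<in> {y \<in> Rn 2. (y 1)\<^sup>2 \<le> \<beta> (y 0)}"
    by (simp add: z g_def Rn_eq f_def)
next
  fix y assume y: "y \<in> {y \<in> Rn 2. (y 1)\<^sup>2 \<le> \<beta> (y 0)}"
  define s where "s = y 0"
  have le: "(y 1)\<^sup>2 \<le> \<beta> s" using y by (simp add: s_def)
  \<comment> \<open>The second y-variable takes up the rest of \<beta>; it exists because p is at
    least 2.\<close>
  define z where "z i = (if i = 1 then y 1 else if i = 2 then sqrt (\<beta> s - (y 1)\<^sup>2)
    else if i = p + 1 then s else if i = p + 2 then root 3 (poly Q s) else 0)" for i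
  obtain q where "p = 2 + q" using p le_iff_add by blast
  then have q: "p = Suc (Suc q)" by simp
  have "(\<Sum>j<p. (z (Suc j))\<^sup>2) = (z 1)\<^sup>2 + ((z 2)\<^sup>2 + (\<Sum>j<q. (z (Suc (Suc (Suc j))))\<^sup>2))"
    unfolding q sum.lessThan_Suc_shift by (simp add: numeral_2_eq_2)
  also have "(\<Sum>j<q. (z (Suc (Suc (Suc j))))\<^sup>2) = 0"
  proof (intro sum.neutral ballI)
    fix j assume "j \<in> {..<q}"
    then have "Suc (Suc (Suc j)) < p + 1" using q by simp
    then show "(z (Suc (Suc (Suc j))))\<^sup>2 = 0" by (simp add: z_def)
  qed
  finally have sum: "(\<Sum>j<p. (z (Suc j))\<^sup>2) = \<beta> s" using le by (simp add: z_def)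
  have z': "z (p + 1) = s" "z (p + 2) = root 3 (poly Q s)" "z 0 = 0" "z 1 = y 1"
    using p by (auto simp: z_def)
  have "z \<in> Rn (p + 3)" using p by (auto simp: z_def Rn_eq)
  then have "z \<in> M"
    unfolding M_def G_def H_def mem_Collect_eq z' sum by (simp add: odd_real_root_pow)
  moreover have "g z i = y i" for i
  proof -
    consider "i = 0" | "i = 1" | "2 \<le> i" by linarith
    then show ?thesis
    proof cases
      case 1
      then show ?thesis unfolding g_def z' by (simp add: s_def)
    next
      case 2
      then show ?thesis unfolding g_def z' by simp
    next
      case 3
      then show ?thesis using y by (simp add: g_def Rn_eq)
    qed
  qed
  ultimately show "y \<in> g ` M" by (intro image_eqI[of _ _ z]) auto
qed

end

section \<open>Prescribed singular values\<close>

lemma poly_prod_linear: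
  fixes t :: "nat \<Rightarrow> real"
  shows "poly (\<Prod>j\<in>J. [:- t j, 1:]) x = (\<Prod>j\<in>J. x - t j)"
  unfolding poly_prod by (intro prod.cong) simp_all

text \<open>At a root only the summand in which the vanishing factor is differentiated survives, and
  it is a product of differences of distinct numbers.\<close>

lemma pderiv_prod_linear_nonzero:
  fixes t :: "nat \<Rightarrow> real"
  assumes "finite J" "inj_on t J" "j \<in> J"
  shows "poly (pderiv (\<Prod>j\<in>J. [:- t j, 1:])) (t j) \<noteq> 0"
proof -
  have eq: "(\<Prod>j\<in>J. [:- t j, 1:]) = [:- t j, 1:] * (\<Prod>i\<in>J - {j}. [:- t i, 1:])"
    using assms by (intro prod.remove) auto
  have "poly (pderiv (\<Prod>j\<in>J. [:- t j, 1:])) (t j) = (\<Prod>i\<in>J - {j}. t j - t i)"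
    unfolding eq pderiv_mult poly_add poly_mult by (simp add: poly_prod_linear pderiv_pCons)
  also have "\<dots> \<noteq> 0"
    using assms by (auto dest: inj_onD)
  finally show ?thesis .
qed

text \<open>The quadratic factor of index j is negative exactly on the open interval from t_j to
  t_(j+1). These intervals are disjoint, so on each of them at most one factor of \<open>A\<close>
  is negative, and \<open>A\<close> is positive outside [t_1, t_l].\<close>

lemma exists_fibration_data:
  fixes l :: nat and t :: "nat \<Rightarrow> real" and lam :: "nat \<Rightarrow> nat"
  assumes "l > 1" and mono: "strict_mono_on {1..l} t" and "2 \<le> p"
  obtains A Q where "cubic_fibration p (t 1) (t l) A Q"
    "t ` {1..l} = {t 1, t l} \<union> {x. poly Q x = 0}"
    "\<And>j s. j \<in> {1..l - 1} \<Longrightarrow> s \<in> {t j<..<t (j + 1)} \<Longrightarrow>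
      t 1 < s \<and> s < t l \<and> (lam j = 0 \<longrightarrow> 0 < poly A s) \<and> (lam j = 1 \<longrightarrow> poly A s < 0)"
proof -
  have less: "t i < t j" if "1 \<le> i" "i < j" "j \<le> l" for i j
    using strict_mono_onD[OF mono, of i j] that by simp
  have le: "t i \<le> t j" if "1 \<le> i" "i \<le> j" "j \<le> l" for i j
    using less[of i j] that by (cases "i = j") auto
  have inj: "inj_on t {1..l}" by (rule strict_mono_on_imp_inj_on[OF mono])
  define J where "J = {j \<in> {1..l - 1}. lam j = 1}"
  \<comment> \<open>Only the inner values are roots. For l = 2 the product is empty and equals 1,
    without roots.\<close>
  define Q where "Q = (\<Prod>j\<in>{2..l - 1}. [:- t j, 1:])"
  define A where "A = (\<Prod>j\<in>J. [:- t j, 1:] * [:- t (j + 1), 1:])"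
  have J: "finite J" "\<And>j. j \<in> J \<Longrightarrow> 1 \<le> j \<and> j + 1 \<le> l \<and> lam j = 1" using assms(1) by (auto simp: J_def)
  have A: "poly A x = (\<Prod>j\<in>J. (x - t j) * (x - t (j + 1)))" for x
    unfolding A_def poly_prod by (intro prod.cong) (simp_all add: algebra_simps)
  have Q: "poly Q x = 0 \<longleftrightarrow> x \<in> t ` {2..l - 1}" for x
    by (auto simp: Q_def poly_prod)
  have pos: "0 < poly A x" if x: "x < t 1 \<or> t l < x" for x
    unfolding A
  proof (intro prod_pos)
    fix j assume "j \<in> J"
    then have j: "1 \<le> j" "j + 1 \<le> l" using J(2) by auto
    then have "t 1 \<le> t j" "t j \<le> t (j + 1)" "t (j + 1) \<le> t l" by (auto intro!: le)
    then show "0 < (x - t j) * (x - t (j + 1))"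
      using x by (auto simp: zero_less_mult_iff)
  qed
  have "cubic_fibration p (t 1) (t l) A Q"
  proof
    show "2 \<le> p" "t 1 < t l" using assms less[of 1 l] by auto
    fix x
    show "x < t 1 \<or> t l < x \<Longrightarrow> 0 < poly A x" by (rule pos)
    assume "poly Q x = 0"
    then obtain j where j: "j \<in> {2..l - 1}" "x = t j" using Q by auto
    have "t 1 < x" "x < t l" using j assms(1) by (auto intro!: less)
    moreover have "poly (pderiv Q) x \<noteq> 0"
      unfolding Q_def j(2)
      by (rule pderiv_prod_linear_nonzero[OF _ inj_on_subset[OF inj]]) (use j in auto)
    ultimately show "t 1 < x \<and> x < t l \<and> poly (pderiv Q) x \<noteq> 0" by simp
  qed
  moreover have "t ` {1..l} = {t 1, t l} \<union> {x. poly Q x = 0}"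
  proof -
    have "{1..l} = {1, l} \<union> {2..l - 1}" using assms(1) by auto
    then show ?thesis unfolding Q by auto
  qed
  moreover have "t 1 < s \<and> s < t l \<and> (lam j = 0 \<longrightarrow> 0 < poly A s) \<and> (lam j = 1 \<longrightarrow> poly A s < 0)"
    if j: "j \<in> {1..l - 1}" and s: "s \<in> {t j<..<t (j + 1)}" for j s
  proof -
    have jl: "1 \<le> j" "j + 1 \<le> l" using j assms(1) by auto
    have "t 1 \<le> t j" "t (j + 1) \<le> t l" using jl by (auto intro!: le)
    then have "t 1 < s" "s < t l" using s by auto
    \<comment> \<open>Both roots of a factor with another index lie on the same side of
      \<open>s\<close>, even for the neighbouring intervals, which share an end point.\<close>
    have other: "0 < (s - t i) * (s - t (i + 1))" if "i \<in> J" "i \<noteq> j" for i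
    proof -
      have i: "1 \<le> i" "i + 1 \<le> l" using J(2) that by auto
      consider "i < j" | "j < i" using \<open>i \<noteq> j\<close> by linarith
      then show ?thesis
      proof cases
        case 1
        then have "t i \<le> t j" "t (i + 1) \<le> t j" using i jl by (auto intro!: le)
        then show ?thesis using s by (auto simp: zero_less_mult_iff)
      next
        case 2
        then have "t (j + 1) \<le> t i" "t (j + 1) \<le> t (i + 1)" using i jl by (auto intro!: le)
        then show ?thesis using s by (auto simp: zero_less_mult_iff)
      qed
    qed
    have "0 < poly A s" if "lam j = 0"
      unfolding A using other J(2) that by (intro prod_pos) force
    moreover have "poly A s < 0" if "lam j = 1"
    proof -
      have "j \<in> J" using that j by (simp add: J_def)
      then have "poly A s = (s - t j) * (s - t (j + 1)) * (\<Prod>i\<in>J - {j}. (s - t i) * (s - t (i + 1)))"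
        unfolding A using J(1) by (intro prod.remove)
      moreover have "0 < (\<Prod>i\<in>J - {j}. (s - t i) * (s - t (i + 1)))"
        using other by (intro prod_pos) auto
      moreover have "(s - t j) * (s - t (j + 1)) < 0" using s by (auto simp: mult_less_0_iff)
      ultimately show ?thesis by (simp add: mult_neg_pos)
    qed
    ultimately show ?thesis using \<open>t 1 < s\<close> \<open>s < t l\<close> by blast
  qed
  ultimately show ?thesis by (rule that)
qed


text \<open>Completing the square turns \<beta>(x) - v^2 >= 0 into a round disc whose diameter is
  the segment from t_1 to t_l. Its boundary circle is the only hypersurface, so disjointness from
  the others is vacuous.\<close>

lemma exists_fibration_over_disc:
  fixes l :: nat and t :: "nat \<Rightarrow> real" and lam :: "nat \<Rightarrow> nat"
  assumes "l > 1" "strict_mono_on {1..l} t" "3 \<le> m"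
  shows "\<exists>k M f g D r P S.
        nonsingular_alg_manifold k m M \<and> connectedin (Euclidean_space k) M \<and>
        algebraic_fun k M f \<and> prescribed_fibres l t lam m k M f \<and>
        algebraic_map k M 2 g \<and> (\<forall>x\<in>M. f x = g x 0) \<and>
        NCD 2 D r P S \<and> g ` M = Euclidean_space 2 closure_of D \<and>
        (\<exists>\<F>. finite \<F> \<and> (Euclidean_space 2 closure_of D) - D = \<Union>\<F> \<and>
           (\<forall>F\<in>\<F>. smooth_submanifold_corners 2 (2 - 1) F \<and>
              connectedin (Euclidean_space 2) F \<and> (\<exists>j<r. F \<subseteq> S j))) \<and>
        (\<forall>j<r. \<exists>q. poly_in_vars 2 q \<and> poly_degree_le 2 q \<and>
           S j \<in> components_in 2 (alg_set 2 [q])) \<and>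
        (\<forall>j<r. affine_subspace 2 (S j) \<or>
           (\<exists>H. hyperbola_cylinder 2 H \<and> S j \<in> components_in 2 H) \<or>
           ellipsoid_boundary 2 (S j)) \<and>
        (\<forall>j0<r. ellipsoid_boundary 2 (S j0) \<longrightarrow>
           (\<forall>j<r. j \<noteq> j0 \<longrightarrow> S j \<inter> S j0 = {}))"
proof -
  \<comment> \<open>There are p + 3 coordinates and two equations, so the dimension is p + 1; the
    bound on \<open>m\<close> makes p at least 2.\<close>
  obtain p where p: "m = p + 1" "2 \<le> p"
    using assms(3) by (intro that[of "m - 1"]) auto
  obtain A Q where AQ: "cubic_fibration p (t 1) (t l) A Q"
    "t ` {1..l} = {t 1, t l} \<union> {x. poly Q x = 0}"
    "\<And>j s. j \<in> {1..l - 1} \<Longrightarrow> s \<in> {t j<..<t (j + 1)} \<Longrightarrow>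
      t 1 < s \<and> s < t l \<and> (lam j = 0 \<longrightarrow> 0 < poly A s) \<and> (lam j = 1 \<longrightarrow> poly A s < 0)"
    using exists_fibration_data[OF assms(1,2) p(2), of lam] by metis
  interpret F: cubic_fibration p "t 1" "t l" A Q by (rule AQ(1))
  interpret B: round_disc "(t 1 + t l) / 2" "(t l - t 1) / 2"
    by unfold_locales (use F.ab in simp)
  have P_eq: "B.P y = F.\<beta> (y 0) - (y 1)\<^sup>2" for y
    unfolding B.P_def F.\<beta>_def by (simp add: power2_eq_square field_simps)
  have E: "F.g ` F.M = B.E" unfolding F.g_image B.E_def P_eq by auto
  obtain q where q: "poly_in_vars 2 q" "poly_degree_le 2 q" "poly_eval q = B.P"
    using B.polynomial_fun_P by (auto simp: polynomial_fun_def)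
  have SR: "B.S \<subseteq> Rn 2" unfolding B.S_def by auto
  have comp: "B.S \<in> components_in 2 (alg_set 2 [q])"
    unfolding B.alg_set_S[OF q(1,3)] components_in_connected[OF SR B.connected_S B.S_nonempty] by simp
  have corners: "smooth_submanifold_corners 2 (2 - 1) B.S"
    using SR B.S_slice_chart unfolding smooth_submanifold_corners_def by auto
  have FM: "connectedin (Euclidean_space (p + 3)) F.M"
    unfolding connectedin_Rn[OF F.M_subset_Rn] by (rule F.connected_M)
  have fib: "prescribed_fibres l t lam (p + 1) (p + 3) F.M F.f"
    using AQ by (intro F.prescribed_fibres_M) auto
  show ?thesis
  proof (intro exI conjI)
    show "nonsingular_alg_manifold (p + 3) m F.M" unfolding p by (rule F.nonsingular_M)
    show "connectedin (Euclidean_space (p + 3)) F.M" by (rule FM)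
    show "algebraic_fun (p + 3) F.M F.f" by (rule F.algebraic_fun_f)
    show "prescribed_fibres l t lam m (p + 3) F.M F.f" unfolding p by (rule fib)
    show "algebraic_map (p + 3) F.M 2 F.g" by (rule F.algebraic_map_g)
    show "\<forall>x\<in>F.M. F.f x = F.g x 0" using F.f_eq_g by blast
    show "NCD 2 B.D 1 (\<lambda>_. q) (\<lambda>_. B.S)" by (rule B.NCD_D[OF q(1,3)])
    show "F.g ` F.M = Euclidean_space 2 closure_of B.D" unfolding E B.closure_of_D ..
    show "finite {B.S}" by simp
    show "Euclidean_space 2 closure_of B.D - B.D = \<Union> {B.S}"
      unfolding B.closure_of_D B.closure_minus_D by simp
    show "\<forall>F\<in>{B.S}. smooth_submanifold_corners 2 (2 - 1) F \<and>
        connectedin (Euclidean_space 2) F \<and> (\<exists>j<1::nat. F \<subseteq> B.S)"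
      using corners connectedin_Rn[OF SR] B.connected_S by simp
    show "\<forall>j<1::nat. \<exists>q. poly_in_vars 2 q \<and> poly_degree_le 2 q \<and> B.S \<in> components_in 2 (alg_set 2 [q])"
      using q comp by blast
    show "\<forall>j<1::nat. affine_subspace 2 B.S \<or> (\<exists>H. hyperbola_cylinder 2 H \<and> B.S \<in> components_in 2 H) \<or>
        ellipsoid_boundary 2 B.S"
      using B.ellipsoid_boundary_S by simp
    show "\<forall>j0<1::nat. ellipsoid_boundary 2 B.S \<longrightarrow> (\<forall>j<1. j \<noteq> j0 \<longrightarrow> B.S \<inter> B.S = {})"
      by simp
  qed
qed

theorem theorem1:
  fixes l :: nat and t :: "nat \<Rightarrow> real" and lam :: "nat \<Rightarrow> nat"
  assumes "l > 1"
    and "strict_mono_on {1..l} t"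
    and "lam ` {1..l - 1} \<subseteq> {0, 1}"
  shows
    "(\<exists>m0. \<forall>m\<ge>m0. \<exists>k M f.
        nonsingular_alg_manifold k m M \<and> connectedin (Euclidean_space k) M \<and>
        algebraic_fun k M f \<and> prescribed_fibres l t lam m k M f) \<and>
     (\<exists>n>1. \<exists>m1>n. \<forall>m\<ge>m1. \<exists>k M f g D r P S.
        nonsingular_alg_manifold k m M \<and> connectedin (Euclidean_space k) M \<and>
        algebraic_fun k M f \<and> prescribed_fibres l t lam m k M f \<and>
        algebraic_map k M n g \<and> (\<forall>x\<in>M. f x = g x 0) \<and>
        NCD n D r P S \<and> g ` M = Euclidean_space n closure_of D \<and>
        (\<exists>\<F>. finite \<F> \<and> (Euclidean_space n closure_of D) - D = \<Union>\<F> \<and>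
           (\<forall>F\<in>\<F>. smooth_submanifold_corners n (n - 1) F \<and>
              connectedin (Euclidean_space n) F \<and> (\<exists>j<r. F \<subseteq> S j))) \<and>
        (\<forall>j<r. \<exists>q. poly_in_vars n q \<and> poly_degree_le 2 q \<and>
           S j \<in> components_in n (alg_set n [q])) \<and>
        (\<forall>j<r. affine_subspace n (S j) \<or>
           (\<exists>H. hyperbola_cylinder n H \<and> S j \<in> components_in n H) \<or>
           ellipsoid_boundary n (S j)) \<and>
        (\<forall>j0<r. ellipsoid_boundary n (S j0) \<longrightarrow>
           (\<forall>j<r. j \<noteq> j0 \<longrightarrow> S j \<inter> S j0 = {})))"
proof -
  note over_disc = exists_fibration_over_disc[OF assms(1,2)]
  have "\<exists>k M f. nonsingular_alg_manifold k m M \<and> connectedin (Euclidean_space k) M \<and>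
      algebraic_fun k M f \<and> prescribed_fibres l t lam m k M f" if "3 \<le> m" for m
    using over_disc[OF that, of lam] by (elim exE conjE) (intro exI conjI)
  \<comment> \<open>The bound 3 for \<open>m\<close> serves both claims, and the plane n = 2 serves
    for the second.\<close>
  then show ?thesis
    using over_disc by (intro conjI exI[of _ "3 :: nat"] exI[of _ "2 :: nat"]) simp_all
qed

end
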